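(* Let $N$ be a paraquaternionic CR-submanifold of a paraquaternionic K\"ahler manifold $(M,\sigma,g)$, and let $\mathfrak{F}^\perp$ be the canonical totally real foliation on $N$. The following assertions are equivalent: (i) $\mathfrak{F}^\perp$ is totally geodesic; (ii) $B(X,Y)\in\Gamma(\nu)$ for all $X\in\Gamma(\mathcal{D})$, $Y\in\Gamma(\mathcal{D}^\perp)$; (iii) $A_\xi X\in\Gamma(\mathcal{D}^\perp)$ for all $X\in\Gamma(\mathcal{D}^\perp)$, $\xi\in\Gamma(\nu^\perp)$; (iv) $A_\xi Y\in\Gamma(\mathcal{D})$ for all $Y\in\Gamma(\mathcal{D})$, $\xi\in\Gamma(\nu^\perp)$.
   Context: Everything is smooth; $\Gamma(E)$ denotes the sections of a bundle $E$. Put $\epsilon_1=1$, $\epsilon_2=\epsilon_3=-1$; indices $\alpha\in\{1,2,3\}$ are taken modulo 3. An almost paraquaternionic structure on $M$ is a rank-3 subbundle $\sigma\subset \mathrm{End}(TM)$ admitting on coordinate neighborhoods $U$ a canonical local basis $\{J_1,J_2,J_3\}$ with $J_\alpha^2=-\epsilon_\alpha \mathrm{Id}$ and $J_\alpha J_{\alpha+1}=-J_{\alpha+1}J_\alpha=\epsilon_{\alpha+2}J_{\alpha+2}$; on overlaps two canonical local bases are related by an $SO(2,1)$-valued matrix of functions. $(M,\sigma,g)$ is almost paraquaternionic hermitian if $g$ is a semi-Riemannian metric with $g(J_\alpha X,J_\alpha Y)=\epsilon_\alpha g(X,Y)$ for all $\alpha$ and all canonical local bases. It is paraquaternionic K\"ahler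 if moreover $\sigma$ is parallel with respect to the Levi-Civita connection $\overline\nabla$ of $g$; equivalently there are local 1-forms $\omega_1,\omega_2,\omega_3$ with $\overline\nabla_XJ_\alpha=-\epsilon_\alpha[\omega_{\alpha+2}(X)J_{\alpha+1}-\omega_{\alpha+1}(X)J_{\alpha+2}]$. A non-degenerate (immersed) submanifold $N$ of $M$ is one on which the induced metric, again denoted $g$, is non-degenerate; $TN^\perp$ is the normal bundle. It is a paraquaternionic CR-submanifold if there is a non-degenerate distribution $\mathcal{D}\subset TN$ such that, for every canonical local basis on $U$ and $x\in U\cap N$, $J_\alpha\mathcal{D}_x=\mathcal{D}_x$ and $J_\alpha\mathcal{D}^\perp_x\subset T_x^\perp N$ for $\alpha\in\{1,2,3\}$, where $\mathcal{D}^\perp$ is the orthogonal complement of $\mathcal{D}$ in $TN$. Let $\nu^\perp=J_1\mathcal{D}^\perp\oplus J_2\mathcal{D}^\perp\oplus J_3\mathcal{D}^\perp\subset TN^\perp$ (independent of the canonical local basis) and $\nu$ its orthogonal complement in $TN^\perp$. With $\nabla$ the Levi-Civita connection of $N$, the Gauss and Weingarten formulas are $\overline\nabla_XY=\nabla_XY+B(X,Y)$ and $\overline\nabla_X\xi=-A_\xi X+\nabla^\perp_X\xi$ for $X,Y\in\Gamma(TN)$, $\xi\in\Gamma(TN^\perp)$, with $B(X,Y),\nabla^\perp_X\xi$ normal and $A_\xi X$ tangent to $N$. The distribution $\mathcal{D}^\perp$ is always integrable; $\mathfrak{F}^\perp$ denotes the foliation of $N$ whose leaves are the integral manifolds of $\mathcal{D}^\perp$.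 It is totally geodesic if its leaves are totally geodesic in $N$, i.e. $\nabla_XZ\in\Gamma(\mathcal{D}^\perp)$ for all $X,Z\in\Gamma(\mathcal{D}^\perp)$. *)

theory Defs
  imports "HOL-Analysis.Analysis"
begin

section \<open>Smooth maps between open subsets of normed spaces\<close>

primrec ck_on :: "nat \<Rightarrow> 'a::real_normed_vector set \<Rightarrow> ('a \<Rightarrow> 'b::real_normed_vector) \<Rightarrow> bool" where
  "ck_on 0 S f \<longleftrightarrow> continuous_on S f"
| "ck_on (Suc k) S f \<longleftrightarrow>
     (\<forall>x\<in>S. f differentiable (at x)) \<and> (\<forall>v. ck_on k S (\<lambda>x. frechet_derivative f (at x) v))"

definition smooth_on :: "'a::real_normed_vector set \<Rightarrow> ('a \<Rightarrow> 'b::real_normed_vector) \<Rightarrow> bool" where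
  "smooth_on S f \<longleftrightarrow> (\<forall>k. ck_on k S f)"


section \<open>Smooth manifolds\<close>

text \<open>A manifold is a (Hausdorff, second countable) type with a smooth atlas. A chart is a pair of
  its domain and its coordinate map; the coordinate map is irrelevant off the domain.\<close>

type_synonym ('m, 'e) chart = "'m set \<times> ('m \<Rightarrow> 'e)"

definition cinv :: "('m, 'e) chart \<Rightarrow> 'e \<Rightarrow> 'm" where
  "cinv c = inv_into (fst c) (snd c)"

definition smooth_atlas ::
    "('m::{t2_space,second_countable_topology}, 'e::euclidean_space) chart set \<Rightarrow> bool" where
  "smooth_atlas A \<longleftrightarrow>
     \<Union> (fst ` A) = UNIV \<and>
     (\<forall>c\<in>A. open (fst c) \<and> open (snd c ` fst c) \<and>
        homeomorphism (fst c) (snd c ` fst c) (snd c) (cinv c)) \<and>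
     (\<forall>c\<in>A. \<forall>d\<in>A. smooth_on (snd c ` (fst c \<inter> fst d)) (snd d \<circ> cinv c))"

text \<open>Once and for all we select a preferred chart at each point and use it to identify the
  tangent space \<open>T\<^sub>pM\<close> with the model space \<open>'e\<close>. Thus a tangent vector at \<open>p\<close> is an element of
  \<open>'e\<close>, a vector field is a function \<open>'m \<Rightarrow> 'e\<close>, an endomorphism of \<open>T\<^sub>pM\<close> is an element of
  \<open>'e \<Rightarrow>\<^sub>L 'e\<close>. As the preferred chart changes from point to point, smoothness of such objects is
  always expressed in a fixed chart, by means of \<open>tcoord\<close> and \<open>coord_field\<close>.\<close>

definition chart_at :: "('m, 'e) chart set \<Rightarrow> 'm \<Rightarrow> ('m, 'e) chart" where
  "chart_at A p = (SOME c. c \<in> A \<and> p \<in> fst c)"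

text \<open>The components, in the chart \<open>c\<close>, of the tangent vector \<open>v\<close> at \<open>p\<close> (that is, the
  differential of the coordinate map), and the vector field with constant components \<open>v\<close>
  in the chart \<open>c\<close>.\<close>

definition tcoord ::
    "('m, 'e::euclidean_space) chart set \<Rightarrow> ('m, 'e) chart \<Rightarrow> 'm \<Rightarrow> 'e \<Rightarrow> 'e" where
  "tcoord A c p v =
     frechet_derivative (snd c \<circ> cinv (chart_at A p)) (at (snd (chart_at A p) p)) v"

definition coord_field ::
    "('m, 'e::euclidean_space) chart set \<Rightarrow> ('m, 'e) chart \<Rightarrow> 'e \<Rightarrow> 'm \<Rightarrow> 'e" where
  "coord_field A c v p = frechet_derivative (snd (chart_at A p) \<circ> cinv c) (at (snd c p)) v"

definition smooth_fun ::
    "('m, 'e::euclidean_space) chart set \<Rightarrow> 'm set \<Rightarrow> ('m \<Rightarrow> real) \<Rightarrow> bool" where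
  "smooth_fun A W h \<longleftrightarrow> (\<forall>c\<in>A. smooth_on (snd c ` (fst c \<inter> W)) (h \<circ> cinv c))"

definition smooth_field ::
    "('m, 'e::euclidean_space) chart set \<Rightarrow> 'm set \<Rightarrow> ('m \<Rightarrow> 'e) \<Rightarrow> bool" where
  "smooth_field A W X \<longleftrightarrow>
     (\<forall>c\<in>A. smooth_on (snd c ` (fst c \<inter> W)) (\<lambda>x. tcoord A c (cinv c x) (X (cinv c x))))"

definition smooth_endo ::
    "('m, 'e::euclidean_space) chart set \<Rightarrow> 'm set \<Rightarrow> ('m \<Rightarrow> 'e \<Rightarrow>\<^sub>L 'e) \<Rightarrow> bool" where
  "smooth_endo A W s \<longleftrightarrow>
     (\<forall>c\<in>A. \<forall>v. smooth_on (snd c ` (fst c \<inter> W))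
        (\<lambda>x. tcoord A c (cinv c x) (blinfun_apply (s (cinv c x)) (coord_field A c v (cinv c x)))))"

definition smooth_map ::
    "('n::topological_space, 'f::euclidean_space) chart set \<Rightarrow>
     ('m::topological_space, 'e::euclidean_space) chart set \<Rightarrow> ('n \<Rightarrow> 'm) \<Rightarrow> bool" where
  "smooth_map AN AM f \<longleftrightarrow> continuous_on UNIV f \<and>
     (\<forall>c\<in>AN. \<forall>d\<in>AM. smooth_on (snd c ` (fst c \<inter> f -` fst d)) (snd d \<circ> f \<circ> cinv c))"

text \<open>The derivative \<open>v(h)\<close> of a function along a tangent vector at \<open>p\<close>, and the differential of
  a map at \<open>p\<close>.\<close>

definition dir_deriv ::
    "('m, 'e::euclidean_space) chart set \<Rightarrow> 'm \<Rightarrow> 'e \<Rightarrow> ('m \<Rightarrow> real) \<Rightarrow> real" where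
  "dir_deriv A p v h = frechet_derivative (h \<circ> cinv (chart_at A p)) (at (snd (chart_at A p) p)) v"

definition mdiff ::
    "('n, 'f::euclidean_space) chart set \<Rightarrow> ('m, 'e::euclidean_space) chart set \<Rightarrow>
     ('n \<Rightarrow> 'm) \<Rightarrow> 'n \<Rightarrow> 'f \<Rightarrow> 'e" where
  "mdiff AN AM f p v =
     frechet_derivative (snd (chart_at AM (f p)) \<circ> f \<circ> cinv (chart_at AN p))
       (at (snd (chart_at AN p) p)) v"


section \<open>Metrics and the Levi-Civita connection\<close>

definition semi_riemannian_metric ::
    "('m::topological_space, 'e::euclidean_space) chart set \<Rightarrow> ('m \<Rightarrow> 'e \<Rightarrow> 'e \<Rightarrow> real) \<Rightarrow> bool" where
  "semi_riemannian_metric A g \<longleftrightarrow>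
     (\<forall>p. bilinear (g p) \<and> (\<forall>u v. g p u v = g p v u) \<and> (\<forall>u. (\<forall>v. g p u v = 0) \<longrightarrow> u = 0)) \<and>
     (\<forall>c\<in>A. \<forall>u v. smooth_on (snd c ` fst c)
        (\<lambda>x. g (cinv c x) (coord_field A c u (cinv c x)) (coord_field A c v (cinv c x))))"

text \<open>\<open>nab p v Y\<close> is the covariant derivative at \<open>p\<close> of the vector field \<open>Y\<close>, smooth on some open
  neighbourhood of \<open>p\<close>, in the direction of the tangent vector \<open>v\<close>. (That it only depends on the
  germ of \<open>Y\<close> at \<open>p\<close> follows from the Leibniz rule, as \<open>h\<close> ranges over locally defined
  functions.)\<close>

type_synonym ('m, 'e) connection = "'m \<Rightarrow> 'e \<Rightarrow> ('m \<Rightarrow> 'e) \<Rightarrow> 'e"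

definition affine_connection ::
    "('m::topological_space, 'e::euclidean_space) chart set \<Rightarrow> ('m, 'e) connection \<Rightarrow> bool" where
  "affine_connection A nab \<longleftrightarrow> (\<forall>W. open W \<longrightarrow>
     (\<forall>Y p. smooth_field A W Y \<and> p \<in> W \<longrightarrow> linear (\<lambda>v. nab p v Y)) \<and>
     (\<forall>Y Z p v. smooth_field A W Y \<and> smooth_field A W Z \<and> p \<in> W \<longrightarrow>
        nab p v (\<lambda>q. Y q + Z q) = nab p v Y + nab p v Z) \<and>
     (\<forall>h Y p v. smooth_fun A W h \<and> smooth_field A W Y \<and> p \<in> W \<longrightarrow>
        nab p v (\<lambda>q. h q *\<^sub>R Y q) = dir_deriv A p v h *\<^sub>R Y p + h p *\<^sub>R nab p v Y) \<and>
     (\<forall>X Y. smooth_field A W X \<and> smooth_field A W Y \<longrightarrow> smooth_field A W (\<lambda>q. nab q (X q) Y)))"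

definition is_lie_bracket ::
    "('m::topological_space, 'e::euclidean_space) chart set \<Rightarrow> 'm set \<Rightarrow>
     ('m \<Rightarrow> 'e) \<Rightarrow> ('m \<Rightarrow> 'e) \<Rightarrow> ('m \<Rightarrow> 'e) \<Rightarrow> bool" where
  "is_lie_bracket A W X Y Z \<longleftrightarrow>
     (\<forall>V h p. open V \<and> V \<subseteq> W \<and> smooth_fun A V h \<and> p \<in> V \<longrightarrow>
        dir_deriv A p (Z p) h =
          dir_deriv A p (X p) (\<lambda>q. dir_deriv A q (Y q) h) -
          dir_deriv A p (Y p) (\<lambda>q. dir_deriv A q (X q) h))"

definition levi_civita ::
    "('m::topological_space, 'e::euclidean_space) chart set \<Rightarrow> ('m \<Rightarrow> 'e \<Rightarrow> 'e \<Rightarrow> real) \<Rightarrow>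
     ('m, 'e) connection \<Rightarrow> bool" where
  "levi_civita A g nab \<longleftrightarrow>
     affine_connection A nab \<and>
     (\<forall>W X Y. open W \<and> smooth_field A W X \<and> smooth_field A W Y \<longrightarrow>
        is_lie_bracket A W X Y (\<lambda>p. nab p (X p) Y - nab p (Y p) X)) \<and>
     (\<forall>W Y Z p v. open W \<and> smooth_field A W Y \<and> smooth_field A W Z \<and> p \<in> W \<longrightarrow>
        dir_deriv A p v (\<lambda>q. g q (Y q) (Z q)) = g p (nab p v Y) (Z p) + g p (Y p) (nab p v Z))"


section \<open>Paraquaternionic Kaehler manifolds\<close>

text \<open>The indices modulo 3 are the elements of the type \<open>3\<close>, in which \<open>3 = 0\<close>.\<close>

definition eps :: "3 \<Rightarrow> real" where
  "eps \<alpha> = (if \<alpha> = 1 then 1 else -1)"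

definition canonical_basis ::
    "('m::topological_space, 'e::euclidean_space) chart set \<Rightarrow> ('m \<Rightarrow> ('e \<Rightarrow>\<^sub>L 'e) set) \<Rightarrow>
     'm set \<Rightarrow> (3 \<Rightarrow> 'm \<Rightarrow> 'e \<Rightarrow>\<^sub>L 'e) \<Rightarrow> bool" where
  "canonical_basis A \<sigma> U J \<longleftrightarrow> open U \<and>
     (\<forall>\<alpha>. smooth_endo A U (J \<alpha>)) \<and>
     (\<forall>p\<in>U. inj (\<lambda>\<alpha>. J \<alpha> p) \<and> independent (range (\<lambda>\<alpha>. J \<alpha> p)) \<and>
        span (range (\<lambda>\<alpha>. J \<alpha> p)) = \<sigma> p) \<and>
     (\<forall>p\<in>U. \<forall>\<alpha>.
        J \<alpha> p o\<^sub>L J \<alpha> p = - eps \<alpha> *\<^sub>R id_blinfun \<and>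
        J \<alpha> p o\<^sub>L J (\<alpha> + 1) p = eps (\<alpha> + 2) *\<^sub>R J (\<alpha> + 2) p \<and>
        J (\<alpha> + 1) p o\<^sub>L J \<alpha> p = - eps (\<alpha> + 2) *\<^sub>R J (\<alpha> + 2) p)"

definition SO21 :: "(real^3^3) set" where
  "SO21 = (let \<eta> = (\<chi> i j. if i = j then eps i else 0)
           in {a. a ** \<eta> ** transpose a = \<eta> \<and> det a = 1})"

definition almost_paraquaternionic ::
    "('m::topological_space, 'e::euclidean_space) chart set \<Rightarrow> ('m \<Rightarrow> ('e \<Rightarrow>\<^sub>L 'e) set) \<Rightarrow> bool" where
  "almost_paraquaternionic A \<sigma> \<longleftrightarrow>
     (\<forall>p. \<exists>U J. p \<in> U \<and> canonical_basis A \<sigma> U J) \<and>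
     (\<forall>U J U' J'. canonical_basis A \<sigma> U J \<and> canonical_basis A \<sigma> U' J' \<longrightarrow>
        (\<exists>a :: 'm \<Rightarrow> real^3^3.
           (\<forall>\<alpha> \<beta>. smooth_fun A (U \<inter> U') (\<lambda>q. a q $ \<alpha> $ \<beta>)) \<and>
           (\<forall>q\<in>U \<inter> U'. a q \<in> SO21 \<and> (\<forall>\<alpha>. J' \<alpha> q = (\<Sum>\<beta>\<in>UNIV. a q $ \<alpha> $ \<beta> *\<^sub>R J \<beta> q)))))"

definition almost_paraquaternionic_hermitian ::
    "('m::topological_space, 'e::euclidean_space) chart set \<Rightarrow> ('m \<Rightarrow> ('e \<Rightarrow>\<^sub>L 'e) set) \<Rightarrow>
     ('m \<Rightarrow> 'e \<Rightarrow> 'e \<Rightarrow> real) \<Rightarrow> bool" where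
  "almost_paraquaternionic_hermitian A \<sigma> g \<longleftrightarrow>
     almost_paraquaternionic A \<sigma> \<and> semi_riemannian_metric A g \<and>
     (\<forall>U J. canonical_basis A \<sigma> U J \<longrightarrow>
        (\<forall>p\<in>U. \<forall>\<alpha> u v. g p (J \<alpha> p u) (J \<alpha> p v) = eps \<alpha> * g p u v))"

text \<open>\<open>\<sigma>\<close> is parallel: for every local section \<open>s\<close> of \<open>\<sigma>\<close> and every tangent vector \<open>v\<close>, the
  covariant derivative \<open>t = \<nabla>\<^sub>v s\<close>, given by \<open>(\<nabla>\<^sub>v s) Y = \<nabla>\<^sub>v (s Y) - s (\<nabla>\<^sub>v Y)\<close>, is again in \<open>\<sigma>\<close>.\<close>

definition parallel_subbundle ::
    "('m::topological_space, 'e::euclidean_space) chart set \<Rightarrow> ('m, 'e) connection \<Rightarrow>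
     ('m \<Rightarrow> ('e \<Rightarrow>\<^sub>L 'e) set) \<Rightarrow> bool" where
  "parallel_subbundle A nab \<sigma> \<longleftrightarrow>
     (\<forall>W s p v. open W \<and> smooth_endo A W s \<and> (\<forall>q\<in>W. s q \<in> \<sigma> q) \<and> p \<in> W \<longrightarrow>
        (\<exists>t\<in>\<sigma> p. \<forall>Y. smooth_field A W Y \<longrightarrow>
           blinfun_apply t (Y p) = nab p v (\<lambda>q. s q (Y q)) - s p (nab p v Y)))"

definition paraquaternionic_kaehler ::
    "('m::{t2_space,second_countable_topology}, 'e::euclidean_space) chart set \<Rightarrow>
     ('m \<Rightarrow> ('e \<Rightarrow>\<^sub>L 'e) set) \<Rightarrow> ('m \<Rightarrow> 'e \<Rightarrow> 'e \<Rightarrow> real) \<Rightarrow> ('m, 'e) connection \<Rightarrow> bool" where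
  "paraquaternionic_kaehler A \<sigma> g nab \<longleftrightarrow>
     smooth_atlas A \<and> almost_paraquaternionic_hermitian A \<sigma> g \<and> levi_civita A g nab \<and>
     parallel_subbundle A nab \<sigma>"


section \<open>Non-degenerate immersed submanifolds\<close>

text \<open>The submanifold is the immersion \<open>f\<close> of the manifold with atlas \<open>AN\<close> into the one with atlas
  \<open>AM\<close>. Vectors tangent to the submanifold live in \<open>'f\<close>, vectors of the ambient manifold
  at \<open>f p\<close> in \<open>'e\<close>; the inclusion \<open>T\<^sub>pN \<subseteq> T\<^bsub>f p\<^esub>M\<close> is \<open>mdiff AN AM f p\<close>.\<close>

definition induced_metric ::
    "('n, 'f::euclidean_space) chart set \<Rightarrow> ('m, 'e::euclidean_space) chart set \<Rightarrow> ('n \<Rightarrow> 'm) \<Rightarrow>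
     ('m \<Rightarrow> 'e \<Rightarrow> 'e \<Rightarrow> real) \<Rightarrow> 'n \<Rightarrow> 'f \<Rightarrow> 'f \<Rightarrow> real" where
  "induced_metric AN AM f g p u v = g (f p) (mdiff AN AM f p u) (mdiff AN AM f p v)"

definition nondegenerate_submanifold ::
    "('n::{t2_space,second_countable_topology}, 'f::euclidean_space) chart set \<Rightarrow>
     ('m::topological_space, 'e::euclidean_space) chart set \<Rightarrow> ('n \<Rightarrow> 'm) \<Rightarrow>
     ('m \<Rightarrow> 'e \<Rightarrow> 'e \<Rightarrow> real) \<Rightarrow> bool" where
  "nondegenerate_submanifold AN AM f g \<longleftrightarrow>
     smooth_atlas AN \<and> smooth_map AN AM f \<and> (\<forall>p. inj (mdiff AN AM f p)) \<and>
     (\<forall>p u. (\<forall>v. induced_metric AN AM f g p u v = 0) \<longrightarrow> u = 0)"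

definition normal_space ::
    "('n, 'f::euclidean_space) chart set \<Rightarrow> ('m, 'e::euclidean_space) chart set \<Rightarrow> ('n \<Rightarrow> 'm) \<Rightarrow>
     ('m \<Rightarrow> 'e \<Rightarrow> 'e \<Rightarrow> real) \<Rightarrow> 'n \<Rightarrow> 'e set" where
  "normal_space AN AM f g p = {w. \<forall>u. g (f p) w (mdiff AN AM f p u) = 0}"

text \<open>Global smooth sections of a subbundle of \<open>TN\<close>, and of a subbundle of \<open>f\<^sup>* TM\<close> (vector fields
  along \<open>f\<close>).\<close>

definition sections ::
    "('n, 'f::euclidean_space) chart set \<Rightarrow> ('n \<Rightarrow> 'f set) \<Rightarrow> ('n \<Rightarrow> 'f) set" where
  "sections AN E = {X. smooth_field AN UNIV X \<and> (\<forall>p. X p \<in> E p)}"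

definition smooth_along ::
    "('n, 'f::euclidean_space) chart set \<Rightarrow> ('m, 'e::euclidean_space) chart set \<Rightarrow> ('n \<Rightarrow> 'm) \<Rightarrow>
     ('n \<Rightarrow> 'e) \<Rightarrow> bool" where
  "smooth_along AN AM f \<xi> \<longleftrightarrow>
     (\<forall>c\<in>AN. \<forall>d\<in>AM. smooth_on (snd c ` (fst c \<inter> f -` fst d))
        (\<lambda>x. tcoord AM d (f (cinv c x)) (\<xi> (cinv c x))))"

definition sections_along ::
    "('n, 'f::euclidean_space) chart set \<Rightarrow> ('m, 'e::euclidean_space) chart set \<Rightarrow> ('n \<Rightarrow> 'm) \<Rightarrow>
     ('n \<Rightarrow> 'e set) \<Rightarrow> ('n \<Rightarrow> 'e) set" where
  "sections_along AN AM f E = {\<xi>. smooth_along AN AM f \<xi> \<and> (\<forall>p. \<xi> p \<in> E p)}"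

text \<open>The connection of \<open>M\<close> acting on vector fields along \<open>f\<close> (the induced connection of
  \<open>f\<^sup>* TM\<close>): near \<open>p\<close>, write \<open>\<xi> = \<Sum>b. \<xi>\<^sup>b (\<partial>\<^sub>b \<circ> f)\<close> in terms of the coordinate fields \<open>\<partial>\<^sub>b\<close> of a
  chart \<open>d\<close> at \<open>f p\<close>; then \<open>\<nabla>\<^sub>v \<xi> = \<Sum>b. v(\<xi>\<^sup>b) \<partial>\<^sub>b + \<xi>\<^sup>b \<nabla>\<^bsub>df(v)\<^esub> \<partial>\<^sub>b\<close>. As \<open>d\<close> is the preferred chart at
  \<open>f p\<close>, one has \<open>\<partial>\<^sub>b = b\<close> and \<open>\<xi>\<^sup>b = \<xi> p \<bullet> b\<close> at that point.\<close>

definition conn_along ::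
    "('n, 'f::euclidean_space) chart set \<Rightarrow> ('m, 'e::euclidean_space) chart set \<Rightarrow> ('n \<Rightarrow> 'm) \<Rightarrow>
     ('m, 'e) connection \<Rightarrow> 'n \<Rightarrow> 'f \<Rightarrow> ('n \<Rightarrow> 'e) \<Rightarrow> 'e" where
  "conn_along AN AM f nab p v \<xi> =
     (let c = chart_at AN p; d = chart_at AM (f p) in
        frechet_derivative (\<lambda>x. tcoord AM d (f (cinv c x)) (\<xi> (cinv c x))) (at (snd c p)) v +
        (\<Sum>b\<in>Basis. (\<xi> p \<bullet> b) *\<^sub>R nab (f p) (mdiff AN AM f p v) (coord_field AM d b)))"

text \<open>\<open>B(X,Y)\<close>, by the Gauss formula, \<open>nabN\<close> being the Levi-Civita connection of the induced
  metric.\<close>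

definition second_fundamental_form ::
    "('n, 'f::euclidean_space) chart set \<Rightarrow> ('m, 'e::euclidean_space) chart set \<Rightarrow> ('n \<Rightarrow> 'm) \<Rightarrow>
     ('m, 'e) connection \<Rightarrow> ('n, 'f) connection \<Rightarrow> ('n \<Rightarrow> 'f) \<Rightarrow> ('n \<Rightarrow> 'f) \<Rightarrow> 'n \<Rightarrow> 'e" where
  "second_fundamental_form AN AM f nabM nabN X Y p =
     conn_along AN AM f nabM p (X p) (\<lambda>q. mdiff AN AM f q (Y q)) -
     mdiff AN AM f p (nabN p (X p) Y)"

text \<open>\<open>A\<^sub>\<xi> X\<close>, by the Weingarten formula.\<close>

definition shape_operator ::
    "('n, 'f::euclidean_space) chart set \<Rightarrow> ('m, 'e::euclidean_space) chart set \<Rightarrow> ('n \<Rightarrow> 'm) \<Rightarrow>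
     ('m \<Rightarrow> 'e \<Rightarrow> 'e \<Rightarrow> real) \<Rightarrow> ('m, 'e) connection \<Rightarrow> ('n \<Rightarrow> 'e) \<Rightarrow> ('n \<Rightarrow> 'f) \<Rightarrow> 'n \<Rightarrow> 'f" where
  "shape_operator AN AM f g nabM \<xi> X p =
     (THE a. \<exists>w\<in>normal_space AN AM f g p.
        conn_along AN AM f nabM p (X p) \<xi> = - mdiff AN AM f p a + w)"


section \<open>Paraquaternionic CR-submanifolds\<close>

definition distribution ::
    "('n::topological_space, 'f::euclidean_space) chart set \<Rightarrow> ('n \<Rightarrow> 'f set) \<Rightarrow> bool" where
  "distribution AN D \<longleftrightarrow>
     (\<exists>k. \<forall>p. \<exists>U. open U \<and> p \<in> U \<and>
        (\<exists>X :: nat \<Rightarrow> 'n \<Rightarrow> 'f. (\<forall>i<k. smooth_field AN U (X i)) \<and>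
           (\<forall>q\<in>U. inj_on (\<lambda>i. X i q) {..<k} \<and> independent ((\<lambda>i. X i q) ` {..<k}) \<and>
              span ((\<lambda>i. X i q) ` {..<k}) = D q)))"

definition orth_distr ::
    "('n \<Rightarrow> 'f \<Rightarrow> 'f \<Rightarrow> real) \<Rightarrow> ('n \<Rightarrow> 'f set) \<Rightarrow> 'n \<Rightarrow> 'f set" where
  "orth_distr h D p = {u. \<forall>v\<in>D p. h p u v = 0}"

definition paraquaternionic_CR_submanifold ::
    "('n::{t2_space,second_countable_topology}, 'f::euclidean_space) chart set \<Rightarrow>
     ('m::topological_space, 'e::euclidean_space) chart set \<Rightarrow> ('n \<Rightarrow> 'm) \<Rightarrow>
     ('m \<Rightarrow> ('e \<Rightarrow>\<^sub>L 'e) set) \<Rightarrow> ('m \<Rightarrow> 'e \<Rightarrow> 'e \<Rightarrow> real) \<Rightarrow> ('n \<Rightarrow> 'f set) \<Rightarrow> bool" where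
  "paraquaternionic_CR_submanifold AN AM f \<sigma> g D \<longleftrightarrow>
     nondegenerate_submanifold AN AM f g \<and>
     distribution AN D \<and>
     (\<forall>p. \<forall>u\<in>D p. (\<forall>v\<in>D p. induced_metric AN AM f g p u v = 0) \<longrightarrow> u = 0) \<and>
     (\<forall>U J p \<alpha>. canonical_basis AM \<sigma> U J \<and> f p \<in> U \<longrightarrow>
        blinfun_apply (J \<alpha> (f p)) ` mdiff AN AM f p ` D p = mdiff AN AM f p ` D p \<and>
        blinfun_apply (J \<alpha> (f p)) ` mdiff AN AM f p ` orth_distr (induced_metric AN AM f g) D p
          \<subseteq> normal_space AN AM f g p)"

text \<open>\<open>\<nu>\<^sup>\<bottom> = J\<^sub>1 D\<^sup>\<bottom> \<oplus> J\<^sub>2 D\<^sup>\<bottom> \<oplus> J\<^sub>3 D\<^sup>\<bottom>\<close>, which does not depend on the canonical local basis, and its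
  orthogonal complement in the normal bundle.\<close>

definition nu_perp ::
    "('n::topological_space, 'f::euclidean_space) chart set \<Rightarrow>
     ('m::topological_space, 'e::euclidean_space) chart set \<Rightarrow> ('n \<Rightarrow> 'm) \<Rightarrow>
     ('m \<Rightarrow> ('e \<Rightarrow>\<^sub>L 'e) set) \<Rightarrow> ('m \<Rightarrow> 'e \<Rightarrow> 'e \<Rightarrow> real) \<Rightarrow> ('n \<Rightarrow> 'f set) \<Rightarrow> 'n \<Rightarrow> 'e set" where
  "nu_perp AN AM f \<sigma> g D p =
     {w. \<exists>U J u. canonical_basis AM \<sigma> U J \<and> f p \<in> U \<and>
        (\<forall>\<alpha>::3. u \<alpha> \<in> orth_distr (induced_metric AN AM f g) D p) \<and>
        w = (\<Sum>\<alpha>\<in>UNIV. blinfun_apply (J \<alpha> (f p)) (mdiff AN AM f p (u \<alpha>)))}"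

definition nu ::
    "('n::topological_space, 'f::euclidean_space) chart set \<Rightarrow>
     ('m::topological_space, 'e::euclidean_space) chart set \<Rightarrow> ('n \<Rightarrow> 'm) \<Rightarrow>
     ('m \<Rightarrow> ('e \<Rightarrow>\<^sub>L 'e) set) \<Rightarrow> ('m \<Rightarrow> 'e \<Rightarrow> 'e \<Rightarrow> real) \<Rightarrow> ('n \<Rightarrow> 'f set) \<Rightarrow> 'n \<Rightarrow> 'e set" where
  "nu AN AM f \<sigma> g D p =
     {w \<in> normal_space AN AM f g p. \<forall>z\<in>nu_perp AN AM f \<sigma> g D p. g (f p) w z = 0}"

text \<open>For an integrable distribution \<open>E\<close>: the leaves of the foliation tangent to \<open>E\<close> are totally
  geodesic.\<close>

definition totally_geodesic_foliation ::
    "('n, 'f::euclidean_space) chart set \<Rightarrow> ('n, 'f) connection \<Rightarrow> ('n \<Rightarrow> 'f set) \<Rightarrow> bool" where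
  "totally_geodesic_foliation AN nab E \<longleftrightarrow>
     (\<forall>X\<in>sections AN E. \<forall>Z\<in>sections AN E. (\<lambda>p. nab p (X p) Z) \<in> sections AN E)"

end

theory Submission
  imports Defs "Jordan_Normal_Form.Determinant"
begin

text \<open>Let \<open>h\<close> be the induced metric. All four assertions are equivalent to the pointwise condition
  \<open>g(B(x, y), J\<^sub>\<alpha> z) = 0\<close> for \<open>x \<in> D\<close>, \<open>y, z \<in> D\<^sup>\<bottom>\<close>. For (ii) this is the
  definition of \<open>\<nu>\<close>, and for (iii) and (iv) it is the identity \<open>h(A\<^sub>\<xi> x, y) = g(B(x, y), \<xi>)\<close> together
  with the symmetry of \<open>B\<close> and \<open>D = (D\<^sup>\<bottom>)\<^sup>\<bottom>\<close>. For (i), if \<open>Z\<close> is a section of \<open>D\<^sup>\<bottom>\<close> and \<open>y \<in> D\<close>, then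
  \<open>\<epsilon>\<^sub>\<alpha> h(\<nabla>\<^sub>x Z, y) = g(J\<^sub>\<alpha> \<nabla>\<^sub>x Z, J\<^sub>\<alpha> y) = g(\<nabla>\<^sub>x (J\<^sub>\<alpha> Z), J\<^sub>\<alpha> y) = - g(J\<^sub>\<alpha> Z, B(x, J\<^sub>\<alpha> y))\<close>, since the derivative
  of \<open>J\<^sub>\<alpha>\<close> lies in \<open>\<sigma>\<close> and hence maps \<open>Z\<close> to a normal vector. The passage between pointwise statements
  and global sections uses bump functions and smooth orthogonal projections.\<close>

section \<open>Smooth maps between open sets\<close>

text \<open>The ambient connection differentiates only fields on open subsets of M, whereas
  \<open>df(Y)\<close>, \<open>J\<^sub>\<alpha> Z\<close> and the normal fields live along the
  immersion. Metric compatibility, vanishing torsion and parallelism of \<sigma> therefore have to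
  be carried over to fields along \<open>f\<close>, by expansion in coordinate fields of M. The
  preferred chart that identifies a tangent space with the model space jumps from point to point, so
  smooth dependence on the point is visible only in a chart held fixed; this is why
  chart-independent expansions are proved for everything that is defined through the preferred
  chart. The metric is indefinite, so projections come from inverting Gram matrices and not from
  orthonormal frames. \<open>B\<close> takes vector fields and is made pointwise by its symmetry;
  the shape operator is a definite description, whose object is found by representing a linear
  functional by the nondegenerate form \<open>h\<close> on TN. In (i) each index \<alpha> has to be
  handled separately: the passage from (i) to the pointwise condition uses that every
  \<open>J\<^sub>\<alpha>\<close> maps D onto D, while the way back follows from one index.\<close>

lemma frechet_derivative_eq:
  "(f has_derivative f') (at x) \<Longrightarrow> frechet_derivative f (at x) = f'"
  by (metis frechet_derivative_at)

lemma linear_eq_sum_Basis: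
  fixes h :: "'a::euclidean_space \<Rightarrow> 'b::real_vector"
  assumes "linear h"
  shows "h v = (\<Sum>b\<in>Basis. inner v b *\<^sub>R h b)"
proof -
  have "h v = h (\<Sum>b\<in>Basis. inner v b *\<^sub>R b)"
    by (simp only: euclidean_representation)
  also have "\<dots> = (\<Sum>b\<in>Basis. inner v b *\<^sub>R h b)"
    by (simp only: linear_sum[OF assms] linear_scale[OF assms] o_def)
  finally show ?thesis .
qed

text \<open>The derivatives in \<open>ck_on\<close> are taken in the whole space, so agreement on S
  controls them only because S is open.\<close>

lemma ck_on_cong_imp:
  assumes "open S" "\<And>x. x \<in> S \<Longrightarrow> f x = g x" "ck_on k S f"
  shows "ck_on k S g"
  using assms(2,3)
proof (induction k arbitrary: f g)
  case 0
  then show ?case using continuous_on_cong[of S S f g] by simp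
next
  case (Suc k)
  have d: "(g has_derivative frechet_derivative f (at x)) (at x)" if "x \<in> S" for x
    using Suc.prems that has_derivative_transform_within_open[OF _ assms(1) that]
    by (metis ck_on.simps(2) frechet_derivative_works)
  show ?case
    unfolding ck_on.simps
  proof (intro conjI ballI allI)
    show "g differentiable at x" if "x \<in> S" for x
      using d[OF that] by (rule differentiableI)
    show "ck_on k S (\<lambda>x. frechet_derivative g (at x) v)" for v
    proof (rule Suc.IH[of "\<lambda>x. frechet_derivative f (at x) v"])
      show "frechet_derivative f (at x) v = frechet_derivative g (at x) v" if "x \<in> S" for x
        using frechet_derivative_eq[OF d[OF that]] by simp
    qed (use Suc.prems in simp)
  qed
qed

text \<open>Replaces the chosen \<open>frechet_derivative\<close> by any explicitly known
  derivative; all closure properties below are inductions through this rule.\<close>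

lemma ck_on_SucI:
  assumes "open S" "\<And>x. x \<in> S \<Longrightarrow> (f has_derivative f' x) (at x)"
    and "\<And>v. ck_on k S (\<lambda>x. f' x v)"
  shows "ck_on (Suc k) S f"
  unfolding ck_on.simps
proof (intro conjI ballI allI)
  show "f differentiable at x" if "x \<in> S" for x
    using assms(2)[OF that] by (rule differentiableI)
  show "ck_on k S (\<lambda>x. frechet_derivative f (at x) v)" for v
    by (rule ck_on_cong_imp[OF assms(1) _ assms(3)[of v]])
      (simp add: frechet_derivative_eq[OF assms(2)])
qed

lemma ck_on_SucD:
  assumes "ck_on (Suc k) S f"
  shows "x \<in> S \<Longrightarrow> (f has_derivative frechet_derivative f (at x)) (at x)"
    and "ck_on k S (\<lambda>x. frechet_derivative f (at x) v)"
  using assms by (auto simp: frechet_derivative_works)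

lemma ck_on_Suc_imp: "ck_on (Suc k) S f \<Longrightarrow> ck_on k S f"
proof (induction k arbitrary: f)
  case 0
  then show ?case
    unfolding ck_on.simps
    by (intro differentiable_imp_continuous_on) (auto simp: differentiable_on_def
        differentiable_at_withinI)
next
  case (Suc k)
  show ?case
    using Suc.prems Suc.IH by (subst ck_on.simps) (metis ck_on.simps(2))
qed

lemma ck_on_subset: "ck_on k S f \<Longrightarrow> T \<subseteq> S \<Longrightarrow> ck_on k T f"
  by (induction k arbitrary: f) (auto intro: continuous_on_subset)

lemma ck_on_local:
  assumes "\<And>x. x \<in> S \<Longrightarrow> \<exists>T. open T \<and> x \<in> T \<and> ck_on k T f"
  shows "ck_on k S f"
  using assms
proof (induction k arbitrary: f)
  case 0
  show ?case
    using 0 by (auto intro!: continuous_at_imp_continuous_on dest!: continuous_on_interior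
        simp: interior_open) (metis continuous_on_interior interior_open)
next
  case (Suc k)
  show ?case
    unfolding ck_on.simps
  proof (intro conjI ballI allI)
    show "f differentiable at x" if "x \<in> S" for x
      using Suc.prems[OF that] by auto
    show "ck_on k S (\<lambda>x. frechet_derivative f (at x) v)" for v
      by (rule Suc.IH) (use Suc.prems in fastforce)
  qed
qed

lemma ck_on_const: "ck_on k S (\<lambda>x. c)"
  by (induction k arbitrary: c) auto

lemma ck_on_bounded_linear:
  assumes L: "bounded_linear L" and S: "open S"
  shows "ck_on k S f \<Longrightarrow> ck_on k S (\<lambda>x. L (f x))"
proof (induction k arbitrary: f)
  case 0
  then show ?case using bounded_linear.continuous_on[OF L] by auto
next
  case (Suc k)
  show ?case
    by (rule ck_on_SucI[OF S bounded_linear.has_derivative[OF L ck_on_SucD(1)[OF Suc.prems]] Suc.IH[OF ck_on_SucD(2)[OF Suc.prems]]])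
qed

lemma ck_on_add:
  assumes S: "open S"
  shows "ck_on k S f \<Longrightarrow> ck_on k S g \<Longrightarrow> ck_on k S (\<lambda>x. f x + g x)"
proof (induction k arbitrary: f g)
  case 0
  then show ?case by (auto intro: continuous_on_add)
next
  case (Suc k)
  show ?case
    by (rule ck_on_SucI[OF S has_derivative_add[OF ck_on_SucD(1)[OF Suc.prems(1)] ck_on_SucD(1)[OF Suc.prems(2)]]
          Suc.IH[OF ck_on_SucD(2)[OF Suc.prems(1)] ck_on_SucD(2)[OF Suc.prems(2)]]])
qed

lemma ck_on_bounded_bilinear:
  assumes B: "bounded_bilinear B" and S: "open S"
  shows "ck_on k S f \<Longrightarrow> ck_on k S g \<Longrightarrow> ck_on k S (\<lambda>x. B (f x) (g x))"
proof (induction k arbitrary: f g)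
  case 0
  then show ?case using bounded_bilinear.continuous_on[OF B] by auto
next
  case (Suc k)
  show ?case
    by (rule ck_on_SucI[OF S bounded_bilinear.FDERIV[OF B ck_on_SucD(1)[OF Suc.prems(1)] ck_on_SucD(1)[OF Suc.prems(2)]]],
        assumption, assumption)
      (intro ck_on_add[OF S] Suc.IH ck_on_SucD(2) Suc.prems ck_on_Suc_imp[OF Suc.prems(1)]
        ck_on_Suc_imp[OF Suc.prems(2)])
qed

lemma ck_on_sum:
  assumes "open S" "\<And>i. i \<in> I \<Longrightarrow> ck_on k S (f i)"
  shows "ck_on k S (\<lambda>x. \<Sum>i\<in>I. f i x)"
  using assms(2)
  by (induction I rule: infinite_finite_induct) (auto intro!: ck_on_const ck_on_add assms(1))

text \<open>The recursion of \<open>ck_on\<close> speaks of derivatives in a fixed direction, but in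
  the chain rule the direction in which \<open>g\<close> is differentiated varies with x. Expanding
  that direction in the orthonormal basis of the intermediate space leaves fixed directions b with
  scalar coefficients; hence the Euclidean middle type.\<close>

lemma ck_on_compose:
  fixes f :: "'a::real_normed_vector \<Rightarrow> 'b::euclidean_space" and g :: "'b \<Rightarrow> 'c::real_normed_vector"
  assumes S: "open S"
  shows "ck_on k S f \<Longrightarrow> ck_on k T g \<Longrightarrow> f ` S \<subseteq> T \<Longrightarrow> ck_on k S (\<lambda>x. g (f x))"
proof (induction k arbitrary: g)
  case 0
  then show ?case using continuous_on_compose2[of T g S f] by simp
next
  case (Suc k)
  have g: "(g has_derivative frechet_derivative g (at (f x))) (at (f x))" if "x \<in> S" for x
    by (rule ck_on_SucD(1)[OF Suc.prems(2)]) (use Suc.prems(3) that in auto)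
  have d: "((\<lambda>x. g (f x)) has_derivative
      (\<lambda>v. \<Sum>b\<in>Basis. inner (frechet_derivative f (at x) v) b *\<^sub>R frechet_derivative g (at (f x)) b)) (at x)"
    if "x \<in> S" for x
  proof (rule has_derivative_eq_rhs[OF has_derivative_compose[OF ck_on_SucD(1)[OF Suc.prems(1) that] g[OF that]]])
    show "(\<lambda>v. frechet_derivative g (at (f x)) (frechet_derivative f (at x) v)) =
      (\<lambda>v. \<Sum>b\<in>Basis. inner (frechet_derivative f (at x) v) b *\<^sub>R frechet_derivative g (at (f x)) b)"
      by (rule ext, rule linear_eq_sum_Basis)
        (rule bounded_linear.linear[OF has_derivative_bounded_linear[OF g[OF that]]])
  qed
  show ?case
  proof (rule ck_on_SucI[OF S d])
    fix v
    show "ck_on k S (\<lambda>x. \<Sum>b\<in>Basis. inner (frechet_derivative f (at x) v) b *\<^sub>R frechet_derivative g (at (f x)) b)"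
    proof (intro ck_on_sum[OF S] ck_on_bounded_bilinear[OF bounded_bilinear_scaleR S])
      fix b :: 'b
      show "ck_on k S (\<lambda>x. inner (frechet_derivative f (at x) v) b)"
        by (rule ck_on_bounded_linear[OF bounded_linear_inner_left S ck_on_SucD(2)[OF Suc.prems(1)]])
      show "ck_on k S (\<lambda>x. frechet_derivative g (at (f x)) b)"
        by (rule Suc.IH[OF ck_on_Suc_imp[OF Suc.prems(1)] ck_on_SucD(2)[OF Suc.prems(2)] Suc.prems(3)])
    qed
  qed
qed

text \<open>The derivative of 1/x is a product of copies of 1/x itself, so the induction hypothesis
  applies to it.\<close>

lemma ck_on_inverse: "ck_on k {x::real. x \<noteq> 0} inverse"
proof (induction k)
  case 0
  show ?case by (auto intro!: continuous_intros)
next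
  case (Suc k)
  have o: "open {x::real. x \<noteq> 0}"
    by (simp add: open_Collect_neq)
  show ?case
    by (rule ck_on_SucI[OF o, where f' = "\<lambda>x v. - (inverse x * v * inverse x)"])
      (auto intro!: derivative_eq_intros ck_on_bounded_bilinear[OF bounded_bilinear_mult o]
        ck_on_bounded_linear[OF bounded_linear_minus[OF bounded_linear_ident] o] Suc ck_on_const)
qed

text \<open>The function exp(-1/t), extended by zero, together with its multiples by powers of 1/t:
  the derivative of one member is a linear combination of members, so smoothness of all of them is a
  single induction.\<close>

definition flat :: "nat \<Rightarrow> real \<Rightarrow> real" where
  "flat n t = (if t > 0 then exp (- inverse t) * inverse t ^ n else 0)"

text \<open>With u = 1/t this is the fact that exp(u) outgrows every power of u.\<close>

lemma flat_tendsto_0: "(flat n \<longlongrightarrow> 0) (at 0)"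
proof -
  have "((\<lambda>u::real. u ^ n / exp u) \<longlongrightarrow> 0) at_top"
    by (rule tendsto_power_div_exp_0)
  then have "((\<lambda>t::real. inverse t ^ n / exp (inverse t)) \<longlongrightarrow> 0) (at_right 0)"
    by (rule filterlim_compose[OF _ filterlim_inverse_at_top_right])
  then have "(flat n \<longlongrightarrow> 0) (at_right 0)"
    by (rule Lim_transform_eventually)
      (auto simp: flat_def exp_minus field_simps eventually_at_filter)
  moreover have "(flat n \<longlongrightarrow> 0) (at_left 0)"
    by (rule Lim_transform_eventually[OF tendsto_const]) (auto simp: flat_def eventually_at_filter)
  ultimately show ?thesis
    by (simp add: filterlim_split_at)
qed

lemma flat_deriv: "(flat n has_real_derivative (flat (n + 2) t - real n * flat (n + 1) t)) (at t)"
proof -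
  consider "t > 0" | "t < 0" | "t = 0" by linarith
  then show ?thesis
  proof cases
    case 1
    have "((\<lambda>t. exp (- inverse t) * inverse t ^ n) has_real_derivative
        (flat (n + 2) t - real n * flat (n + 1) t)) (at t)"
    proof -
      have "((\<lambda>t. inverse t) has_real_derivative - (inverse t * inverse t)) (at t)"
        using 1 by (auto intro!: derivative_eq_intros simp: power2_eq_square)
      note d = this
      have "((\<lambda>t. inverse t ^ n) has_real_derivative - (real n * inverse t ^ (n + 1))) (at t)"
        using DERIV_power[OF d, of n] 1 by (cases n) (auto simp: mult_ac)
      moreover have "((\<lambda>t. exp (- inverse t)) has_real_derivative exp (- inverse t) * (inverse t * inverse t)) (at t)"
        using DERIV_fun_exp[OF DERIV_minus[OF d]] by simp
      ultimately show ?thesis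
        using 1 DERIV_mult by (fastforce simp: flat_def algebra_simps)
    qed
    then show ?thesis
      by (rule has_field_derivative_transform_within_open[where S = "{0<..}"]) (use 1 in \<open>auto simp: flat_def\<close>)
  next
    case 2
    have "((\<lambda>t. 0) has_real_derivative (flat (n + 2) t - real n * flat (n + 1) t)) (at t)"
      using 2 by (auto simp: flat_def)
    then show ?thesis
      by (rule has_field_derivative_transform_within_open[where S = "{..<0}"]) (use 2 in \<open>auto simp: flat_def\<close>)
  next
    case 3
    \<comment> \<open>The difference quotient at 0 is again in the family, so the derivative there
      is the limit already known. The equality includes y = 0, where division by zero gives
      0.\<close>
    have "(\<lambda>y. (flat n y - flat n 0) / (y - 0)) = flat (Suc n)"
      by (rule ext) (simp add: flat_def divide_inverse)
    then have "((\<lambda>y. (flat n y - flat n 0) / (y - 0)) \<longlongrightarrow> 0) (at 0)"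
      by (simp add: flat_tendsto_0)
    then show ?thesis
      using 3 by (simp add: has_field_derivative_iff flat_def)
  qed
qed

lemma ck_on_flat: "ck_on k UNIV (flat n)"
proof (induction k arbitrary: n)
  case 0
  show ?case
    by (auto intro!: DERIV_isCont[OF flat_deriv] continuous_at_imp_continuous_on)
next
  case (Suc k)
  show ?case
  proof (rule ck_on_SucI[OF open_UNIV flat_deriv[unfolded has_field_derivative_def]])
    fix v
    have "ck_on k UNIV (\<lambda>t. (flat (n + 2) t + (- real n) * flat (n + 1) t) * v)"
      by (intro ck_on_add ck_on_bounded_bilinear[OF bounded_bilinear_mult] Suc ck_on_const open_UNIV)
    then show "ck_on k UNIV (\<lambda>t. (flat (n + 2) t - real n * flat (n + 1) t) * v)"
      by simp
  qed
qed

lemma smooth_on_cong: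
  assumes "open S" "\<And>x. x \<in> S \<Longrightarrow> f x = g x"
  shows "smooth_on S f \<longleftrightarrow> smooth_on S g"
  unfolding smooth_on_def
  using ck_on_cong_imp[OF assms(1), of f g] ck_on_cong_imp[OF assms(1), of g f] assms(2) by auto

lemma smooth_on_local:
  assumes "\<And>x. x \<in> S \<Longrightarrow> \<exists>T. open T \<and> x \<in> T \<and> smooth_on T f"
  shows "smooth_on S f"
  unfolding smooth_on_def
proof
  show "ck_on k S f" for k
    by (rule ck_on_local) (use assms in \<open>auto simp: smooth_on_def\<close>)
qed

lemma smooth_on_subset: "smooth_on S f \<Longrightarrow> T \<subseteq> S \<Longrightarrow> smooth_on T f"
  unfolding smooth_on_def using ck_on_subset[of _ S f T] by auto

lemma smooth_on_const: "smooth_on S (\<lambda>x. c)"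
  unfolding smooth_on_def by (auto intro!: ck_on_const)

lemma smooth_on_bounded_linear:
  "bounded_linear L \<Longrightarrow> open S \<Longrightarrow> smooth_on S f \<Longrightarrow> smooth_on S (\<lambda>x. L (f x))"
  unfolding smooth_on_def using ck_on_bounded_linear[of L S _ f] by auto

lemma smooth_on_add:
  "open S \<Longrightarrow> smooth_on S f \<Longrightarrow> smooth_on S g \<Longrightarrow> smooth_on S (\<lambda>x. f x + g x)"
  unfolding smooth_on_def using ck_on_add[of S _ f g] by auto

lemma smooth_on_bounded_bilinear:
  "bounded_bilinear B \<Longrightarrow> open S \<Longrightarrow> smooth_on S f \<Longrightarrow> smooth_on S g \<Longrightarrow>
    smooth_on S (\<lambda>x. B (f x) (g x))"
  unfolding smooth_on_def using ck_on_bounded_bilinear[of B S _ f g] by auto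

lemma smooth_on_compose:
  fixes f :: "'a::real_normed_vector \<Rightarrow> 'b::euclidean_space" and g :: "'b \<Rightarrow> 'c::real_normed_vector"
  shows "open S \<Longrightarrow> smooth_on S f \<Longrightarrow> smooth_on T g \<Longrightarrow> f ` S \<subseteq> T \<Longrightarrow> smooth_on S (\<lambda>x. g (f x))"
  unfolding smooth_on_def using ck_on_compose[of S _ f T g] by auto

lemma smooth_on_deriv: "smooth_on S f \<Longrightarrow> smooth_on S (\<lambda>x. frechet_derivative f (at x) v)"
  unfolding smooth_on_def using ck_on_SucD(2)[of _ S f] by auto

lemma smooth_on_has_derivative:
  "smooth_on S f \<Longrightarrow> x \<in> S \<Longrightarrow> (f has_derivative frechet_derivative f (at x)) (at x)"
  unfolding smooth_on_def using ck_on_SucD(1)[of _ S f] by auto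

lemma smooth_on_inverse: "smooth_on {x::real. x \<noteq> 0} inverse"
  unfolding smooth_on_def using ck_on_inverse by auto

lemma smooth_on_ident: "open S \<Longrightarrow> smooth_on S (\<lambda>x. x)"
  unfolding smooth_on_def
proof
  show "ck_on k S (\<lambda>x. x)" if "open S" for k
    proof (cases k)
    case (Suc m)
    show ?thesis
      unfolding Suc by (rule ck_on_SucI[OF that has_derivative_ident ck_on_const])
  qed (simp add: continuous_on_id)
qed

text \<open>Apply \<open>flat 0\<close> to r^2 - |x - x0|^2, a polynomial that is positive exactly
  inside the ball; the squared norm avoids the singularity of the norm at the centre. The constant
  factor normalises the value at the centre, which is \<open>flat 0 (r\<^sup>2)\<close>.\<close>

lemma smooth_bump:
  fixes x0 :: "'a::euclidean_space"
  assumes "r > 0"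
  obtains \<beta> :: "'a \<Rightarrow> real"
  where "smooth_on UNIV \<beta>" "\<beta> x0 = 1" "\<And>x. x \<notin> ball x0 r \<Longrightarrow> \<beta> x = 0"
proof
  define q where "q x = r\<^sup>2 + (- 1) * inner (x - x0) (x - x0)" for x :: 'a
  let ?\<beta> = "\<lambda>x. inverse (flat 0 (r\<^sup>2)) * flat 0 (q x)"
  have d: "smooth_on UNIV (\<lambda>x::'a. x - x0)"
    using smooth_on_add[OF open_UNIV smooth_on_ident[OF open_UNIV] smooth_on_const[of _ "- x0"]] by simp
  have "smooth_on UNIV q"
    unfolding q_def
    by (intro smooth_on_add smooth_on_const smooth_on_bounded_bilinear[OF bounded_bilinear_mult]
        smooth_on_bounded_bilinear[OF bounded_bilinear_inner] d open_UNIV)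
  moreover have "smooth_on UNIV (flat 0)"
    unfolding smooth_on_def using ck_on_flat by auto
  ultimately show "smooth_on UNIV ?\<beta>"
    by (intro smooth_on_bounded_bilinear[OF bounded_bilinear_mult] smooth_on_const
        smooth_on_compose[of _ q _ "flat 0"] open_UNIV) auto
  show "?\<beta> x0 = 1"
    using assms by (simp add: q_def flat_def)
  show "?\<beta> x = 0" if "x \<notin> ball x0 r" for x
  proof -
    have "r \<le> norm (x - x0)"
      using that by (simp add: dist_norm norm_minus_commute)
    then have "r\<^sup>2 \<le> (norm (x - x0))\<^sup>2"
      using assms by (intro power_mono) auto
    then show ?thesis
      by (simp add: q_def flat_def dot_square_norm)
  qed
qed

section \<open>Linear systems of smooth functions\<close>

text \<open>Cramer's rule expresses the solution of a linear system with functions as coefficients by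
  ring operations and one division.\<close>

lemma linear_system_in_function_algebra:
  fixes G :: "nat \<Rightarrow> nat \<Rightarrow> 'q \<Rightarrow> real" and b :: "nat \<Rightarrow> 'q \<Rightarrow> real"
  assumes const: "\<And>c. P (\<lambda>_. c)"
    and add: "\<And>u v. P u \<Longrightarrow> P v \<Longrightarrow> P (\<lambda>q. u q + v q)"
    and mult: "\<And>u v. P u \<Longrightarrow> P v \<Longrightarrow> P (\<lambda>q. u q * v q)"
    and inverse: "\<And>u. P u \<Longrightarrow> (\<And>q. q \<in> W \<Longrightarrow> u q \<noteq> 0) \<Longrightarrow> P (\<lambda>q. inverse (u q))"
    and G: "\<And>i j. i < k \<Longrightarrow> j < k \<Longrightarrow> P (G i j)"
    and b: "\<And>i. i < k \<Longrightarrow> P (b i)"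
    and inj: "\<And>q c. q \<in> W \<Longrightarrow> (\<forall>i<k. (\<Sum>j<k. G i j q * c j) = 0) \<Longrightarrow> (\<forall>j<k. c j = 0)"
  obtains c where "\<And>j. j < k \<Longrightarrow> P (c j)"
    and "\<And>q i. q \<in> W \<Longrightarrow> i < k \<Longrightarrow> (\<Sum>j<k. G i j q * c j q) = b i q"
proof -
  have sum: "P (\<lambda>q. \<Sum>i\<in>I. u i q)" if "\<And>i. i \<in> I \<Longrightarrow> P (u i)" for I :: "'z set" and u
    using that by (induction I rule: infinite_finite_induct) (auto intro!: const add)
  have prod: "P (\<lambda>q. \<Prod>i\<in>I. u i q)" if "\<And>i. i \<in> I \<Longrightarrow> P (u i)" for I :: "'z set" and u
    using that by (induction I rule: infinite_finite_induct) (auto intro!: const mult)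
  define M where "M q = Matrix.mat k k (\<lambda>(i, j). G i j q)" for q
  have M: "M q \<in> carrier_mat k k" for q
    by (simp add: M_def)
  \<comment> \<open>The Leibniz formula writes a determinant as a polynomial in the entries. The
    size n is left free because cofactors need it at k - 1.\<close>
  have P_det: "P (\<lambda>q. Determinant.det (N q))"
    if "\<And>q. N q \<in> carrier_mat n n" "\<And>i j. i < n \<Longrightarrow> j < n \<Longrightarrow> P (\<lambda>q. N q $$ (i, j))" for N n
    unfolding det_def'[OF that(1)]
    by (intro sum mult const prod that(2)) auto
  have P_cof: "P (\<lambda>q. cofactor (M q) i j)" if "i < k" "j < k" for i j
    unfolding cofactor_def
  proof (intro mult const P_det[of "\<lambda>q. mat_delete (M q) i j" "k - 1"])
    show "mat_delete (M q) i j \<in> carrier_mat (k - 1) (k - 1)" for q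
      using mat_delete_carrier[OF M] by simp
    show "P (\<lambda>q. mat_delete (M q) i j $$ (i', j'))" if "i' < k - 1" "j' < k - 1" for i' j'
      using that \<open>i < k\<close> \<open>j < k\<close> by (auto simp: mat_delete_def M_def intro!: G)
  qed
  have det0: "Determinant.det (M q) \<noteq> 0" if q: "q \<in> W" for q
  proof
    assume "Determinant.det (M q) = 0"
    then obtain v where v: "v \<in> carrier_vec k" "v \<noteq> 0\<^sub>v k" "M q *\<^sub>v v = 0\<^sub>v k"
      using det_0_iff_vec_prod_zero[OF M] by blast
    have "(\<Sum>j<k. G i j q * v $ j) = 0" if "i < k" for i
    proof -
      have "(M q *\<^sub>v v) $ i = 0" using v(3) that by simp
      then show ?thesis
        using that v(1) by (simp add: M_def scalar_prod_def atLeast0LessThan)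
    qed
    then have "\<forall>j<k. v $ j = 0"
      using inj[OF q, of "vec_index v"] by blast
    then have "v = 0\<^sub>v k"
      using v(1) by (intro eq_vecI) auto
    with v(2) show False by blast
  qed
  \<comment> \<open>The (j, i) entry of the adjugate is the (i, j) cofactor, so this is the adjugate
    applied to b and divided by the determinant.\<close>
  define c where "c j q = inverse (Determinant.det (M q)) * (\<Sum>i<k. cofactor (M q) i j * b i q)" for j q
  show thesis
  proof
    show "P (c j)" if "j < k" for j
      unfolding c_def using that
      by (intro mult inverse sum P_det[OF M] P_cof b det0) (auto simp: M_def intro: G)
    show "(\<Sum>j<k. G i j q * c j q) = b i q" if q: "q \<in> W" and i: "i < k" for q i
    proof -
      have *: "(\<Sum>j<k. G i j q * cofactor (M q) l j) = Determinant.det (M q) * (if i = l then 1 else 0)" if l: "l < k" for l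
      proof -
        have "(M q * adj_mat (M q)) $$ (i, l) = (Determinant.det (M q) \<cdot>\<^sub>m 1\<^sub>m k) $$ (i, l)"
          using adj_mat(2)[OF M] by simp
        then show ?thesis
          using i l by (simp add: M_def adj_mat_def scalar_prod_def atLeast0LessThan)
      qed
      have "(\<Sum>j<k. G i j q * c j q) =
          (\<Sum>j<k. \<Sum>l<k. inverse (Determinant.det (M q)) * (b l q * (G i j q * cofactor (M q) l j)))"
        by (simp add: c_def sum_distrib_left mult_ac)
      also have "\<dots> = (\<Sum>l<k. inverse (Determinant.det (M q)) * (b l q * (\<Sum>j<k. G i j q * cofactor (M q) l j)))"
        by (subst sum.swap) (simp add: sum_distrib_left)
      also have "\<dots> = (\<Sum>l<k. if i = l then b l q else 0)"
        by (rule sum.cong) (auto simp: * det0[OF q])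
      finally show ?thesis using i by simp
    qed
  qed
qed

section \<open>Calculus on manifolds\<close>

text \<open>\<open>smooth_fun\<close> and \<open>dir_deriv\<close> only admit real values. With
  vector values the same calculus covers coordinate maps and components of fields:
  \<open>tcoord\<close> and \<open>mdiff\<close> are instances of \<open>vderiv\<close>.\<close>

definition vsmooth ::
    "('m, 'e::euclidean_space) chart set \<Rightarrow> 'm set \<Rightarrow> ('m \<Rightarrow> 'b::real_normed_vector) \<Rightarrow> bool" where
  "vsmooth A W F \<longleftrightarrow> (\<forall>c\<in>A. smooth_on (snd c ` (fst c \<inter> W)) (F \<circ> cinv c))"

definition vderiv ::
    "('m, 'e::euclidean_space) chart set \<Rightarrow> 'm \<Rightarrow> 'e \<Rightarrow> ('m \<Rightarrow> 'b::real_normed_vector) \<Rightarrow> 'b" where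
  "vderiv A p v F = frechet_derivative (F \<circ> cinv (chart_at A p)) (at (snd (chart_at A p) p)) v"

lemma smooth_fun_iff_vsmooth: "smooth_fun A W h \<longleftrightarrow> vsmooth A W h"
  by (simp add: smooth_fun_def vsmooth_def)

lemma dir_deriv_eq_vderiv: "dir_deriv A p v h = vderiv A p v h"
  by (simp add: dir_deriv_def vderiv_def)

lemma tcoord_eq_vderiv: "tcoord A c p v = vderiv A p v (snd c)"
  by (simp add: tcoord_def vderiv_def)

lemma mdiff_eq_vderiv: "mdiff AN AM f p v = vderiv AN p v (snd (chart_at AM (f p)) \<circ> f)"
  by (simp add: mdiff_def vderiv_def)

lemma vsmooth_subset: "vsmooth A W F \<Longrightarrow> V \<subseteq> W \<Longrightarrow> vsmooth A V F"
  unfolding vsmooth_def by (meson Int_mono image_mono order_refl smooth_on_subset)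

text \<open>No differentiability is assumed: f and g have the same candidates for a derivative at x,
  so the choice operator returns the same value for both.\<close>

lemma frechet_derivative_cong:
  assumes "open S" "x \<in> S" "\<And>y. y \<in> S \<Longrightarrow> f y = g y"
  shows "frechet_derivative f (at x) = frechet_derivative g (at x)"
proof -
  have "(f has_derivative D) (at x) \<longleftrightarrow> (g has_derivative D) (at x)" for D
    using has_derivative_transform_within_open[OF _ assms(1,2), of f D UNIV g]
      has_derivative_transform_within_open[OF _ assms(1,2), of g D UNIV f] assms(3) by auto
  then show ?thesis
    by (simp add: frechet_derivative_def)
qed

section \<open>Charts, smooth functions and their derivatives on a manifold\<close>

locale atlas =
  fixes A :: "('m::{t2_space,second_countable_topology}, 'e::euclidean_space) chart set"
  assumes atlas: "smooth_atlas A"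
begin

lemma chart_at: "chart_at A p \<in> A" "p \<in> fst (chart_at A p)"
proof -
  have "\<exists>c. c \<in> A \<and> p \<in> fst c"
    using atlas unfolding smooth_atlas_def by blast
  then have "chart_at A p \<in> A \<and> p \<in> fst (chart_at A p)"
    unfolding chart_at_def by (rule someI_ex)
  then show "chart_at A p \<in> A" "p \<in> fst (chart_at A p)" by auto
qed

context
  fixes c assumes c: "c \<in> A"
begin

lemma chart_homeomorphism: "homeomorphism (fst c) (snd c ` fst c) (snd c) (cinv c)"
  using atlas c unfolding smooth_atlas_def by blast

lemma open_chart: "open (fst c)"
  using atlas c unfolding smooth_atlas_def by blast

lemma cinv_chart [simp]: "p \<in> fst c \<Longrightarrow> cinv c (snd c p) = p"
  using chart_homeomorphism by (simp add: homeomorphism_def)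

lemma open_chart_image: "open W \<Longrightarrow> open (snd c ` (fst c \<inter> W))"
proof -
  assume "open W"
  have "openin (top_of_set (snd c ` fst c)) (snd c ` (fst c \<inter> W))"
    by (rule homeomorphism_imp_open_map[OF chart_homeomorphism]) (use \<open>open W\<close> in auto)
  moreover have "open (snd c ` fst c)"
    using atlas c unfolding smooth_atlas_def by blast
  ultimately show ?thesis
    by (simp add: openin_open_eq)
qed

lemma chart_image_cinv:
  assumes "x \<in> snd c ` (fst c \<inter> W)"
  shows "cinv c x \<in> fst c" "cinv c x \<in> W" "snd c (cinv c x) = x"
  using assms by auto

lemma vsmooth_chart: "vsmooth A (fst c) (snd c)"
  using atlas c unfolding smooth_atlas_def vsmooth_def by blast

end

lemma vsmooth_has_derivative:
  assumes "vsmooth A W F" "c \<in> A" "p \<in> fst c" "p \<in> W"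
  shows "((F \<circ> cinv c) has_derivative frechet_derivative (F \<circ> cinv c) (at (snd c p))) (at (snd c p))"
  using assms unfolding vsmooth_def by (intro smooth_on_has_derivative[of "snd c ` (fst c \<inter> W)"]) auto

lemma vsmooth_local:
  assumes "\<And>p. p \<in> W \<Longrightarrow> \<exists>V. open V \<and> p \<in> V \<and> vsmooth A V F"
  shows "vsmooth A W F"
  unfolding vsmooth_def
proof
  fix c assume c: "c \<in> A"
  show "smooth_on (snd c ` (fst c \<inter> W)) (F \<circ> cinv c)"
  proof (rule smooth_on_local)
    fix x assume "x \<in> snd c ` (fst c \<inter> W)"
    then obtain p where p: "p \<in> fst c" "p \<in> W" "x = snd c p" by auto
    with assms obtain V where V: "open V" "p \<in> V" "vsmooth A V F" by blast
    then show "\<exists>T. open T \<and> x \<in> T \<and> smooth_on T (F \<circ> cinv c)"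
      using p c open_chart_image[OF c V(1)] unfolding vsmooth_def by blast
  qed
qed

lemma vsmooth_cong:
  assumes "open W" "\<And>p. p \<in> W \<Longrightarrow> F p = G p" "vsmooth A W F"
  shows "vsmooth A W G"
  unfolding vsmooth_def
proof
  fix c assume c: "c \<in> A"
  have "smooth_on (snd c ` (fst c \<inter> W)) (F \<circ> cinv c)"
    using assms(3) c unfolding vsmooth_def by blast
  then show "smooth_on (snd c ` (fst c \<inter> W)) (G \<circ> cinv c)"
    by (subst smooth_on_cong[of _ _ "F \<circ> cinv c"])
      (use assms(2) c in \<open>auto simp: open_chart_image[OF c assms(1)]\<close>)
qed

text \<open>Smoothness in one chart passes to the others through the smooth transition maps; later
  proofs verify smoothness near a point in a single well-chosen chart.\<close>

lemma vsmoothI_chart: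
  assumes c: "c \<in> A" and W: "open W" "W \<subseteq> fst c" and F: "smooth_on (snd c ` W) (F \<circ> cinv c)"
  shows "vsmooth A W F"
  unfolding vsmooth_def
proof
  fix d assume d: "d \<in> A"
  let ?S = "snd d ` (fst d \<inter> W)"
  have "smooth_on ?S (snd c \<circ> cinv d)"
    using vsmooth_chart[OF c] d W smooth_on_subset[of "snd d ` (fst d \<inter> fst c)" _ ?S]
    unfolding vsmooth_def by blast
  then have "smooth_on ?S (\<lambda>x. (F \<circ> cinv c) ((snd c \<circ> cinv d) x))"
    by (rule smooth_on_compose[OF open_chart_image[OF d W(1)] _ F]) (use d in auto)
  then show "smooth_on ?S (F \<circ> cinv d)"
    by (subst smooth_on_cong[of _ _ "\<lambda>x. (F \<circ> cinv c) ((snd c \<circ> cinv d) x)"])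
      (use c d W in \<open>auto simp: open_chart_image[OF d W(1)] subset_iff\<close>)
qed

lemma vsmooth_const: "vsmooth A W (\<lambda>_. a)"
  by (simp add: vsmooth_def o_def smooth_on_const)

context
  fixes W :: "'m set" assumes W: "open W"
begin

lemma vsmooth_bounded_linear:
  "bounded_linear L \<Longrightarrow> vsmooth A W F \<Longrightarrow> vsmooth A W (\<lambda>p. L (F p))"
  using smooth_on_bounded_linear[OF _ open_chart_image[OF _ W], of L _ "F \<circ> cinv c" for c]
  by (auto simp: vsmooth_def o_def)

lemma vsmooth_bounded_bilinear:
  "bounded_bilinear B \<Longrightarrow> vsmooth A W F \<Longrightarrow> vsmooth A W G \<Longrightarrow> vsmooth A W (\<lambda>p. B (F p) (G p))"
  using smooth_on_bounded_bilinear[OF _ open_chart_image[OF _ W], of B _ "F \<circ> cinv c" "G \<circ> cinv c" for c]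
  by (auto simp: vsmooth_def o_def)

lemma vsmooth_add: "vsmooth A W F \<Longrightarrow> vsmooth A W G \<Longrightarrow> vsmooth A W (\<lambda>p. F p + G p)"
  using smooth_on_add[OF open_chart_image[OF _ W], of _ "F \<circ> cinv c" "G \<circ> cinv c" for c]
  by (auto simp: vsmooth_def o_def)

lemma vsmooth_sum:
  "(\<And>i. i \<in> I \<Longrightarrow> vsmooth A W (F i)) \<Longrightarrow> vsmooth A W (\<lambda>p. \<Sum>i\<in>I. F i p)"
  by (induction I rule: infinite_finite_induct) (auto intro!: vsmooth_const vsmooth_add)

lemmas vsmooth_scaleR = vsmooth_bounded_bilinear[OF bounded_bilinear_scaleR]
lemmas vsmooth_mult = vsmooth_bounded_bilinear[OF bounded_bilinear_mult]
lemmas vsmooth_inner_const = vsmooth_bounded_linear[OF bounded_linear_inner_left]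

lemma vsmooth_inverse:
  fixes F :: "'m \<Rightarrow> real"
  assumes "vsmooth A W F" "\<And>p. p \<in> W \<Longrightarrow> F p \<noteq> 0"
  shows "vsmooth A W (\<lambda>p. inverse (F p))"
  unfolding vsmooth_def
proof
  fix c assume c: "c \<in> A"
  have "smooth_on (snd c ` (fst c \<inter> W)) (\<lambda>x. inverse ((F \<circ> cinv c) x))"
  proof (rule smooth_on_compose[OF open_chart_image[OF c W] _ smooth_on_inverse])
    show "smooth_on (snd c ` (fst c \<inter> W)) (F \<circ> cinv c)"
      using assms(1) c unfolding vsmooth_def by blast
  qed (use assms(2) c in auto)
  then show "smooth_on (snd c ` (fst c \<inter> W)) ((\<lambda>p. inverse (F p)) \<circ> cinv c)"
    by (simp add: o_def)
qed

end

lemma frechet_derivative_transition: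
  assumes F: "vsmooth A W F" and W: "open W" and cd: "c \<in> A" "d \<in> A"
    and p: "p \<in> W" "p \<in> fst c" "p \<in> fst d"
  shows "frechet_derivative (F \<circ> cinv d) (at (snd d p)) v =
    frechet_derivative (F \<circ> cinv c) (at (snd c p)) (frechet_derivative (snd c \<circ> cinv d) (at (snd d p)) v)"
proof -
  have 1: "((snd c \<circ> cinv d) has_derivative frechet_derivative (snd c \<circ> cinv d) (at (snd d p))) (at (snd d p))"
    by (rule vsmooth_has_derivative[OF vsmooth_chart[OF cd(1)] cd(2) p(3) p(2)])
  have 2: "((F \<circ> cinv c) has_derivative frechet_derivative (F \<circ> cinv c) (at (snd c p)))
      (at ((snd c \<circ> cinv d) (snd d p)))"
    using vsmooth_has_derivative[OF F cd(1) p(2) p(1)] cd p by simp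
  have "((\<lambda>x. (F \<circ> cinv c) ((snd c \<circ> cinv d) x)) has_derivative
      (\<lambda>v. frechet_derivative (F \<circ> cinv c) (at (snd c p))
        (frechet_derivative (snd c \<circ> cinv d) (at (snd d p)) v))) (at (snd d p))"
    by (rule has_derivative_compose[OF 1 2])
  moreover have "open (snd d ` (fst d \<inter> (fst c \<inter> W)))"
    by (intro open_chart_image cd open_Int open_chart W)
  ultimately have "((F \<circ> cinv d) has_derivative
      (\<lambda>v. frechet_derivative (F \<circ> cinv c) (at (snd c p))
        (frechet_derivative (snd c \<circ> cinv d) (at (snd d p)) v))) (at (snd d p))"
    by (rule has_derivative_transform_within_open) (use p cd in auto)
  then show ?thesis
    by (simp add: frechet_derivative_eq)
qed

lemma frechet_derivative_chart_id:
  assumes "c \<in> A" "p \<in> fst c"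
  shows "frechet_derivative (snd c \<circ> cinv c) (at (snd c p)) v = v"
proof -
  have "((\<lambda>x. x) has_derivative (\<lambda>v. v)) (at (snd c p))" by simp
  then have "((snd c \<circ> cinv c) has_derivative (\<lambda>v. v)) (at (snd c p))"
    by (rule has_derivative_transform_within_open[where s = "snd c ` (fst c \<inter> UNIV)"])
      (use assms open_chart_image[OF assms(1) open_UNIV] in auto)
  then show ?thesis by (simp add: frechet_derivative_eq)
qed

lemma vderivI:
  "((F \<circ> cinv (chart_at A p)) has_derivative D) (at (snd (chart_at A p) p)) \<Longrightarrow> vderiv A p v F = D v"
  by (simp add: vderiv_def frechet_derivative_eq)

lemma vderiv_const: "vderiv A p v (\<lambda>q. a) = 0"
  by (rule vderivI) (simp add: o_def)

context
  fixes W :: "'m set" and p :: 'm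
  assumes W: "open W" and p: "p \<in> W"
begin

lemma vderiv_has_derivative:
  "vsmooth A W F \<Longrightarrow>
    ((F \<circ> cinv (chart_at A p)) has_derivative (\<lambda>v. vderiv A p v F)) (at (snd (chart_at A p) p))"
  unfolding vderiv_def by (rule vsmooth_has_derivative[OF _ chart_at p])

lemma vderiv_cong: "(\<And>q. q \<in> W \<Longrightarrow> F q = G q) \<Longrightarrow> vderiv A p v F = vderiv A p v G"
  unfolding vderiv_def
  by (rule fun_cong, rule frechet_derivative_cong[where S = "snd (chart_at A p) ` (fst (chart_at A p) \<inter> W)"])
    (use open_chart_image[OF chart_at(1) W] chart_at p in auto)

lemma vderiv_linear: "vsmooth A W F \<Longrightarrow> linear (\<lambda>v. vderiv A p v F)"
  by (rule bounded_linear.linear[OF has_derivative_bounded_linear[OF vderiv_has_derivative]])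

text \<open>Frees \<open>vderiv\<close> from the preferred chart at p: with \<open>c\<close> held
  fixed the right-hand side can be followed as p moves.\<close>

lemma vderiv_chart:
  assumes "vsmooth A W F" "c \<in> A" "p \<in> fst c"
  shows "vderiv A p v F = frechet_derivative (F \<circ> cinv c) (at (snd c p)) (tcoord A c p v)"
  unfolding vderiv_def tcoord_def
  by (rule frechet_derivative_transition[OF assms(1) W assms(2) chart_at(1) p assms(3) chart_at(2)])

lemma vderiv_add:
  assumes "vsmooth A W F" "vsmooth A W G"
  shows "vderiv A p v (\<lambda>q. F q + G q) = vderiv A p v F + vderiv A p v G"
  using has_derivative_add[OF assms[THEN vderiv_has_derivative]] by (intro vderivI) (simp add: o_def)

lemma vderiv_bounded_bilinear:
  assumes "bounded_bilinear B" "vsmooth A W F" "vsmooth A W G"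
  shows "vderiv A p v (\<lambda>q. B (F q) (G q)) = B (F p) (vderiv A p v G) + B (vderiv A p v F) (G p)"
  using bounded_bilinear.FDERIV[OF assms(1) assms(2,3)[THEN vderiv_has_derivative]] chart_at
  by (intro vderivI) (simp add: o_def)

lemma vderiv_bounded_linear:
  assumes "bounded_linear L" "vsmooth A W F"
  shows "vderiv A p v (\<lambda>q. L (F q)) = L (vderiv A p v F)"
  using bounded_linear.has_derivative[OF assms(1) vderiv_has_derivative[OF assms(2)]]
  by (intro vderivI) (simp add: o_def)

lemma vderiv_sum:
  "(\<And>i. i \<in> I \<Longrightarrow> vsmooth A W (F i)) \<Longrightarrow> vderiv A p v (\<lambda>q. \<Sum>i\<in>I. F i q) = (\<Sum>i\<in>I. vderiv A p v (F i))"
  by (induction I rule: infinite_finite_induct) (auto simp: vderiv_const vderiv_add vsmooth_sum[OF W])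

end

lemma tcoord_chart_at [simp]: "tcoord A (chart_at A p) p v = v"
  unfolding tcoord_def by (rule frechet_derivative_chart_id[OF chart_at])

lemma tcoord_transition:
  assumes "c \<in> A" "d \<in> A" "p \<in> fst c" "p \<in> fst d"
  shows "tcoord A d p u = frechet_derivative (snd d \<circ> cinv c) (at (snd c p)) (tcoord A c p u)"
  unfolding tcoord_eq_vderiv[of A d]
  by (rule vderiv_chart[OF open_chart[OF assms(2)] assms(4) vsmooth_chart[OF assms(2)] assms(1,3)])

context
  fixes c p assumes c: "c \<in> A" and p: "p \<in> fst c"
begin

lemma coord_field_tcoord [simp]: "coord_field A c (tcoord A c p u) p = u"
  using tcoord_transition[OF c chart_at(1) p chart_at(2), of u] by (simp add: coord_field_def)

lemma tcoord_coord_field [simp]: "tcoord A c p (coord_field A c v p) = v"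
  using frechet_derivative_transition[OF vsmooth_chart[OF c] open_chart[OF c] chart_at(1) c p chart_at(2) p, of v]
  by (simp add: tcoord_def coord_field_def frechet_derivative_chart_id[OF c p])

lemma linear_tcoord: "linear (tcoord A c p)"
  using vderiv_linear[OF open_chart[OF c] p vsmooth_chart[OF c]] by (simp add: tcoord_eq_vderiv[abs_def])

lemma linear_coord_field: "linear (\<lambda>v. coord_field A c v p)"
  unfolding coord_field_def
  by (rule bounded_linear.linear[OF has_derivative_bounded_linear[OF
      vsmooth_has_derivative[OF vsmooth_chart[OF chart_at(1)] c p chart_at(2)]]])

lemma coord_field_expansion:
  "u = (\<Sum>b\<in>Basis. inner (tcoord A c p u) b *\<^sub>R coord_field A c b p)"
  using linear_eq_sum_Basis[OF linear_coord_field, of "tcoord A c p u"] by simp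

end

lemma coord_field_chart_at [simp]: "coord_field A (chart_at A p) v p = v"
  using coord_field_tcoord[OF chart_at, of p v] by simp

text \<open>The Euclidean bump is pulled back by a chart and extended by zero off K, the preimage of
  a closed ball. K is compact, hence closed because the manifold is Hausdorff, so the chart domain
  and the complement of K form an open cover on each member of which smoothness is clear. K is part
  of the result because extending fields by zero needs the same cover.\<close>

lemma bump_function:
  assumes W: "open W" and p: "p \<in> W"
  obtains h :: "'m \<Rightarrow> real" and K
  where "vsmooth A UNIV h" "h p = 1" "closed K" "K \<subseteq> W" "\<And>q. q \<notin> K \<Longrightarrow> h q = 0"
proof -
  define c where "c = chart_at A p"
  have c: "c \<in> A" "p \<in> fst c" using chart_at by (auto simp: c_def)
  let ?O = "snd c ` (fst c \<inter> W)"
  have "open ?O" by (rule open_chart_image[OF c(1) W])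
  then obtain r where r: "r > 0" "cball (snd c p) r \<subseteq> ?O"
    using c p open_contains_cball[of ?O] by blast
  obtain \<beta> :: "'e \<Rightarrow> real" where \<beta>: "smooth_on UNIV \<beta>" "\<beta> (snd c p) = 1"
      "\<And>x. x \<notin> ball (snd c p) r \<Longrightarrow> \<beta> x = 0"
    using smooth_bump[OF r(1)] by blast
  define K where "K = cinv c ` cball (snd c p) r"
  define h where "h q = (if q \<in> K then \<beta> (snd c q) else 0)" for q
  have "continuous_on (snd c ` fst c) (cinv c)"
    using chart_homeomorphism[OF c(1)] by (simp add: homeomorphism_def)
  then have "continuous_on (cball (snd c p) r) (cinv c)"
    by (rule continuous_on_subset) (use r in auto)
  then have K: "closed K"
    unfolding K_def by (intro compact_imp_closed compact_continuous_image compact_cball)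
  have KW: "K \<subseteq> fst c \<inter> W"
  proof
    fix q assume "q \<in> K"
    then obtain x where "x \<in> cball (snd c p) r" "q = cinv c x" unfolding K_def by blast
    with r(2) have "x \<in> ?O" "q = cinv c x" by blast+
    then show "q \<in> fst c \<inter> W" using chart_image_cinv[OF c(1)] by auto
  qed
  have h: "h q = \<beta> (snd c q)" if "q \<in> fst c" for q
  proof (cases "snd c q \<in> cball (snd c p) r")
    case True
    then have "cinv c (snd c q) \<in> K" unfolding K_def by (rule imageI)
    then have "q \<in> K" using cinv_chart[OF c(1) that] by simp
    then show ?thesis by (simp add: h_def)
  next
    case False
    then have "\<beta> (snd c q) = 0" using \<beta>(3) by auto
    then show ?thesis by (simp add: h_def)
  qed
  show thesis
  proof
    show "vsmooth A UNIV h"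
    proof (rule vsmooth_local)
      fix q
      have "vsmooth A (fst c) h"
      proof (rule vsmoothI_chart[OF c(1) open_chart[OF c(1)] order_refl])
        have "open (snd c ` fst c)" using open_chart_image[OF c(1) open_UNIV] by simp
        then show "smooth_on (snd c ` fst c) (h \<circ> cinv c)"
          by (subst smooth_on_cong[of _ _ \<beta>]) (use c in \<open>auto simp: h intro: smooth_on_subset[OF \<beta>(1)]\<close>)
      qed
      moreover have "vsmooth A (- K) h"
        by (rule vsmooth_cong[OF _ _ vsmooth_const[of _ 0]]) (use K in \<open>auto simp: h_def\<close>)
      moreover have "q \<in> fst c \<or> q \<in> - K" using KW by auto
      ultimately show "\<exists>V. open V \<and> q \<in> V \<and> vsmooth A V h"
        using open_chart[OF c(1)] open_Compl[OF K] by auto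
    qed
    show "h p = 1" using h[OF c(2)] \<beta>(2) by simp
  qed (use K KW h_def in auto)
qed

end

context atlas
begin

lemma vsmooth_frechet_derivative:
  assumes c: "c \<in> A" and W: "open W" and F: "vsmooth A W F"
  shows "vsmooth A (W \<inter> fst c) (\<lambda>q. frechet_derivative (F \<circ> cinv c) (at (snd c q)) b)"
proof (rule vsmoothI_chart[OF c])
  have o: "open (snd c ` (W \<inter> fst c))"
    using open_chart_image[OF c W] by (simp add: Int_commute)
  have "smooth_on (snd c ` (W \<inter> fst c)) (F \<circ> cinv c)"
    using F c unfolding vsmooth_def by (metis Int_commute)
  then have "smooth_on (snd c ` (W \<inter> fst c)) (\<lambda>x. frechet_derivative (F \<circ> cinv c) (at x) b)"
    by (rule smooth_on_deriv)
  then show "smooth_on (snd c ` (W \<inter> fst c))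
      ((\<lambda>q. frechet_derivative (F \<circ> cinv c) (at (snd c q)) b) \<circ> cinv c)"
    by (subst smooth_on_cong[OF o]) (use c in \<open>auto\<close>)
qed (use W open_chart[OF c] in auto)

lemma smooth_field_tcoord:
  assumes "smooth_field A W X" "c \<in> A" "open W"
  shows "vsmooth A (W \<inter> fst c) (\<lambda>q. tcoord A c q (X q))"
proof (rule vsmoothI_chart[OF assms(2)])
  show "smooth_on (snd c ` (W \<inter> fst c)) ((\<lambda>q. tcoord A c q (X q)) \<circ> cinv c)"
    using assms unfolding smooth_field_def by (simp add: o_def Int_commute)
qed (use assms(3) open_chart[OF assms(2)] in auto)

text \<open>In a fixed chart X(F) is the sum of the components of X times the partial derivatives of
  F, all of them smooth.\<close>

lemma vsmooth_vderiv:
  assumes F: "vsmooth A W F" and W: "open W" and X: "smooth_field A W X"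
  shows "vsmooth A W (\<lambda>q. vderiv A q (X q) F)"
proof (rule vsmooth_local)
  fix p assume p: "p \<in> W"
  define c where "c = chart_at A p"
  have c: "c \<in> A" "p \<in> fst c" using chart_at by (auto simp: c_def)
  have o: "open (W \<inter> fst c)" using W open_chart[OF c(1)] by auto
  have "vsmooth A (W \<inter> fst c) (\<lambda>q. \<Sum>b\<in>Basis. inner (tcoord A c q (X q)) b *\<^sub>R
      frechet_derivative (F \<circ> cinv c) (at (snd c q)) b)"
    by (intro vsmooth_sum[OF o] vsmooth_scaleR[OF o] vsmooth_inner_const[OF o]
        smooth_field_tcoord[OF X c(1) W] vsmooth_frechet_derivative[OF c(1) W F])
  then have "vsmooth A (W \<inter> fst c) (\<lambda>q. vderiv A q (X q) F)"
  proof (rule vsmooth_cong[OF o, rotated])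
    fix q assume q: "q \<in> W \<inter> fst c"
    have "linear (frechet_derivative (F \<circ> cinv c) (at (snd c q)))"
      using q by (intro bounded_linear.linear[OF has_derivative_bounded_linear[OF
            vsmooth_has_derivative[OF F c(1)]]]) auto
    then show "(\<Sum>b\<in>Basis. inner (tcoord A c q (X q)) b *\<^sub>R
        frechet_derivative (F \<circ> cinv c) (at (snd c q)) b) = vderiv A q (X q) F"
      using vderiv_chart[OF W _ F c(1), of q "X q"] q linear_eq_sum_Basis by (metis IntE)
  qed
  then show "\<exists>V. open V \<and> p \<in> V \<and> vsmooth A V (\<lambda>q. vderiv A q (X q) F)"
    using o p c(2) by (intro exI[of _ "W \<inter> fst c"]) auto
qed

end

lemma smooth_field_subset:
  assumes "smooth_field A W X" "V \<subseteq> W"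
  shows "smooth_field A V X"
  unfolding smooth_field_def
proof
  fix c assume "c \<in> A"
  with assms(1) have "smooth_on (snd c ` (fst c \<inter> W)) (\<lambda>x. tcoord A c (cinv c x) (X (cinv c x)))"
    unfolding smooth_field_def by blast
  then show "smooth_on (snd c ` (fst c \<inter> V)) (\<lambda>x. tcoord A c (cinv c x) (X (cinv c x)))"
    by (rule smooth_on_subset) (use assms(2) in auto)
qed

lemma smooth_endo_subset:
  assumes "smooth_endo A W s" "V \<subseteq> W"
  shows "smooth_endo A V s"
  unfolding smooth_endo_def
proof (intro ballI allI)
  fix c v assume "c \<in> A"
  with assms(1) have "smooth_on (snd c ` (fst c \<inter> W))
      (\<lambda>x. tcoord A c (cinv c x) (blinfun_apply (s (cinv c x)) (coord_field A c v (cinv c x))))"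
    unfolding smooth_endo_def by blast
  then show "smooth_on (snd c ` (fst c \<inter> V))
      (\<lambda>x. tcoord A c (cinv c x) (blinfun_apply (s (cinv c x)) (coord_field A c v (cinv c x))))"
    by (rule smooth_on_subset) (use assms(2) in auto)
qed

section \<open>Smooth vector fields along a map, over an open subset of the source\<close>

definition along ::
    "('n, 'f::euclidean_space) chart set \<Rightarrow> ('m, 'e::euclidean_space) chart set \<Rightarrow> ('n \<Rightarrow> 'm) \<Rightarrow>
     'n set \<Rightarrow> ('n \<Rightarrow> 'e) \<Rightarrow> bool" where
  "along AN AM f W \<xi> \<longleftrightarrow>
     (\<forall>d\<in>AM. vsmooth AN (W \<inter> f -` fst d) (\<lambda>q. tcoord AM d (f q) (\<xi> q)))"

lemma smooth_along_iff_along: "smooth_along AN AM f \<xi> \<longleftrightarrow> along AN AM f UNIV \<xi>"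
  unfolding smooth_along_def along_def vsmooth_def o_def by auto

lemma along_subset: "along AN AM f W \<xi> \<Longrightarrow> V \<subseteq> W \<Longrightarrow> along AN AM f V \<xi>"
  unfolding along_def by (auto intro: vsmooth_subset[of _ "W \<inter> _"])

locale atlas_map = N: atlas AN + M: atlas AM
  for AN :: "('n::{t2_space,second_countable_topology}, 'f::euclidean_space) chart set"
    and AM :: "('m::{t2_space,second_countable_topology}, 'e::euclidean_space) chart set" +
  fixes f :: "'n \<Rightarrow> 'm"
  assumes smooth_f: "smooth_map AN AM f"
begin

lemma open_vimage_f: "open W \<Longrightarrow> open (f -` W)"
  using smooth_f unfolding smooth_map_def by (intro open_vimage) auto

lemma open_vimage_chart: "d \<in> AM \<Longrightarrow> open (f -` fst d)"
  by (rule open_vimage_f[OF M.open_chart])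

lemma vsmooth_chart_comp: "d \<in> AM \<Longrightarrow> vsmooth AN (f -` fst d) (snd d \<circ> f)"
  using smooth_f unfolding smooth_map_def vsmooth_def by (simp add: o_assoc)

lemma vsmooth_comp:
  assumes h: "vsmooth AM W h" and W: "open W"
  shows "vsmooth AN (f -` W) (h \<circ> f)"
proof (rule N.vsmooth_local)
  fix p assume p: "p \<in> f -` W"
  define c where "c = chart_at AN p"
  define d where "d = chart_at AM (f p)"
  have c: "c \<in> AN" "p \<in> fst c" using N.chart_at by (auto simp: c_def)
  have d: "d \<in> AM" "f p \<in> fst d" using M.chart_at by (auto simp: d_def)
  define V where "V = fst c \<inter> f -` (fst d \<inter> W)"
  have V: "open V" "V \<subseteq> fst c"
    using N.open_chart[OF c(1)] open_vimage_f[OF open_Int[OF M.open_chart[OF d(1)] W]]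
    by (auto simp: V_def)
  have oV: "open (snd c ` V)"
    using N.open_chart_image[OF c(1) V(1)] V(2) by (simp add: Int_absorb1)
  have "vsmooth AN V (h \<circ> f)"
  proof (rule N.vsmoothI_chart[OF c(1) V])
    have "smooth_on (snd c ` (fst c \<inter> f -` fst d)) (snd d \<circ> f \<circ> cinv c)"
      using vsmooth_chart_comp[OF d(1)] c unfolding vsmooth_def by (simp add: o_assoc)
    then have 1: "smooth_on (snd c ` V) (snd d \<circ> f \<circ> cinv c)"
      by (rule smooth_on_subset) (auto simp: V_def)
    have 2: "smooth_on (snd d ` (fst d \<inter> W)) (h \<circ> cinv d)"
      using h d unfolding vsmooth_def by blast
    have "smooth_on (snd c ` V) (\<lambda>x. (h \<circ> cinv d) ((snd d \<circ> f \<circ> cinv c) x))"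
      by (rule smooth_on_compose[OF oV 1 2]) (use c in \<open>auto simp: V_def\<close>)
    then show "smooth_on (snd c ` V) (h \<circ> f \<circ> cinv c)"
      by (subst smooth_on_cong[OF oV, of _ "\<lambda>x. (h \<circ> cinv d) ((snd d \<circ> f \<circ> cinv c) x)"])
        (use c d in \<open>auto simp: V_def\<close>)
  qed
  then show "\<exists>V. open V \<and> p \<in> V \<and> vsmooth AN V (h \<circ> f)"
    using V p c d by (intro exI[of _ V]) (simp add: V_def)
qed

lemma vderiv_comp:
  assumes h: "vsmooth AM W h" and W: "open W" and p: "f p \<in> W"
  shows "vderiv AN p v (h \<circ> f) = vderiv AM (f p) (mdiff AN AM f p v) h"
proof -
  define c where "c = chart_at AN p"
  define d where "d = chart_at AM (f p)"
  have c: "c \<in> AN" "p \<in> fst c" using N.chart_at by (auto simp: c_def)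
  have d: "d \<in> AM" "f p \<in> fst d" using M.chart_at by (auto simp: d_def)
  have 1: "((snd d \<circ> f \<circ> cinv c) has_derivative mdiff AN AM f p) (at (snd c p))"
    using N.vsmooth_has_derivative[OF vsmooth_chart_comp[OF d(1)] c] d(2)
    by (simp add: mdiff_def[abs_def] c_def d_def)
  have 2: "((h \<circ> cinv d) has_derivative (\<lambda>w. vderiv AM (f p) w h)) (at ((snd d \<circ> f \<circ> cinv c) (snd c p)))"
    using M.vderiv_has_derivative[OF W p h] c by (simp add: d_def)
  have "((\<lambda>x. (h \<circ> cinv d) ((snd d \<circ> f \<circ> cinv c) x)) has_derivative
      (\<lambda>v. vderiv AM (f p) (mdiff AN AM f p v) h)) (at (snd c p))"
    by (rule has_derivative_compose[OF 1 2])
  then have "((h \<circ> f \<circ> cinv c) has_derivative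
      (\<lambda>v. vderiv AM (f p) (mdiff AN AM f p v) h)) (at (snd c p))"
    by (rule has_derivative_transform_within_open[OF _
          N.open_chart_image[OF c(1) open_vimage_f[OF M.open_chart[OF d(1)]]]])
      (use c d in auto)
  then show ?thesis
    by (simp add: vderiv_def frechet_derivative_eq c_def)
qed

lemma linear_mdiff: "linear (mdiff AN AM f p)"
  using N.vderiv_linear[OF open_vimage_chart[OF M.chart_at(1)] _ vsmooth_chart_comp[OF M.chart_at(1)],
      of p "f p"] M.chart_at(2)
  by (simp add: mdiff_eq_vderiv[abs_def])

lemma tcoord_mdiff:
  assumes "d \<in> AM" "f p \<in> fst d"
  shows "tcoord AM d (f p) (mdiff AN AM f p v) = vderiv AN p v (snd d \<circ> f)"
  using vderiv_comp[OF M.vsmooth_chart[OF assms(1)] M.open_chart[OF assms(1)] assms(2)]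
  by (simp add: tcoord_eq_vderiv)

lemma along_vsmooth_tcoord:
  "along AN AM f W \<xi> \<Longrightarrow> d \<in> AM \<Longrightarrow> vsmooth AN (W \<inter> f -` fst d) (\<lambda>q. tcoord AM d (f q) (\<xi> q))"
  unfolding along_def by blast

lemma along_local:
  assumes "\<And>p. p \<in> W \<Longrightarrow> \<exists>V. open V \<and> p \<in> V \<and> along AN AM f V \<xi>"
  shows "along AN AM f W \<xi>"
  unfolding along_def
proof
  fix d assume d: "d \<in> AM"
  show "vsmooth AN (W \<inter> f -` fst d) (\<lambda>q. tcoord AM d (f q) (\<xi> q))"
  proof (rule N.vsmooth_local)
    fix p assume p: "p \<in> W \<inter> f -` fst d"
    with assms obtain V where V: "open V" "p \<in> V" "along AN AM f V \<xi>" by blast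
    then show "\<exists>V. open V \<and> p \<in> V \<and> vsmooth AN V (\<lambda>q. tcoord AM d (f q) (\<xi> q))"
      using along_vsmooth_tcoord[OF V(3) d] p open_Int[OF V(1) open_vimage_chart[OF d]]
      by (intro exI[of _ "V \<inter> f -` fst d"]) auto
  qed
qed

lemma along_cong:
  assumes W: "open W" and "\<And>q. q \<in> W \<Longrightarrow> \<xi> q = \<eta> q" and "along AN AM f W \<xi>"
  shows "along AN AM f W \<eta>"
  unfolding along_def
proof
  fix d assume d: "d \<in> AM"
  show "vsmooth AN (W \<inter> f -` fst d) (\<lambda>q. tcoord AM d (f q) (\<eta> q))"
    by (rule N.vsmooth_cong[OF _ _ along_vsmooth_tcoord[OF assms(3) d]])
      (use assms(2) open_Int[OF W open_vimage_chart[OF d]] in auto)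
qed

text \<open>Passing from \<open>d\<close> to another chart of M multiplies the components by the
  Jacobian of the transition map, which is smooth on M and remains so after composition with
  f.\<close>

lemma alongI_chart:
  assumes d: "d \<in> AM" and W: "open W" "W \<subseteq> f -` fst d"
    and \<xi>: "vsmooth AN W (\<lambda>q. tcoord AM d (f q) (\<xi> q))"
  shows "along AN AM f W \<xi>"
  unfolding along_def
proof
  fix d' assume d': "d' \<in> AM"
  let ?D = "\<lambda>m. frechet_derivative (snd d' \<circ> cinv d) (at (snd d m))"
  let ?V = "W \<inter> f -` fst d'"
  have V: "open ?V" using W(1) open_vimage_chart[OF d'] by auto
  have D: "vsmooth AN ?V (\<lambda>q. ?D (f q) b)" for b
  proof -
    have "vsmooth AN (f -` (fst d' \<inter> fst d)) ((\<lambda>m. ?D m b) \<circ> f)"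
      by (intro vsmooth_comp M.vsmooth_frechet_derivative[OF d M.open_chart[OF d'] M.vsmooth_chart[OF d']]
          open_Int M.open_chart d d')
    then show ?thesis
      unfolding o_def by (rule vsmooth_subset) (use W(2) in auto)
  qed
  have "vsmooth AN ?V (\<lambda>q. \<Sum>b\<in>Basis. inner (tcoord AM d (f q) (\<xi> q)) b *\<^sub>R ?D (f q) b)"
    by (intro N.vsmooth_sum[OF V] N.vsmooth_scaleR[OF V] N.vsmooth_inner_const[OF V] D
        vsmooth_subset[OF \<xi>]) auto
  then show "vsmooth AN ?V (\<lambda>q. tcoord AM d' (f q) (\<xi> q))"
  proof (rule N.vsmooth_cong[OF V, rotated])
    fix q assume q: "q \<in> ?V"
    then have fq: "f q \<in> fst d" "f q \<in> fst d'" using W(2) by auto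
    have "linear (?D (f q))"
      by (intro bounded_linear.linear[OF has_derivative_bounded_linear[OF
            M.vsmooth_has_derivative[OF M.vsmooth_chart[OF d'] d fq]]])
    then show "(\<Sum>b\<in>Basis. inner (tcoord AM d (f q) (\<xi> q)) b *\<^sub>R ?D (f q) b) = tcoord AM d' (f q) (\<xi> q)"
      using M.tcoord_transition[OF d d' fq] linear_eq_sum_Basis by metis
  qed
qed

lemma along_coord_field:
  assumes d: "d \<in> AM"
  shows "along AN AM f (f -` fst d) (\<lambda>q. coord_field AM d v (f q))"
  by (rule alongI_chart[OF d open_vimage_chart[OF d] order_refl],
      rule N.vsmooth_cong[OF open_vimage_chart[OF d] _ N.vsmooth_const[of _ v]])
    (use d in simp)

lemma along_add:
  assumes W: "open W" and \<xi>: "along AN AM f W \<xi>" and \<eta>: "along AN AM f W \<eta>"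
  shows "along AN AM f W (\<lambda>q. \<xi> q + \<eta> q)"
  unfolding along_def
proof
  fix d assume d: "d \<in> AM"
  have V: "open (W \<inter> f -` fst d)" using W open_vimage_chart[OF d] by auto
  show "vsmooth AN (W \<inter> f -` fst d) (\<lambda>q. tcoord AM d (f q) (\<xi> q + \<eta> q))"
    by (rule N.vsmooth_cong[OF V _ N.vsmooth_add[OF V \<xi>[THEN along_vsmooth_tcoord, OF d]
            \<eta>[THEN along_vsmooth_tcoord, OF d]]])
      (use M.linear_tcoord[OF d] in \<open>auto simp: linear_add\<close>)
qed

lemma along_scaleR:
  assumes W: "open W" and h: "vsmooth AN W h" and \<xi>: "along AN AM f W \<xi>"
  shows "along AN AM f W (\<lambda>q. h q *\<^sub>R \<xi> q)"
  unfolding along_def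
proof
  fix d assume d: "d \<in> AM"
  have V: "open (W \<inter> f -` fst d)" using W open_vimage_chart[OF d] by auto
  show "vsmooth AN (W \<inter> f -` fst d) (\<lambda>q. tcoord AM d (f q) (h q *\<^sub>R \<xi> q))"
    by (rule N.vsmooth_cong[OF V _ N.vsmooth_scaleR[OF V vsmooth_subset[OF h]
            \<xi>[THEN along_vsmooth_tcoord, OF d]]])
      (use M.linear_tcoord[OF d] in \<open>auto simp: linear_scale\<close>)
qed

lemma along_zero: "along AN AM f W (\<lambda>q. 0)"
  unfolding along_def
proof
  fix d assume d: "d \<in> AM"
  have "vsmooth AN (f -` fst d) (\<lambda>q. tcoord AM d (f q) 0)"
    by (rule N.vsmooth_cong[OF open_vimage_chart[OF d] _ N.vsmooth_const[of _ 0]])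
      (use M.linear_tcoord[OF d] in \<open>auto simp: linear_0\<close>)
  then show "vsmooth AN (W \<inter> f -` fst d) (\<lambda>q. tcoord AM d (f q) 0)"
    by (rule vsmooth_subset) auto
qed

lemma along_sum:
  assumes W: "open W"
  shows "(\<And>i. i \<in> I \<Longrightarrow> along AN AM f W (\<xi> i)) \<Longrightarrow> along AN AM f W (\<lambda>q. \<Sum>i\<in>I. \<xi> i q)"
proof (induction I rule: infinite_finite_induct)
  case (insert x F)
  then show ?case using along_add[OF W, of "\<xi> x" "\<lambda>q. \<Sum>i\<in>F. \<xi> i q"] by simp
qed (simp_all add: along_zero)

lemma along_field_comp:
  assumes Y: "smooth_field AM W Y" and W: "open W"
  shows "along AN AM f (f -` W) (\<lambda>q. Y (f q))"
  unfolding along_def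
proof
  fix d assume d: "d \<in> AM"
  have "vsmooth AN (f -` (W \<inter> fst d)) ((\<lambda>m. tcoord AM d m (Y m)) \<circ> f)"
    by (intro vsmooth_comp M.smooth_field_tcoord[OF Y d W] open_Int W M.open_chart d)
  then show "vsmooth AN (f -` W \<inter> f -` fst d) (\<lambda>q. tcoord AM d (f q) (Y (f q)))"
    by (simp add: o_def)
qed

text \<open>The components of \<open>df(X)\<close> in a chart of M are the derivatives along X of
  the coordinates of f.\<close>

lemma along_mdiff:
  assumes X: "smooth_field AN W X" and W: "open W"
  shows "along AN AM f W (\<lambda>q. mdiff AN AM f q (X q))"
  unfolding along_def
proof
  fix d assume d: "d \<in> AM"
  have V: "open (W \<inter> f -` fst d)" using W open_vimage_chart[OF d] by auto
  have "vsmooth AN (W \<inter> f -` fst d) (\<lambda>q. vderiv AN q (X q) (snd d \<circ> f))"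
  proof (rule N.vsmooth_vderiv[OF _ V])
    show "vsmooth AN (W \<inter> f -` fst d) (snd d \<circ> f)"
      by (rule vsmooth_subset[OF vsmooth_chart_comp[OF d]]) auto
    show "smooth_field AN (W \<inter> f -` fst d) X"
      by (rule smooth_field_subset[OF X]) simp
  qed
  then show "vsmooth AN (W \<inter> f -` fst d) (\<lambda>q. tcoord AM d (f q) (mdiff AN AM f q (X q)))"
    by (rule N.vsmooth_cong[OF V, rotated]) (use tcoord_mdiff[OF d] in auto)
qed

lemma along_bump:
  assumes W: "open W" and \<xi>: "along AN AM f W \<xi>" and p: "p \<in> W"
  obtains h where "along AN AM f UNIV (\<lambda>q. h q *\<^sub>R \<xi> q)" "h p = 1" "\<And>q. q \<notin> W \<Longrightarrow> h q = 0"
proof -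
  obtain h :: "'n \<Rightarrow> real" and K
    where h: "vsmooth AN UNIV h" "h p = 1" "closed K" "K \<subseteq> W" "\<And>q. q \<notin> K \<Longrightarrow> h q = 0"
    by (rule N.bump_function[OF W p]) blast
  show thesis
  proof (rule that)
    show "along AN AM f UNIV (\<lambda>q. h q *\<^sub>R \<xi> q)"
    proof (rule along_local)
      fix q
      have 1: "along AN AM f W (\<lambda>q. h q *\<^sub>R \<xi> q)"
        by (rule along_scaleR[OF W vsmooth_subset[OF h(1)] \<xi>]) simp
      have 2: "along AN AM f (- K) (\<lambda>q. h q *\<^sub>R \<xi> q)"
        by (rule along_cong[OF _ _ along_zero]) (use h in auto)
      have "q \<in> W \<or> q \<in> - K" using h(4) by auto
      then show "\<exists>V. open V \<and> q \<in> V \<and> along AN AM f V (\<lambda>q. h q *\<^sub>R \<xi> q)"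
        using 1 2 W open_Compl[OF h(3)] by auto
    qed
    show "h p = 1" by (rule h(2))
    show "h q = 0" if "q \<notin> W" for q
      by (rule h(5)) (use h(4) that in blast)
  qed
qed

definition component :: "('m, 'e) chart \<Rightarrow> ('n \<Rightarrow> 'e) \<Rightarrow> 'e \<Rightarrow> 'n \<Rightarrow> real" where
  "component d \<xi> b q = inner (tcoord AM d (f q) (\<xi> q)) b"

lemma vsmooth_component:
  assumes "along AN AM f W \<xi>" "d \<in> AM" "open W"
  shows "vsmooth AN (W \<inter> f -` fst d) (component d \<xi> b)"
  unfolding component_def using N.vsmooth_inner_const[OF _ along_vsmooth_tcoord[OF assms(1,2)]]
    open_Int[OF assms(3) open_vimage_chart[OF assms(2)]] by auto

lemma along_expansion:
  "d \<in> AM \<Longrightarrow> f q \<in> fst d \<Longrightarrow> \<xi> q = (\<Sum>b\<in>Basis. component d \<xi> b q *\<^sub>R coord_field AM d b (f q))"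
  unfolding component_def by (rule M.coord_field_expansion)

text \<open>Smoothness of the metric is given on pairs of coordinate fields only; expand both
  arguments in them.\<close>

lemma vsmooth_metric:
  assumes g: "semi_riemannian_metric AM g" and W: "open W"
    and \<xi>: "along AN AM f W \<xi>" and \<eta>: "along AN AM f W \<eta>"
  shows "vsmooth AN W (\<lambda>q. g (f q) (\<xi> q) (\<eta> q))"
proof (rule N.vsmooth_local)
  fix p assume p: "p \<in> W"
  define d where "d = chart_at AM (f p)"
  have d: "d \<in> AM" "f p \<in> fst d" using M.chart_at by (auto simp: d_def)
  let ?V = "W \<inter> f -` fst d"
  have V: "open ?V" using W open_vimage_chart[OF d(1)] by auto
  have gc: "vsmooth AN ?V (\<lambda>q. g (f q) (coord_field AM d a (f q)) (coord_field AM d b (f q)))" for a b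
  proof -
    have "vsmooth AM (fst d) (\<lambda>m. g m (coord_field AM d a m) (coord_field AM d b m))"
      using g d(1) unfolding semi_riemannian_metric_def
      by (intro M.vsmoothI_chart[OF d(1) M.open_chart[OF d(1)]]) (auto simp: o_def)
    from vsmooth_comp[OF this M.open_chart[OF d(1)]] show ?thesis
      unfolding o_def by (rule vsmooth_subset) auto
  qed
  have "vsmooth AN ?V (\<lambda>q. \<Sum>a\<in>Basis. component d \<xi> a q *\<^sub>R (\<Sum>b\<in>Basis. component d \<eta> b q *\<^sub>R
      g (f q) (coord_field AM d a (f q)) (coord_field AM d b (f q))))"
    by (intro N.vsmooth_sum[OF V] N.vsmooth_scaleR[OF V] vsmooth_component \<xi> \<eta> d W gc)
  then have "vsmooth AN ?V (\<lambda>q. g (f q) (\<xi> q) (\<eta> q))"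
  proof (rule N.vsmooth_cong[OF V, rotated])
    fix q assume "q \<in> ?V"
    then have fq: "f q \<in> fst d" by auto
    have lin: "linear (\<lambda>u. g (f q) u v)" "linear (g (f q) u)" for u v
      using g unfolding semi_riemannian_metric_def bilinear_def by auto
    show "(\<Sum>a\<in>Basis. component d \<xi> a q *\<^sub>R (\<Sum>b\<in>Basis. component d \<eta> b q *\<^sub>R
      g (f q) (coord_field AM d a (f q)) (coord_field AM d b (f q)))) = g (f q) (\<xi> q) (\<eta> q)"
      by (subst along_expansion[OF d(1) fq, of \<xi>], subst along_expansion[OF d(1) fq, of \<eta>])
        (simp only: linear_sum[OF lin(1)] linear_scale[OF lin(1)], simp only: linear_sum[OF lin(2)] linear_scale[OF lin(2)])
  qed
  then show "\<exists>V. open V \<and> p \<in> V \<and> vsmooth AN V (\<lambda>q. g (f q) (\<xi> q) (\<eta> q))"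
    using V p d(2) by (intro exI[of _ ?V]) auto
qed

end

section \<open>Vector fields on a manifold, as vector fields along the identity\<close>

lemma (in atlas) atlas_map_id: "atlas_map A A (\<lambda>x. x)"
proof
  show "smooth_map A A (\<lambda>x. x)"
    using vsmooth_chart unfolding smooth_map_def vsmooth_def by (auto simp: o_def)
qed

lemma (in atlas) smooth_field_iff_along:
  assumes W: "open W"
  shows "smooth_field A W X \<longleftrightarrow> along A A (\<lambda>x. x) W X"
proof
  assume "smooth_field A W X"
  then show "along A A (\<lambda>x. x) W X"
    unfolding along_def using smooth_field_tcoord[OF _ _ W] by auto
next
  assume *: "along A A (\<lambda>x. x) W X"
  show "smooth_field A W X"
    unfolding smooth_field_def
  proof
    fix c assume c: "c \<in> A"
    have "vsmooth A (W \<inter> fst c) (\<lambda>q. tcoord A c q (X q))"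
      using * c by (auto simp: along_def)
    then have "smooth_on (snd c ` (fst c \<inter> (W \<inter> fst c))) ((\<lambda>q. tcoord A c q (X q)) \<circ> cinv c)"
      using c unfolding vsmooth_def by blast
    then show "smooth_on (snd c ` (fst c \<inter> W)) (\<lambda>x. tcoord A c (cinv c x) (X (cinv c x)))"
      by (simp add: o_def Int_ac)
  qed
qed

context atlas
begin

interpretation self: atlas_map A A "\<lambda>x. x"
  by (rule atlas_map_id)

lemma smooth_field_local:
  assumes "open W" "\<And>p. p \<in> W \<Longrightarrow> \<exists>V. open V \<and> p \<in> V \<and> smooth_field A V X"
  shows "smooth_field A W X"
  unfolding smooth_field_iff_along[OF assms(1)]
proof (rule self.along_local)
  fix p assume "p \<in> W"
  with assms(2) obtain V where "open V" "p \<in> V" "smooth_field A V X" by blast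
  then show "\<exists>V. open V \<and> p \<in> V \<and> along A A (\<lambda>x. x) V X"
    by (intro exI[of _ V]) (simp add: smooth_field_iff_along)
qed

lemma smooth_field_cong:
  "open W \<Longrightarrow> (\<And>q. q \<in> W \<Longrightarrow> X q = Y q) \<Longrightarrow> smooth_field A W X \<Longrightarrow> smooth_field A W Y"
  using self.along_cong[of W X Y] by (simp add: smooth_field_iff_along)

lemma smooth_field_coord_field: "c \<in> A \<Longrightarrow> smooth_field A (fst c) (coord_field A c v)"
  using self.along_coord_field[of c v] smooth_field_iff_along[OF open_chart] by simp

lemma smooth_field_add:
  "open W \<Longrightarrow> smooth_field A W X \<Longrightarrow> smooth_field A W Y \<Longrightarrow> smooth_field A W (\<lambda>q. X q + Y q)"
  using self.along_add[of W X Y] by (simp add: smooth_field_iff_along)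

lemma smooth_field_scaleR:
  "open W \<Longrightarrow> vsmooth A W h \<Longrightarrow> smooth_field A W X \<Longrightarrow> smooth_field A W (\<lambda>q. h q *\<^sub>R X q)"
  using self.along_scaleR[of W h X] by (simp add: smooth_field_iff_along)

lemma smooth_field_zero: "open W \<Longrightarrow> smooth_field A W (\<lambda>q. 0)"
  by (simp add: smooth_field_iff_along self.along_zero)

lemma smooth_field_sum:
  "open W \<Longrightarrow> (\<And>i. i \<in> I \<Longrightarrow> smooth_field A W (X i)) \<Longrightarrow> smooth_field A W (\<lambda>q. \<Sum>i\<in>I. X i q)"
  using self.along_sum[of W I X] by (simp add: smooth_field_iff_along)

lemma smooth_field_bump:
  assumes "open W" "smooth_field A W X" "p \<in> W"
  obtains h where "smooth_field A UNIV (\<lambda>q. h q *\<^sub>R X q)" "h p = 1" "\<And>q. q \<notin> W \<Longrightarrow> h q = 0"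
  using self.along_bump[of W X p] assms by (auto simp: smooth_field_iff_along)

text \<open>\<open>smooth_endo\<close> tests an endomorphism on coordinate fields; a general field
  is a combination of these with smooth coefficients.\<close>

lemma smooth_field_endo:
  assumes s: "smooth_endo A W s" and W: "open W" and Y: "smooth_field A W Y"
  shows "smooth_field A W (\<lambda>q. blinfun_apply (s q) (Y q))"
proof (rule smooth_field_local[OF W])
  fix p assume p: "p \<in> W"
  define c where "c = chart_at A p"
  have c: "c \<in> A" "p \<in> fst c" using chart_at by (auto simp: c_def)
  let ?V = "W \<inter> fst c"
  have V: "open ?V" using W open_chart[OF c(1)] by auto
  have e: "smooth_field A ?V (\<lambda>q. blinfun_apply (s q) (coord_field A c v q))" for v
    unfolding smooth_field_iff_along[OF V]
  proof (rule self.alongI_chart[OF c(1) V])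
    show "vsmooth A ?V (\<lambda>q. tcoord A c q (blinfun_apply (s q) (coord_field A c v q)))"
      by (rule vsmoothI_chart[OF c(1) V]) (use s c in \<open>auto simp: smooth_endo_def o_def Int_commute\<close>)
  qed simp
  have "smooth_field A ?V (\<lambda>q. \<Sum>b\<in>Basis. inner (tcoord A c q (Y q)) b *\<^sub>R
      blinfun_apply (s q) (coord_field A c b q))"
    by (intro smooth_field_sum[OF V] smooth_field_scaleR[OF V] vsmooth_inner_const[OF V]
        smooth_field_tcoord[OF Y c(1) W] e)
  then have "smooth_field A ?V (\<lambda>q. blinfun_apply (s q) (Y q))"
  proof (rule smooth_field_cong[OF V, rotated])
    fix q assume "q \<in> ?V"
    then have q: "q \<in> fst c" by auto
    show "(\<Sum>b\<in>Basis. inner (tcoord A c q (Y q)) b *\<^sub>R blinfun_apply (s q) (coord_field A c b q)) =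
      blinfun_apply (s q) (Y q)"
      using arg_cong[OF coord_field_expansion[OF c(1) q, of "Y q"], of "blinfun_apply (s q)"]
      by (simp only: blinfun.sum_right blinfun.scaleR_right)
  qed
  then show "\<exists>V. open V \<and> p \<in> V \<and> smooth_field A V (\<lambda>q. blinfun_apply (s q) (Y q))"
    using V p c(2) by (intro exI[of _ ?V]) auto
qed

end

lemma (in atlas_map) along_endo:
  assumes s: "smooth_endo AM U s" and U: "open U" and W: "open W" "W \<subseteq> f -` U" and \<xi>: "along AN AM f W \<xi>"
  shows "along AN AM f W (\<lambda>q. blinfun_apply (s (f q)) (\<xi> q))"
proof (rule along_local)
  fix p assume p: "p \<in> W"
  define d where "d = chart_at AM (f p)"
  have d: "d \<in> AM" "f p \<in> fst d" using M.chart_at by (auto simp: d_def)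
  let ?V = "W \<inter> f -` fst d"
  have V: "open ?V" using W open_vimage_chart[OF d(1)] by auto
  have s': "smooth_endo AM (U \<inter> fst d) s"
    by (rule smooth_endo_subset[OF s]) simp
  have oUd: "open (U \<inter> fst d)" using U M.open_chart[OF d(1)] by auto
  have e: "along AN AM f ?V (\<lambda>q. blinfun_apply (s (f q)) (coord_field AM d b (f q)))" for b
    by (rule along_subset[OF along_field_comp[OF M.smooth_field_endo[OF s' oUd
              smooth_field_subset[OF M.smooth_field_coord_field[OF d(1)]]] oUd]]) (use W(2) in auto)
  have "along AN AM f ?V (\<lambda>q. \<Sum>b\<in>Basis. component d \<xi> b q *\<^sub>R
      blinfun_apply (s (f q)) (coord_field AM d b (f q)))"
    by (intro along_sum[OF V] along_scaleR[OF V] vsmooth_component[OF \<xi> d(1) W(1)] e)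
  then have "along AN AM f ?V (\<lambda>q. blinfun_apply (s (f q)) (\<xi> q))"
  proof (rule along_cong[OF V, rotated])
    fix q assume "q \<in> ?V"
    then have q: "f q \<in> fst d" by auto
    show "(\<Sum>b\<in>Basis. component d \<xi> b q *\<^sub>R blinfun_apply (s (f q)) (coord_field AM d b (f q))) =
      blinfun_apply (s (f q)) (\<xi> q)"
      using arg_cong[OF along_expansion[OF d(1) q, of \<xi>], of "blinfun_apply (s (f q))"]
      by (simp only: blinfun.sum_right blinfun.scaleR_right)
  qed
  then show "\<exists>V. open V \<and> p \<in> V \<and> along AN AM f V (\<lambda>q. blinfun_apply (s (f q)) (\<xi> q))"
    using V p d(2) by (intro exI[of _ ?V]) auto
qed

section \<open>Connections and vector fields along a map\<close>

locale connection = atlas A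
  for A :: "('m::{t2_space,second_countable_topology}, 'e::euclidean_space) chart set" +
  fixes nab :: "('m, 'e) connection"
  assumes affine: "affine_connection A nab"
begin

context
  fixes W :: "'m set" assumes W: "open W"
begin

private lemmas affineW = affine[unfolded affine_connection_def, rule_format, OF W]

lemma nab_linear: "smooth_field A W Y \<Longrightarrow> p \<in> W \<Longrightarrow> linear (\<lambda>v. nab p v Y)"
  using affineW[THEN conjunct1] by simp

lemma nab_add:
  "smooth_field A W Y \<Longrightarrow> smooth_field A W Z \<Longrightarrow> p \<in> W \<Longrightarrow>
    nab p v (\<lambda>q. Y q + Z q) = nab p v Y + nab p v Z"
  using affineW[THEN conjunct2, THEN conjunct1] by simp

lemma nab_scaleR:
  "vsmooth A W h \<Longrightarrow> smooth_field A W Y \<Longrightarrow> p \<in> W \<Longrightarrow>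
    nab p v (\<lambda>q. h q *\<^sub>R Y q) = vderiv A p v h *\<^sub>R Y p + h p *\<^sub>R nab p v Y"
  using affineW[THEN conjunct2, THEN conjunct2, THEN conjunct1]
  by (simp add: smooth_fun_iff_vsmooth dir_deriv_eq_vderiv)

lemma smooth_field_nab:
  "smooth_field A W X \<Longrightarrow> smooth_field A W Y \<Longrightarrow> smooth_field A W (\<lambda>q. nab q (X q) Y)"
  using affineW[THEN conjunct2, THEN conjunct2, THEN conjunct2] by simp

text \<open>Locality follows from the Leibniz rule for the indicator function of \<open>W\<close>.\<close>

lemma nab_cong:
  assumes Y: "smooth_field A W Y" and eq: "\<And>q. q \<in> W \<Longrightarrow> Y q = Z q" and p: "p \<in> W"
  shows "nab p v Y = nab p v Z"
proof -
  define h where "h q = (if q \<in> W then 1 else 0 :: real)" for q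
  have h: "vsmooth A W h"
    by (rule vsmooth_cong[OF W _ vsmooth_const[of _ 1]]) (simp add: h_def)
  have h': "vderiv A p v h = 0"
    using vderiv_cong[OF W p, of h "\<lambda>_. 1"] vderiv_const[of p v "1::real"] by (simp add: h_def)
  have Z: "smooth_field A W Z"
    by (rule smooth_field_cong[OF W eq Y])
  have "(\<lambda>q. h q *\<^sub>R Y q) = (\<lambda>q. h q *\<^sub>R Z q)"
    by (auto simp: h_def eq)
  then show ?thesis
    using nab_scaleR[OF h Y p, of v] nab_scaleR[OF h Z p, of v] p by (simp add: h' h_def)
qed

lemma nab_zero: "p \<in> W \<Longrightarrow> nab p v (\<lambda>q. 0) = 0"
  using nab_scaleR[OF vsmooth_const[of _ 0] smooth_field_zero[OF W], of p v] vderiv_const[of p v "0::real"]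
  by simp

lemma nab_sum:
  assumes p: "p \<in> W"
  shows "(\<And>i. i \<in> I \<Longrightarrow> smooth_field A W (Y i)) \<Longrightarrow>
    nab p v (\<lambda>q. \<Sum>i\<in>I. Y i q) = (\<Sum>i\<in>I. nab p v (Y i))"
proof (induction I rule: infinite_finite_induct)
  case (insert x F)
  have 1: "smooth_field A W (Y x)" and 2: "smooth_field A W (\<lambda>q. \<Sum>i\<in>F. Y i q)"
    using insert.prems by (auto intro!: smooth_field_sum[OF W])
  show ?case
    using nab_add[OF 1 2 p, of v] insert by simp
qed (simp_all add: nab_zero[OF p])

end

text \<open>Symmetry of the Christoffel symbols. The torsion-free condition identifies the
  difference with the bracket of two coordinate fields, and this bracket annihilates each coordinate
  function because a coordinate field differentiates it to a constant.\<close>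

lemma nab_coord_fields_commute:
  assumes lc: "levi_civita A g nab" and c: "c \<in> A" and p: "p \<in> fst c"
  shows "nab p (coord_field A c a p) (coord_field A c b) = nab p (coord_field A c b p) (coord_field A c a)"
proof -
  let ?x = "\<lambda>a. coord_field A c a"
  let ?Z = "\<lambda>q. nab q (?x a q) (?x b) - nab q (?x b q) (?x a)"
  note o = open_chart[OF c]
  have br: "is_lie_bracket A (fst c) (?x a) (?x b) ?Z"
    using lc[unfolded levi_civita_def, THEN conjunct2, THEN conjunct1, rule_format, of "fst c" "?x a" "?x b"]
      o smooth_field_coord_field[OF c] by simp
  have "inner (tcoord A c p (?Z p)) i = 0" for i
  proof -
    let ?h = "\<lambda>q. inner (snd c q) i"
    have h: "vsmooth A (fst c) ?h"
      by (rule vsmooth_inner_const[OF o vsmooth_chart[OF c]])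
    have d: "vderiv A q v ?h = inner (tcoord A c q v) i" if "q \<in> fst c" for q v
      using vderiv_bounded_linear[OF o that bounded_linear_inner_left vsmooth_chart[OF c]]
      by (simp add: tcoord_eq_vderiv)
    have "vderiv A p v (\<lambda>q. vderiv A q (?x b q) ?h) = 0" for v b
      using vderiv_cong[OF o p, of "\<lambda>q. vderiv A q (?x b q) ?h" "\<lambda>_. inner b i" v] c
        vderiv_const[of p v "inner b i"]
      by (simp add: d)
    then have "vderiv A p (?Z p) ?h = 0"
      using br[unfolded is_lie_bracket_def, rule_format, of "fst c" ?h p] h o p
      by (simp add: smooth_fun_iff_vsmooth dir_deriv_eq_vderiv)
    then show ?thesis by (simp add: d[OF p])
  qed
  then have "tcoord A c p (?Z p) = 0"
    by (metis inner_eq_zero_iff)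
  then have "?Z p = 0"
    using coord_field_tcoord[OF c p, of "?Z p"] linear_0[OF linear_coord_field[OF c p]] by simp
  then show ?thesis by simp
qed

end

section \<open>The connection induced on the pulled-back tangent bundle\<close>

locale connection_map = atlas_map AN AM f + C: connection AM nab
  for AN :: "('n::{t2_space,second_countable_topology}, 'f::euclidean_space) chart set"
    and AM :: "('m::{t2_space,second_countable_topology}, 'e::euclidean_space) chart set"
    and f nab
begin

abbreviation "conn \<equiv> conn_along AN AM f nab"
abbreviation "df \<equiv> mdiff AN AM f"

lemma conn_along_eq_vderiv:
  "conn p v \<xi> = vderiv AN p v (\<lambda>q. tcoord AM (chart_at AM (f p)) (f q) (\<xi> q)) +
    (\<Sum>b\<in>Basis. inner (\<xi> p) b *\<^sub>R nab (f p) (df p v) (coord_field AM (chart_at AM (f p)) b))"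
  by (simp add: conn_along_def Let_def vderiv_def o_def)

context
  fixes W :: "'n set" and p :: 'n
  assumes W: "open W" and p: "p \<in> W"
begin

private lemma d: "chart_at AM (f p) \<in> AM" "f p \<in> fst (chart_at AM (f p))"
  by (rule M.chart_at)+

private lemma V: "open (W \<inter> f -` fst (chart_at AM (f p)))" "p \<in> W \<inter> f -` fst (chart_at AM (f p))"
  using W p open_vimage_chart[OF d(1)] d(2) by auto

lemma conn_along_cong: "(\<And>q. q \<in> W \<Longrightarrow> \<xi> q = \<eta> q) \<Longrightarrow> conn p v \<xi> = conn p v \<eta>"
  unfolding conn_along_eq_vderiv using p
  by (subst N.vderiv_cong[OF W p, of _ "\<lambda>q. tcoord AM (chart_at AM (f p)) (f q) (\<eta> q)"]) auto

lemma conn_along_add: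
  assumes \<xi>: "along AN AM f W \<xi>" and \<eta>: "along AN AM f W \<eta>"
  shows "conn p v (\<lambda>q. \<xi> q + \<eta> q) = conn p v \<xi> + conn p v \<eta>"
proof -
  let ?t = "\<lambda>q. tcoord AM (chart_at AM (f p)) (f q)"
  have "vderiv AN p v (\<lambda>q. ?t q (\<xi> q + \<eta> q)) = vderiv AN p v (\<lambda>q. ?t q (\<xi> q) + ?t q (\<eta> q))"
    by (rule N.vderiv_cong[OF V]) (use M.linear_tcoord[OF d(1)] in \<open>auto simp: linear_add\<close>)
  also have "\<dots> = vderiv AN p v (\<lambda>q. ?t q (\<xi> q)) + vderiv AN p v (\<lambda>q. ?t q (\<eta> q))"
    by (rule N.vderiv_add[OF V along_vsmooth_tcoord[OF \<xi> d(1)] along_vsmooth_tcoord[OF \<eta> d(1)]])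
  finally show ?thesis
    by (simp add: conn_along_eq_vderiv inner_add_left scaleR_add_left sum.distrib)
qed

lemma conn_along_scaleR:
  assumes h: "vsmooth AN W h" and \<xi>: "along AN AM f W \<xi>"
  shows "conn p v (\<lambda>q. h q *\<^sub>R \<xi> q) = vderiv AN p v h *\<^sub>R \<xi> p + h p *\<^sub>R conn p v \<xi>"
proof -
  let ?t = "\<lambda>q. tcoord AM (chart_at AM (f p)) (f q)"
  have h': "vsmooth AN (W \<inter> f -` fst (chart_at AM (f p))) h"
    by (rule vsmooth_subset[OF h]) auto
  have "vderiv AN p v (\<lambda>q. ?t q (h q *\<^sub>R \<xi> q)) = vderiv AN p v (\<lambda>q. h q *\<^sub>R ?t q (\<xi> q))"
    by (rule N.vderiv_cong[OF V]) (use M.linear_tcoord[OF d(1)] in \<open>auto simp: linear_scale\<close>)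
  also have "\<dots> = h p *\<^sub>R vderiv AN p v (\<lambda>q. ?t q (\<xi> q)) + vderiv AN p v h *\<^sub>R \<xi> p"
    using N.vderiv_bounded_bilinear[OF V bounded_bilinear_scaleR h' along_vsmooth_tcoord[OF \<xi> d(1)]]
    by simp
  finally show ?thesis
    by (simp add: conn_along_eq_vderiv scaleR_add_right scaleR_sum_right)
qed

lemma conn_along_zero: "conn p v (\<lambda>q. 0) = 0"
  using conn_along_scaleR[OF N.vsmooth_const[of _ 0] along_zero, of v] N.vderiv_const[of p v "0::real"] by simp

lemma conn_along_sum:
  "(\<And>i. i \<in> I \<Longrightarrow> along AN AM f W (\<xi> i)) \<Longrightarrow>
    conn p v (\<lambda>q. \<Sum>i\<in>I. \<xi> i q) = (\<Sum>i\<in>I. conn p v (\<xi> i))"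
proof (induction I rule: infinite_finite_induct)
  case (insert x F)
  have 1: "along AN AM f W (\<xi> x)" and 2: "along AN AM f W (\<lambda>q. \<Sum>i\<in>F. \<xi> i q)"
    using insert.prems by (auto intro!: along_sum[OF W])
  show ?case
    using conn_along_add[OF 1 2, of v] insert by simp
qed (simp_all add: conn_along_zero)

end

text \<open>This ties the coordinate definition of \<open>conn_along\<close> to the connection of M.
  Together with the Leibniz rule it determines \<open>conn_along\<close>, so no transformation law
  of Christoffel symbols is ever computed.\<close>

lemma conn_along_field_comp:
  assumes W: "open W" and fp: "f p \<in> W" and Y: "smooth_field AM W Y"
  shows "conn p v (\<lambda>q. Y (f q)) = nab (f p) (df p v) Y"
proof -
  define d where "d = chart_at AM (f p)"
  have d: "d \<in> AM" "f p \<in> fst d" using M.chart_at by (auto simp: d_def)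
  have V: "open (W \<inter> fst d)" "f p \<in> W \<inter> fst d" using W fp d M.open_chart[OF d(1)] by auto
  let ?t = "\<lambda>m. tcoord AM d m (Y m)"
  have t: "vsmooth AM (W \<inter> fst d) ?t"
    by (rule M.smooth_field_tcoord[OF Y d(1) W])
  have t': "vsmooth AM (W \<inter> fst d) (\<lambda>m. inner (?t m) b)" for b
    by (rule M.vsmooth_inner_const[OF V(1) t])
  have cf: "smooth_field AM (W \<inter> fst d) (coord_field AM d b)" for b
    by (rule smooth_field_subset[OF M.smooth_field_coord_field[OF d(1)]]) simp
  have 1: "vderiv AN p v (\<lambda>q. ?t (f q)) = vderiv AM (f p) (df p v) ?t"
    using vderiv_comp[OF t V, of v] by (simp add: o_def)
  have 2: "vderiv AM (f p) w (\<lambda>m. inner (?t m) b) = inner (vderiv AM (f p) w ?t) b" for w b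
    by (rule M.vderiv_bounded_linear[OF V bounded_linear_inner_left t])
  have "nab (f p) (df p v) Y =
      nab (f p) (df p v) (\<lambda>m. \<Sum>b\<in>Basis. inner (?t m) b *\<^sub>R coord_field AM d b m)"
    by (rule C.nab_cong[OF V(1) smooth_field_subset[OF Y] _ V(2)], simp,
        rule M.coord_field_expansion[OF d(1)], simp)
  also have "\<dots> = (\<Sum>b\<in>Basis. nab (f p) (df p v) (\<lambda>m. inner (?t m) b *\<^sub>R coord_field AM d b m))"
    by (rule C.nab_sum[OF V]) (rule M.smooth_field_scaleR[OF V(1) t' cf])
  also have "\<dots> = (\<Sum>b\<in>Basis. inner (vderiv AM (f p) (df p v) ?t) b *\<^sub>R b
      + inner (Y (f p)) b *\<^sub>R nab (f p) (df p v) (coord_field AM d b))"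
    by (rule sum.cong[OF refl])
      (simp add: C.nab_scaleR[OF V(1) t' cf V(2)] 2, simp add: d_def)
  also have "\<dots> = conn p v (\<lambda>q. Y (f q))"
    by (simp add: conn_along_eq_vderiv sum.distrib euclidean_representation 1 flip: d_def)
  finally show ?thesis ..
qed

text \<open>The defining formula uses the preferred chart at \<open>f p\<close>; this version holds
  in every chart around \<open>f p\<close>, so it can be read as a formula for fields when p
  varies.\<close>

lemma conn_along_expansion:
  assumes W: "open W" and p: "p \<in> W" and \<xi>: "along AN AM f W \<xi>" and d: "d \<in> AM" "f p \<in> fst d"
  shows "conn p v \<xi> = (\<Sum>b\<in>Basis. vderiv AN p v (component d \<xi> b) *\<^sub>R coord_field AM d b (f p)
      + component d \<xi> b p *\<^sub>R nab (f p) (df p v) (coord_field AM d b))"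
proof -
  let ?V = "W \<inter> f -` fst d"
  have V: "open ?V" "p \<in> ?V" using W p d open_vimage_chart[OF d(1)] by auto
  have c: "vsmooth AN ?V (component d \<xi> b)" for b
    by (rule vsmooth_component[OF \<xi> d(1) W])
  have e: "along AN AM f ?V (\<lambda>q. coord_field AM d b (f q))" for b
    by (rule along_subset[OF along_coord_field[OF d(1)]]) simp
  have "conn p v \<xi> = conn p v (\<lambda>q. \<Sum>b\<in>Basis. component d \<xi> b q *\<^sub>R coord_field AM d b (f q))"
    by (rule conn_along_cong[OF V], rule along_expansion[OF d(1)]) simp
  also have "\<dots> = (\<Sum>b\<in>Basis. conn p v (\<lambda>q. component d \<xi> b q *\<^sub>R coord_field AM d b (f q)))"
    by (rule conn_along_sum[OF V]) (rule along_scaleR[OF V(1) c e])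
  also have "\<dots> = (\<Sum>b\<in>Basis. vderiv AN p v (component d \<xi> b) *\<^sub>R coord_field AM d b (f p)
      + component d \<xi> b p *\<^sub>R nab (f p) (df p v) (coord_field AM d b))"
    by (rule sum.cong[OF refl])
      (simp add: conn_along_scaleR[OF V c e] conn_along_field_comp[OF M.open_chart[OF d(1)] d(2) M.smooth_field_coord_field[OF d(1)]])
  finally show ?thesis .
qed

text \<open>The direction \<open>df(v)\<close> is not the value of a given vector field of M.
  Splitting it into coordinate directions leaves covariant derivatives of coordinate fields along
  coordinate fields, which are smooth fields on M and can be composed with f.\<close>

lemma nab_mdiff_expansion:
  assumes d: "d \<in> AM" "f p \<in> fst d"
  shows "nab (f p) u (coord_field AM d b) = (\<Sum>a\<in>Basis. inner (tcoord AM d (f p) u) a *\<^sub>R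
      nab (f p) (coord_field AM d a (f p)) (coord_field AM d b))"
proof -
  have lin: "linear (\<lambda>v. nab (f p) v (coord_field AM d b))"
    by (rule C.nab_linear[OF M.open_chart[OF d(1)] M.smooth_field_coord_field[OF d(1)] d(2)])
  show ?thesis
    using arg_cong[OF M.coord_field_expansion[OF d, of u], of "\<lambda>v. nab (f p) v (coord_field AM d b)"]
    by (simp only: linear_sum[OF lin] linear_scale[OF lin])
qed

lemma along_conn_along:
  assumes W: "open W" and \<xi>: "along AN AM f W \<xi>" and X: "smooth_field AN W X"
  shows "along AN AM f W (\<lambda>q. conn q (X q) \<xi>)"
proof (rule along_local)
  fix p assume p: "p \<in> W"
  define d where "d = chart_at AM (f p)"
  have d: "d \<in> AM" "f p \<in> fst d" using M.chart_at by (auto simp: d_def)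
  let ?V = "W \<inter> f -` fst d"
  have V: "open ?V" using W open_vimage_chart[OF d(1)] by auto
  have c: "vsmooth AN ?V (component d \<xi> b)" for b
    by (rule vsmooth_component[OF \<xi> d(1) W])
  have c': "vsmooth AN ?V (\<lambda>q. vderiv AN q (X q) (component d \<xi> b))" for b
    by (rule N.vsmooth_vderiv[OF c V smooth_field_subset[OF X]]) simp
  have x: "vsmooth AN ?V (component d (\<lambda>q. df q (X q)) b)" for b
    by (rule vsmooth_component[OF along_mdiff[OF X W] d(1) W])
  have e: "along AN AM f ?V (\<lambda>q. coord_field AM d b (f q))" for b
    by (rule along_subset[OF along_coord_field[OF d(1)]]) simp
  have G: "along AN AM f ?V (\<lambda>q. nab (f q) (coord_field AM d a (f q)) (coord_field AM d b))" for a b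
    by (rule along_subset[OF along_field_comp[OF C.smooth_field_nab[OF M.open_chart[OF d(1)]
              M.smooth_field_coord_field[OF d(1)] M.smooth_field_coord_field[OF d(1)]]
            M.open_chart[OF d(1)]]]) simp
  have "along AN AM f ?V (\<lambda>q. \<Sum>b\<in>Basis. vderiv AN q (X q) (component d \<xi> b) *\<^sub>R coord_field AM d b (f q)
      + component d \<xi> b q *\<^sub>R (\<Sum>a\<in>Basis. component d (\<lambda>q. df q (X q)) a q *\<^sub>R
          nab (f q) (coord_field AM d a (f q)) (coord_field AM d b)))"
    by (intro along_sum[OF V] along_add[OF V] along_scaleR[OF V] c c' x e G)
  then have "along AN AM f ?V (\<lambda>q. conn q (X q) \<xi>)"
  proof (rule along_cong[OF V, rotated])
    fix q assume "q \<in> ?V"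
    then have q: "q \<in> W" "f q \<in> fst d" by auto
    show "(\<Sum>b\<in>Basis. vderiv AN q (X q) (component d \<xi> b) *\<^sub>R coord_field AM d b (f q)
      + component d \<xi> b q *\<^sub>R (\<Sum>a\<in>Basis. component d (\<lambda>q. df q (X q)) a q *\<^sub>R
          nab (f q) (coord_field AM d a (f q)) (coord_field AM d b))) = conn q (X q) \<xi>"
      unfolding conn_along_expansion[OF W q(1) \<xi> d(1) q(2)] nab_mdiff_expansion[OF d(1) q(2), of "df q (X q)"]
      by (simp add: component_def)
  qed
  then show "\<exists>V. open V \<and> p \<in> V \<and> along AN AM f V (\<lambda>q. conn q (X q) \<xi>)"
    using V p d(2) by (intro exI[of _ ?V]) auto
qed

text \<open>For two coordinate fields composed with f this is the metric condition on M after the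
  chain rule. The Leibniz rule then allows an arbitrary field in the first slot, and symmetry of the
  metric carries this over to the second.\<close>

lemma conn_along_metric:
  assumes g: "semi_riemannian_metric AM g" and lc: "levi_civita AM g nab"
    and W: "open W" and p: "p \<in> W" and \<xi>: "along AN AM f W \<xi>" and \<eta>: "along AN AM f W \<eta>"
  shows "vderiv AN p v (\<lambda>q. g (f q) (\<xi> q) (\<eta> q)) =
    g (f p) (conn p v \<xi>) (\<eta> p) + g (f p) (\<xi> p) (conn p v \<eta>)"
proof -
  define d where "d = chart_at AM (f p)"
  have d: "d \<in> AM" "f p \<in> fst d" using M.chart_at by (auto simp: d_def)
  note od = M.open_chart[OF d(1)] and cf = M.smooth_field_coord_field[OF d(1)]
  let ?V = "W \<inter> f -` fst d" and ?x = "\<lambda>b q. coord_field AM d b (f q)"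
  have V: "open ?V" "p \<in> ?V" using W p d open_vimage_chart[OF d(1)] by auto
  have lin: "linear (\<lambda>u. g m u v)" "linear (g m u)" for m u v
    using g unfolding semi_riemannian_metric_def bilinear_def by auto
  have sym: "g m u v = g m v u" for m u v
    using g unfolding semi_riemannian_metric_def by blast
  note lin_simps = linear_add[OF lin(1)] linear_add[OF lin(2)] linear_sum[OF lin(1)]
    linear_sum[OF lin(2)] linear_scale[OF lin(1)] linear_scale[OF lin(2)]
  have e: "along AN AM f ?V (?x b)" for b
    by (rule along_subset[OF along_coord_field[OF d(1)]]) simp
  let ?P = "\<lambda>\<xi> \<eta>. vderiv AN p v (\<lambda>q. g (f q) (\<xi> q) (\<eta> q)) =
    g (f p) (conn p v \<xi>) (\<eta> p) + g (f p) (\<xi> p) (conn p v \<eta>)"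
  have step: "?P \<xi> \<eta>" if \<xi>: "along AN AM f ?V \<xi>" and \<eta>: "along AN AM f ?V \<eta>"
    and P: "\<And>b. ?P (?x b) \<eta>" for \<xi> \<eta>
  proof -
    have c: "vsmooth AN ?V (component d \<xi> b)" for b
      by (rule vsmooth_subset[OF vsmooth_component[OF \<xi> d(1) V(1)]]) auto
    have m: "vsmooth AN ?V (\<lambda>q. g (f q) (?x b q) (\<eta> q))" for b
      by (rule vsmooth_metric[OF g V(1) e \<eta>])
    have "vderiv AN p v (\<lambda>q. g (f q) (\<xi> q) (\<eta> q)) =
        vderiv AN p v (\<lambda>q. \<Sum>b\<in>Basis. component d \<xi> b q * g (f q) (?x b q) (\<eta> q))"
    proof (rule N.vderiv_cong[OF V])
      fix q assume "q \<in> ?V"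
      then have q: "f q \<in> fst d" by auto
      show "g (f q) (\<xi> q) (\<eta> q) = (\<Sum>b\<in>Basis. component d \<xi> b q * g (f q) (?x b q) (\<eta> q))"
        using arg_cong[OF along_expansion[OF d(1) q, of \<xi>], of "\<lambda>u. g (f q) u (\<eta> q)"]
        by (simp only: linear_sum[OF lin(1)] linear_scale[OF lin(1)] real_scaleR_def)
    qed
    also have "\<dots> = (\<Sum>b\<in>Basis. vderiv AN p v (\<lambda>q. component d \<xi> b q * g (f q) (?x b q) (\<eta> q)))"
      by (rule N.vderiv_sum[OF V]) (rule N.vsmooth_mult[OF V(1) c m])
    also have "\<dots> = (\<Sum>b\<in>Basis. component d \<xi> b p *
        (g (f p) (conn p v (?x b)) (\<eta> p) + g (f p) (?x b p) (conn p v \<eta>))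
        + vderiv AN p v (component d \<xi> b) * g (f p) (?x b p) (\<eta> p))"
      by (rule sum.cong[OF refl])
        (simp only: N.vderiv_bounded_bilinear[OF V bounded_bilinear_mult c m] P)
    also have "\<dots> = g (f p) (conn p v \<xi>) (\<eta> p)
        + g (f p) (\<Sum>b\<in>Basis. component d \<xi> b p *\<^sub>R ?x b p) (conn p v \<eta>)"
      unfolding conn_along_expansion[OF V \<xi> d] conn_along_field_comp[OF od d(2) cf]
      by (simp add: lin_simps sum.distrib algebra_simps)
    finally show ?thesis
      using along_expansion[OF d, of \<xi>] by simp
  qed
  have xx: "?P (?x a) (?x b)" for a b
  proof -
    have h: "vsmooth AM (fst d) (\<lambda>m. g m (coord_field AM d a m) (coord_field AM d b m))"
      using g d(1) unfolding semi_riemannian_metric_def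
      by (intro M.vsmoothI_chart[OF d(1) M.open_chart[OF d(1)]]) (auto simp: o_def)
    have "vderiv AN p v (\<lambda>q. g (f q) (?x a q) (?x b q)) =
        vderiv AM (f p) (df p v) (\<lambda>m. g m (coord_field AM d a m) (coord_field AM d b m))"
      using vderiv_comp[OF h od d(2), of v] by (simp add: o_def)
    also have "\<dots> = g (f p) (nab (f p) (df p v) (coord_field AM d a)) (?x b p)
        + g (f p) (?x a p) (nab (f p) (df p v) (coord_field AM d b))"
      using lc[unfolded levi_civita_def, THEN conjunct2, THEN conjunct2, rule_format,
          of "fst d" "coord_field AM d a" "coord_field AM d b" "f p" "df p v"] od cf d(2)
      by (simp add: dir_deriv_eq_vderiv)
    finally show ?thesis
      by (simp add: conn_along_field_comp[OF od d(2) cf])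
  qed
  \<comment> \<open>\<open>step\<close> enlarges the first slot only; exchanging the arguments here
    prepares its second use, with \<eta> already general.\<close>
  have x\<xi>: "?P (?x b) \<zeta>" if "along AN AM f ?V \<zeta>" for b \<zeta>
    using step[OF that e xx] by (simp add: sym[of _ "\<zeta> _"] sym[of _ "conn p v \<zeta>"] add.commute)
  have \<xi>': "along AN AM f ?V \<xi>" and \<eta>': "along AN AM f ?V \<eta>"
    by (rule along_subset[OF \<xi>], simp) (rule along_subset[OF \<eta>], simp)
  show ?thesis
    by (rule step[OF \<xi>' \<eta>' x\<xi>[OF \<eta>']])
qed

text \<open>In a chart of M the Christoffel terms cancel by symmetry. What remains are the iterated
  derivatives of the coordinates of f along X and Y, and the bracket condition on Z, tested on these
  functions, turns them into the components of \<open>df(Z)\<close>.\<close>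

lemma conn_along_torsion_free:
  assumes lc: "levi_civita AM g nab"
    and br: "is_lie_bracket AN W X Y Z"
    and W: "open W" and p: "p \<in> W" and X: "smooth_field AN W X" and Y: "smooth_field AN W Y"
  shows "conn p (X p) (\<lambda>q. df q (Y q)) - conn p (Y p) (\<lambda>q. df q (X q)) = df p (Z p)"
proof -
  define d where "d = chart_at AM (f p)"
  have d: "d \<in> AM" "f p \<in> fst d" using M.chart_at by (auto simp: d_def)
  let ?V = "W \<inter> f -` fst d"
  have V: "open ?V" "p \<in> ?V" using W p d open_vimage_chart[OF d(1)] by auto
  let ?h = "\<lambda>b q. inner ((snd d \<circ> f) q) b"
  have ch: "vsmooth AN ?V (snd d \<circ> f)"
    by (rule vsmooth_subset[OF vsmooth_chart_comp[OF d(1)]]) simp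
  have h: "vsmooth AN ?V (?h b)" for b
    by (rule N.vsmooth_inner_const[OF V(1) ch])
  have dh: "inner (tcoord AM d (f q) (df q v)) b = vderiv AN q v (?h b)" if "q \<in> ?V" for q v b
    using N.vderiv_bounded_linear[OF V(1) that bounded_linear_inner_left ch, of v b] tcoord_mdiff[OF d(1), of q v] that
    by simp
  let ?X = "\<lambda>q. df q (X q)" and ?Y = "\<lambda>q. df q (Y q)"
  have dd: "vderiv AN p v (component d (\<lambda>q. df q (U q)) b) = vderiv AN p v (\<lambda>q. vderiv AN q (U q) (?h b))" for v U b
    by (rule N.vderiv_cong[OF V]) (simp add: component_def dh)
  have 1: "vderiv AN p (X p) (component d ?Y b) - vderiv AN p (Y p) (component d ?X b) = inner (tcoord AM d (f p) (df p (Z p))) b" for b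
    using br[unfolded is_lie_bracket_def, rule_format, of ?V "?h b" p] V h[of b]
    unfolding dd dh[OF V(2)] by (simp add: smooth_fun_iff_vsmooth dir_deriv_eq_vderiv)
  let ?G = "\<lambda>a b. nab (f p) (coord_field AM d a (f p)) (coord_field AM d b)"
  have "(\<Sum>b\<in>Basis. component d ?Y b p *\<^sub>R (\<Sum>a\<in>Basis. component d ?X a p *\<^sub>R ?G a b)) =
      (\<Sum>b\<in>Basis. \<Sum>a\<in>Basis. (component d ?X b p * component d ?Y a p) *\<^sub>R ?G b a)"
    by (subst sum.swap) (simp add: scaleR_sum_right mult.commute)
  also have "\<dots> = (\<Sum>b\<in>Basis. component d ?X b p *\<^sub>R (\<Sum>a\<in>Basis. component d ?Y a p *\<^sub>R ?G a b))"
    by (simp add: scaleR_sum_right C.nab_coord_fields_commute[OF lc d, of _ "_"])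
  finally have 2: "(\<Sum>b\<in>Basis. component d ?Y b p *\<^sub>R nab (f p) (df p (X p)) (coord_field AM d b)) =
      (\<Sum>b\<in>Basis. component d ?X b p *\<^sub>R nab (f p) (df p (Y p)) (coord_field AM d b))"
    unfolding nab_mdiff_expansion[OF d, of "df p (X p)"] nab_mdiff_expansion[OF d, of "df p (Y p)"]
    by (simp add: component_def)
  have "conn p (X p) ?Y - conn p (Y p) ?X =
      (\<Sum>b\<in>Basis. (vderiv AN p (X p) (component d ?Y b) - vderiv AN p (Y p) (component d ?X b)) *\<^sub>R coord_field AM d b (f p))"
    unfolding conn_along_expansion[OF W p along_mdiff[OF Y W] d] conn_along_expansion[OF W p along_mdiff[OF X W] d]
    by (simp add: sum.distrib 2 sum_subtractf scaleR_diff_left)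
  also have "\<dots> = df p (Z p)"
    unfolding 1 using M.coord_field_expansion[OF d, of "df p (Z p)"] by simp
  finally show ?thesis .
qed

text \<open>t is the covariant derivative of s in the direction \<open>df(v)\<close>. It is an
  endomorphism at the single point \<open>f p\<close>, so it makes sense on \<xi> although \<xi>
  does not come from a field on M.\<close>

lemma conn_along_parallel_endo:
  assumes par: "parallel_subbundle AM nab \<sigma>"
    and U: "open U" and s: "smooth_endo AM U s" and s\<sigma>: "\<And>m. m \<in> U \<Longrightarrow> s m \<in> \<sigma> m"
    and W: "open W" "W \<subseteq> f -` U" and p: "p \<in> W" and \<xi>: "along AN AM f W \<xi>"
  shows "\<exists>t\<in>\<sigma> (f p). conn p v (\<lambda>q. blinfun_apply (s (f q)) (\<xi> q)) =
    blinfun_apply (s (f p)) (conn p v \<xi>) + blinfun_apply t (\<xi> p)"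
proof -
  define d where "d = chart_at AM (f p)"
  have d: "d \<in> AM" "f p \<in> fst d" using M.chart_at by (auto simp: d_def)
  let ?V = "W \<inter> f -` fst d" and ?U = "U \<inter> fst d" and ?x = "coord_field AM d"
  have V: "open ?V" "p \<in> ?V" using W p d open_vimage_chart[OF d(1)] by auto
  have U': "open ?U" "f p \<in> ?U" using U M.open_chart[OF d(1)] p W(2) d(2) by auto
  have sU: "smooth_endo AM ?U s"
    by (rule smooth_endo_subset[OF s]) simp
  have xU: "smooth_field AM ?U (?x b)" for b
    by (rule smooth_field_subset[OF M.smooth_field_coord_field[OF d(1)]]) simp
  \<comment> \<open>Parallelism characterises t by fields smooth on the whole given open set, and
    coordinate fields are known to be smooth only on the chart; hence the smaller set.\<close>
  have "open ?U \<and> smooth_endo AM ?U s \<and> (\<forall>q\<in>?U. s q \<in> \<sigma> q) \<and> f p \<in> ?U"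
    using U' sU s\<sigma> by simp
  from par[unfolded parallel_subbundle_def, rule_format, OF this, of "df p v"]
  obtain t where t: "t \<in> \<sigma> (f p)"
    "\<forall>Y. smooth_field AM ?U Y \<longrightarrow>
      blinfun_apply t (Y (f p)) = nab (f p) (df p v) (\<lambda>q. s q (Y q)) - s (f p) (nab (f p) (df p v) Y)"
    by (elim bexE)
  have sx: "smooth_field AM ?U (\<lambda>m. blinfun_apply (s m) (?x b m))" for b
    by (rule M.smooth_field_endo[OF sU U'(1) xU])
  have c: "vsmooth AN ?V (component d \<xi> b)" for b
    by (rule vsmooth_component[OF \<xi> d(1) W(1)])
  have e: "along AN AM f ?V (\<lambda>q. blinfun_apply (s (f q)) (?x b (f q)))" for b
    by (rule along_subset[OF along_field_comp[OF sx U'(1)]]) (use W(2) in auto)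
  have "conn p v (\<lambda>q. blinfun_apply (s (f q)) (\<xi> q)) =
      conn p v (\<lambda>q. \<Sum>b\<in>Basis. component d \<xi> b q *\<^sub>R blinfun_apply (s (f q)) (?x b (f q)))"
  proof (rule conn_along_cong[OF V])
    fix q assume "q \<in> ?V"
    then have q: "f q \<in> fst d" by auto
    show "blinfun_apply (s (f q)) (\<xi> q) = (\<Sum>b\<in>Basis. component d \<xi> b q *\<^sub>R blinfun_apply (s (f q)) (?x b (f q)))"
      using arg_cong[OF along_expansion[OF d(1) q, of \<xi>], of "blinfun_apply (s (f q))"]
      by (simp only: blinfun.sum_right blinfun.scaleR_right)
  qed
  also have "\<dots> = (\<Sum>b\<in>Basis. conn p v (\<lambda>q. component d \<xi> b q *\<^sub>R blinfun_apply (s (f q)) (?x b (f q))))"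
    by (rule conn_along_sum[OF V]) (rule along_scaleR[OF V(1) c e])
  also have "\<dots> = (\<Sum>b\<in>Basis. vderiv AN p v (component d \<xi> b) *\<^sub>R blinfun_apply (s (f p)) (?x b (f p))
      + component d \<xi> b p *\<^sub>R (blinfun_apply t (?x b (f p)) + blinfun_apply (s (f p)) (nab (f p) (df p v) (?x b))))"
    by (rule sum.cong[OF refl]) (simp add: conn_along_scaleR[OF V c e] conn_along_field_comp[OF U' sx] t(2)[rule_format, OF xU])
  also have "\<dots> = blinfun_apply (s (f p)) (conn p v \<xi>) +
      blinfun_apply t (\<Sum>b\<in>Basis. component d \<xi> b p *\<^sub>R ?x b (f p))"
    unfolding conn_along_expansion[OF W(1) p \<xi> d]
    by (simp add: blinfun.sum_right blinfun.scaleR_right blinfun.add_right sum.distrib algebra_simps)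
  finally show ?thesis
    using t(1) along_expansion[OF d, of \<xi>] by auto
qed

end

section \<open>Projections and extensions\<close>

text \<open>\<open>distribution\<close> records a frame as an injective family with independent
  image set; here that is converted into a statement about coefficients indexed by numbers.\<close>

lemma independent_family_sum_zero:
  fixes X :: "nat \<Rightarrow> 'a::real_vector"
  assumes "inj_on X {..<k}" "independent (X ` {..<k})" "(\<Sum>i<k. c i *\<^sub>R X i) = 0"
  shows "\<forall>i<k. c i = 0"
proof (intro allI impI)
  fix i assume i: "i < k"
  have "(\<Sum>v\<in>X ` {..<k}. c (the_inv_into {..<k} X v) *\<^sub>R v) = (\<Sum>i<k. c i *\<^sub>R X i)"
    by (simp add: sum.reindex[OF assms(1)] the_inv_into_f_f[OF assms(1)])
  then have "c (the_inv_into {..<k} X (X i)) = 0"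
    using independentD[OF assms(2), of "X ` {..<k}" "\<lambda>v. c (the_inv_into {..<k} X v)" "X i"] assms(3) i
    by auto
  then show "c i = 0"
    using i by (simp add: the_inv_into_f_f[OF assms(1)])
qed

context atlas
begin

text \<open>Lets \<open>represent_functional\<close> be applied to the whole tangent bundle, which
  is how the shape operator is obtained.\<close>

lemma distribution_UNIV: "distribution A (\<lambda>_. UNIV)"
  unfolding distribution_def
proof (intro exI[of _ "DIM('e)"] allI)
  fix p
  define c where "c = chart_at A p"
  have c: "c \<in> A" "p \<in> fst c" using chart_at by (auto simp: c_def)
  obtain e :: "nat \<Rightarrow> 'e" where e: "bij_betw e {..<DIM('e)} Basis"
    using ex_bij_betw_nat_finite[OF finite_Basis] by (auto simp: atLeast0LessThan)
  have "inj_on (\<lambda>i. coord_field A c (e i) q) {..<DIM('e)} \<and>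
      independent ((\<lambda>i. coord_field A c (e i) q) ` {..<DIM('e)}) \<and>
      span ((\<lambda>i. coord_field A c (e i) q) ` {..<DIM('e)}) = UNIV" if q: "q \<in> fst c" for q
  proof (intro conjI)
    let ?L = "\<lambda>v. coord_field A c v q"
    have lin: "linear ?L" by (rule linear_coord_field[OF c(1) q])
    have inj: "inj ?L" by (rule inj_on_inverseI[of _ "tcoord A c q"]) (simp add: c(1) q)
    have surj: "surj ?L" by (rule surjI[of _ "tcoord A c q"]) (simp add: c(1) q)
    have im: "(\<lambda>i. ?L (e i)) ` {..<DIM('e)} = ?L ` Basis"
      using e image_image[of ?L e "{..<DIM('e)}"] by (simp add: bij_betw_def)
    show "inj_on (\<lambda>i. ?L (e i)) {..<DIM('e)}"
      using e inj by (auto simp: bij_betw_def inj_on_def)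
    show "independent ((\<lambda>i. ?L (e i)) ` {..<DIM('e)})"
      unfolding im by (rule linear_independent_injective_image[OF lin independent_Basis inj_on_subset[OF inj subset_UNIV]])
    show "span ((\<lambda>i. ?L (e i)) ` {..<DIM('e)}) = UNIV"
      unfolding im using linear_span_image[OF lin, of Basis] surj by simp
  qed
  then show "\<exists>U. open U \<and> p \<in> U \<and> (\<exists>X. (\<forall>i<DIM('e). smooth_field A U (X i)) \<and>
      (\<forall>q\<in>U. inj_on (\<lambda>i. X i q) {..<DIM('e)} \<and> independent ((\<lambda>i. X i q) ` {..<DIM('e)}) \<and>
        span ((\<lambda>i. X i q) ` {..<DIM('e)}) = UNIV))"
    using open_chart[OF c(1)] c(2) smooth_field_coord_field[OF c(1)]
    by (intro exI[of _ "fst c"] conjI exI[of _ "\<lambda>i. coord_field A c (e i)"]) auto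
qed

lemma represent_functional:
  assumes E: "distribution A E"
    and nondeg: "\<And>q u. u \<in> E q \<Longrightarrow> (\<forall>v\<in>E q. h q u v = 0) \<Longrightarrow> u = 0"
    and h: "\<And>q. bilinear (h q)"
    and smooth_h: "\<And>V X Y. open V \<Longrightarrow> smooth_field A V X \<Longrightarrow> smooth_field A V Y \<Longrightarrow>
      vsmooth A V (\<lambda>q. h q (X q) (Y q))"
    and W: "open W" and p: "p \<in> W"
    and L: "\<And>q. q \<in> W \<Longrightarrow> linear (L q)"
    and smooth_L: "\<And>V X. open V \<Longrightarrow> V \<subseteq> W \<Longrightarrow> smooth_field A V X \<Longrightarrow> vsmooth A V (\<lambda>q. L q (X q))"
  obtains V P where "open V" "p \<in> V" "V \<subseteq> W" "smooth_field A V P"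
    "\<And>q. q \<in> V \<Longrightarrow> P q \<in> E q" "\<And>q v. q \<in> V \<Longrightarrow> v \<in> E q \<Longrightarrow> h q (P q) v = (L q v :: real)"
proof -
  obtain k where "\<forall>p. \<exists>U. open U \<and> p \<in> U \<and> (\<exists>X :: nat \<Rightarrow> 'm \<Rightarrow> 'e. (\<forall>i<k. smooth_field A U (X i)) \<and>
      (\<forall>q\<in>U. inj_on (\<lambda>i. X i q) {..<k} \<and> independent ((\<lambda>i. X i q) ` {..<k}) \<and>
        span ((\<lambda>i. X i q) ` {..<k}) = E q))"
    using E unfolding distribution_def by (elim exE)
  then obtain U and X :: "nat \<Rightarrow> 'm \<Rightarrow> 'e"
    where U: "open U" "p \<in> U" and X: "\<forall>i<k. smooth_field A U (X i)"
      and fr: "\<forall>q\<in>U. inj_on (\<lambda>i. X i q) {..<k} \<and> independent ((\<lambda>i. X i q) ` {..<k}) \<and>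
        span ((\<lambda>i. X i q) ` {..<k}) = E q"
    by (elim allE[of _ p] exE conjE)
  define V where "V = U \<inter> W"
  have V: "open V" "p \<in> V" "V \<subseteq> W" "V \<subseteq> U" using U W p by (auto simp: V_def)
  have XV: "smooth_field A V (X i)" if "i < k" for i
    by (rule smooth_field_subset[OF _ V(4)]) (use X that in simp)
  have lin: "linear (\<lambda>u. h q u v)" "linear (h q u)" for q u v
    using h[of q] by (auto simp: bilinear_def)
  have span: "u \<in> E q" if "q \<in> V" "u \<in> span ((\<lambda>i. X i q) ` {..<k})" for q u
    using fr that V(4) by auto
  have XE: "X i q \<in> E q" if "q \<in> V" "i < k" for q i
    by (rule span[OF that(1)], rule span_base) (use that in auto)
  have agree: "F v = G v" if "linear F" "linear G" "q \<in> V" "v \<in> E q" "\<And>i. i < k \<Longrightarrow> F (X i q) = G (X i q)"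
    for F G :: "'e \<Rightarrow> real" and q v
    by (rule linear_eq_on_span[OF that(1,2), of "(\<lambda>i. X i q) ` {..<k}"]) (use that fr V(4) in auto)
  obtain c where c: "\<And>j. j < k \<Longrightarrow> vsmooth A V (c j)"
    and sol: "\<And>q i. q \<in> V \<Longrightarrow> i < k \<Longrightarrow> (\<Sum>j<k. h q (X j q) (X i q) * c j q) = L q (X i q)"
  proof (rule linear_system_in_function_algebra[of "vsmooth A V" V k "\<lambda>i j q. h q (X j q) (X i q)"
        "\<lambda>i q. L q (X i q)"])
    \<comment> \<open>A kernel vector of the Gram matrix is the coefficient vector of an element of
      E orthogonal to the frame, hence to E.\<close>
    fix q d assume q: "q \<in> V" and 0: "\<forall>i<k. (\<Sum>j<k. h q (X j q) (X i q) * d j) = 0"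
    let ?u = "\<Sum>j<k. d j *\<^sub>R X j q"
    have "?u \<in> E q"
      by (rule span[OF q], intro span_sum span_scale span_base) auto
    moreover have "h q ?u v = 0" if v: "v \<in> E q" for v
      by (rule agree[OF lin(2) linear_zero q v])
        (use 0 in \<open>simp add: linear_sum[OF lin(1)] linear_scale[OF lin(1)] mult.commute\<close>)
    ultimately have "?u = 0" using nondeg by blast
    then show "\<forall>j<k. d j = 0"
      by (intro independent_family_sum_zero) (use fr q V(4) in auto)
  next
    show "vsmooth A V (\<lambda>q. h q (X j q) (X i q))" if "i < k" "j < k" for i j
      by (rule smooth_h[OF V(1) XV[OF that(2)] XV[OF that(1)]])
    show "vsmooth A V (\<lambda>q. L q (X i q))" if "i < k" for i
      by (rule smooth_L[OF V(1,3) XV[OF that]])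
  qed (assumption | rule vsmooth_const vsmooth_add[OF V(1)] vsmooth_mult[OF V(1)] vsmooth_inverse[OF V(1)] that)+
  define P where "P q = (\<Sum>j<k. c j q *\<^sub>R X j q)" for q
  show thesis
  proof (rule that[OF V(1-3)])
    show "smooth_field A V P"
      unfolding P_def by (rule smooth_field_sum[OF V(1)]) (auto intro: smooth_field_scaleR[OF V(1)] c XV)
    show "P q \<in> E q" if q: "q \<in> V" for q
      unfolding P_def by (rule span[OF q], intro span_sum span_scale span_base) auto
    show "h q (P q) v = L q v" if q: "q \<in> V" and v: "v \<in> E q" for q v
      by (rule agree[OF lin(2) L _ v])
        (use q V(3) sol[OF q] in \<open>auto simp: P_def linear_sum[OF lin(1)] linear_scale[OF lin(1)] mult.commute\<close>)
  qed
qed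

text \<open>A bump function cuts the local section off; where it vanishes the value 0 still lies in
  E q.\<close>

lemma extend_to_section:
  assumes "open W" "p \<in> W" "smooth_field A W X" "\<And>q. q \<in> W \<Longrightarrow> X q \<in> E q" "\<And>q. subspace (E q)"
  obtains Y where "Y \<in> sections A E" "Y p = X p"
proof -
  obtain h where h: "smooth_field A UNIV (\<lambda>q. h q *\<^sub>R X q)" "h p = 1" "\<And>q. q \<notin> W \<Longrightarrow> h q = 0"
    by (rule smooth_field_bump[OF assms(1,3,2)]) blast
  have "h q *\<^sub>R X q \<in> E q" for q
    using assms(4,5) h(3)[of q] by (cases "q \<in> W") (auto intro: subspace_scale simp: subspace_0)
  then show thesis
    by (intro that[of "\<lambda>q. h q *\<^sub>R X q"]) (use h in \<open>auto simp: sections_def\<close>)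
qed

end

section \<open>Paraquaternionic CR-submanifolds\<close>

locale CR_submanifold =
  fixes AM :: "('m::{t2_space,second_countable_topology}, 'e::euclidean_space) chart set"
    and AN :: "('n::{t2_space,second_countable_topology}, 'f::euclidean_space) chart set"
    and \<sigma> :: "'m \<Rightarrow> ('e \<Rightarrow>\<^sub>L 'e) set"
    and g :: "'m \<Rightarrow> 'e \<Rightarrow> 'e \<Rightarrow> real"
    and nabM :: "('m, 'e) connection"
    and nabN :: "('n, 'f) connection"
    and f :: "'n \<Rightarrow> 'm"
    and D :: "'n \<Rightarrow> 'f set"
  assumes kaehler: "paraquaternionic_kaehler AM \<sigma> g nabM"
    and CR: "paraquaternionic_CR_submanifold AN AM f \<sigma> g D"
    and lcN: "levi_civita AN (induced_metric AN AM f g) nabN"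
begin

lemma lcM: "levi_civita AM g nabM"
  and herm: "almost_paraquaternionic_hermitian AM \<sigma> g"
  and par: "parallel_subbundle AM nabM \<sigma>"
  and atlasM: "smooth_atlas AM"
  using kaehler by (simp_all add: paraquaternionic_kaehler_def)

lemma g: "semi_riemannian_metric AM g"
  and apq: "almost_paraquaternionic AM \<sigma>"
  using herm by (simp_all add: almost_paraquaternionic_hermitian_def)

lemma nondegenerate: "nondegenerate_submanifold AN AM f g"
  and distr: "distribution AN D"
  using CR by (simp_all add: paraquaternionic_CR_submanifold_def)

sublocale connection_map AN AM f nabM
proof
  show "smooth_atlas AN" "smooth_map AN AM f"
    using nondegenerate by (simp_all add: nondegenerate_submanifold_def)
  show "affine_connection AM nabM"
    using lcM by (simp add: levi_civita_def)
qed (rule atlasM)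

sublocale CN: connection AN nabN
  by unfold_locales (use lcN in \<open>simp add: levi_civita_def\<close>)

abbreviation "h \<equiv> induced_metric AN AM f g"
abbreviation "Dp \<equiv> orth_distr h D"
abbreviation "normal \<equiv> normal_space AN AM f g"
abbreviation "nup \<equiv> nu_perp AN AM f \<sigma> g D"
abbreviation "B \<equiv> second_fundamental_form AN AM f nabM nabN"
abbreviation "Sh \<equiv> shape_operator AN AM f g nabM"

lemma g_linear: "linear (\<lambda>u. g m u v)" "linear (g m u)"
  using g unfolding semi_riemannian_metric_def bilinear_def by auto

lemma g_sym: "g m u v = g m v u"
  using g unfolding semi_riemannian_metric_def by blast

lemmas g_simps = linear_add[OF g_linear(1)] linear_add[OF g_linear(2)]
  linear_diff[OF g_linear(1)] linear_diff[OF g_linear(2)]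
  linear_neg[OF g_linear(1)] linear_neg[OF g_linear(2)]
  linear_scale[OF g_linear(1)] linear_scale[OF g_linear(2)]
  linear_sum[OF g_linear(1)] linear_sum[OF g_linear(2)]
  linear_0[OF g_linear(1)] linear_0[OF g_linear(2)]

lemmas df_simps = linear_add[OF linear_mdiff] linear_diff[OF linear_mdiff] linear_neg[OF linear_mdiff]
  linear_scale[OF linear_mdiff] linear_0[OF linear_mdiff]

lemma h_def: "h p u v = g (f p) (df p u) (df p v)"
  by (simp add: induced_metric_def)

lemma h_sym: "h p u v = h p v u"
  by (simp add: h_def g_sym)

lemma h_bilinear: "bilinear (h p)"
proof -
  have "linear (\<lambda>v. g (f p) (df p u) (df p v))" "linear (\<lambda>v. g (f p) (df p v) (df p u))" for u
    using linear_compose[OF linear_mdiff g_linear(2)] linear_compose[OF linear_mdiff g_linear(1)]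
    by (simp_all add: o_def)
  moreover have "h p = (\<lambda>u v. g (f p) (df p u) (df p v))"
    by (intro ext) (rule h_def)
  ultimately show ?thesis
    unfolding bilinear_def by simp
qed

lemma h_simps: "h p (u + v) w = h p u w + h p v w" "h p (u - v) w = h p u w - h p v w"
  "h p (a *\<^sub>R u) w = a * h p u w" "h p 0 w = 0"
  by (simp_all add: h_def g_simps df_simps)

lemma h_nondegenerate:
  assumes "\<And>v. h p u v = 0"
  shows "u = 0"
  using nondegenerate assms unfolding nondegenerate_submanifold_def by blast

lemma h_nondegenerate_D: "u \<in> D p \<Longrightarrow> (\<forall>v\<in>D p. h p u v = 0) \<Longrightarrow> u = 0"
  using CR by (simp add: paraquaternionic_CR_submanifold_def)

lemma smooth_h:
  "open V \<Longrightarrow> smooth_field AN V X \<Longrightarrow> smooth_field AN V Y \<Longrightarrow> vsmooth AN V (\<lambda>q. h q (X q) (Y q))"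
  unfolding h_def by (intro vsmooth_metric[OF g] along_mdiff)

lemma coord_extension:
  obtains c where "c \<in> AN" "p \<in> fst c" "open (fst c)" "smooth_field AN (fst c) (coord_field AN c u)"
    "coord_field AN c u p = u"
  using that[of "chart_at AN p"] N.chart_at N.open_chart[OF N.chart_at(1)]
    N.smooth_field_coord_field[OF N.chart_at(1)] by simp

lemma subspace_D: "subspace (D p)"
proof -
  have "\<exists>S. span S = D p"
    using distr unfolding distribution_def by blast
  then show ?thesis by (metis subspace_span)
qed

lemma subspace_Dp: "subspace (Dp p)"
  unfolding orth_distr_def by (auto intro!: subspaceI simp: h_simps)

text \<open>Extend u to a coordinate field V and represent \<open>h(V, .)\<close> on D: the
  representing field is the D-part of V, and the remainder is orthogonal to D. Splitting the whole
  field, not only u, provides local sections of both bundles through the parts of u.\<close>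

lemma tangent_decomposition:
  obtains W X Y where "open W" "p \<in> W" "smooth_field AN W X" "\<And>q. q \<in> W \<Longrightarrow> X q \<in> D q"
    "smooth_field AN W Y" "\<And>q. q \<in> W \<Longrightarrow> Y q \<in> Dp q" "u = X p + Y p"
proof -
  obtain c where c: "c \<in> AN" "p \<in> fst c" "open (fst c)" "smooth_field AN (fst c) (coord_field AN c u)"
    "coord_field AN c u p = u"
    by (rule coord_extension)
  let ?V = "coord_field AN c u"
  have lin: "linear (h q (?V q))" for q
    using h_bilinear by (simp add: bilinear_def)
  have sm: "vsmooth AN V (\<lambda>q. h q (?V q) (X q))" if "open V" "V \<subseteq> fst c" "smooth_field AN V X" for V X
    by (rule smooth_h[OF that(1) smooth_field_subset[OF c(4) that(2)] that(3)])
  obtain V P where P: "open V" "p \<in> V" "V \<subseteq> fst c" "smooth_field AN V P"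
    "\<And>q. q \<in> V \<Longrightarrow> P q \<in> D q" "\<And>q v. q \<in> V \<Longrightarrow> v \<in> D q \<Longrightarrow> h q (P q) v = h q (?V q) v"
    by (rule N.represent_functional[where E = D and h = h and W = "fst c" and p = p and L = "\<lambda>q. h q (?V q)"];
        (rule distr h_bilinear c(3) c(2) lin | (rule sm h_nondegenerate_D smooth_h that; assumption)))
  have "smooth_field AN V (\<lambda>q. ?V q + (- 1) *\<^sub>R P q)"
    by (intro N.smooth_field_add N.smooth_field_scaleR N.vsmooth_const P smooth_field_subset[OF c(4)])
  then have "smooth_field AN V (\<lambda>q. ?V q - P q)" by simp
  moreover have "?V q - P q \<in> Dp q" if "q \<in> V" for q
    using P(6)[OF that] by (auto simp: orth_distr_def h_simps)
  ultimately show thesis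
    using that[of V P "\<lambda>q. ?V q - P q"] P(1,2,4,5) c(5) by simp
qed

lemma tangent_decomposition_at:
  obtains x y where "x \<in> D p" "y \<in> Dp p" "u = x + y"
proof -
  obtain W X Y where W: "open W" and X: "p \<in> W" "smooth_field AN W X" "\<And>q. q \<in> W \<Longrightarrow> X q \<in> D q"
    and Y: "smooth_field AN W Y" "\<And>q. q \<in> W \<Longrightarrow> Y q \<in> Dp q" "u = X p + Y p"
    by (rule tangent_decomposition[of p u]) (rule that, assumption+)
  show thesis
    by (rule that[OF X(3)[OF X(1)] Y(2)[OF X(1)] Y(3)])
qed

lemma D_Int_Dp: "u \<in> D p \<Longrightarrow> u \<in> Dp p \<Longrightarrow> u = 0"
  by (rule h_nondegenerate_D) (auto simp: orth_distr_def)

text \<open>Split y by \<open>tangent_decomposition\<close>. The part orthogonal to D vanishes at p,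
  because it also lies in D there, so the other part is a local section of D through y.\<close>

lemma D_extension:
  assumes y: "y \<in> D p"
  obtains Y where "Y \<in> sections AN D" "Y p = y"
proof -
  obtain W X Y where X: "open W" "p \<in> W" "smooth_field AN W X" "\<And>q. q \<in> W \<Longrightarrow> X q \<in> D q"
    and "smooth_field AN W Y" and Y: "\<And>q. q \<in> W \<Longrightarrow> Y q \<in> Dp q" "y = X p + Y p"
    by (rule tangent_decomposition[of p y]) (rule that, assumption+)
  have "Y p = y - X p" using Y(2) by simp
  also have "\<dots> \<in> D p" by (rule subspace_diff[OF subspace_D y X(4)[OF X(2)]])
  finally have "Y p = 0" using D_Int_Dp[of "Y p" p] Y(1)[OF X(2)] by simp
  then have "y = X p" using Y(2) by simp
  moreover obtain Z where "Z \<in> sections AN D" "Z p = X p"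
    by (rule N.extend_to_section[OF X(1-4) subspace_D])
  ultimately show thesis using that by simp
qed

lemma Dp_extension:
  assumes y: "y \<in> Dp p"
  obtains Y where "Y \<in> sections AN Dp" "Y p = y"
proof -
  obtain W X Y where W: "open W" and X: "p \<in> W" "smooth_field AN W X" "\<And>q. q \<in> W \<Longrightarrow> X q \<in> D q"
    and Y: "smooth_field AN W Y" "\<And>q. q \<in> W \<Longrightarrow> Y q \<in> Dp q" "y = X p + Y p"
    by (rule tangent_decomposition[of p y]) (rule that, assumption+)
  have "X p = y - Y p" using Y(3) by simp
  also have "\<dots> \<in> Dp p" by (rule subspace_diff[OF subspace_Dp y Y(2)[OF X(1)]])
  finally have "X p = 0" using D_Int_Dp[OF X(3)[OF X(1)]] by simp
  then have "y = Y p" using Y(3) by simp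
  moreover obtain Z where "Z \<in> sections AN Dp" "Z p = Y p"
    by (rule N.extend_to_section[OF W X(1) Y(1,2) subspace_Dp])
  ultimately show thesis using that by simp
qed

text \<open>D is its own double orthogonal complement; for an indefinite metric this rests on the
  splitting. The \<open>Dp\<close>-part of u is orthogonal to both parts of every tangent vector,
  and \<open>h\<close> is nondegenerate on TN.\<close>

lemma D_eq_orth: "u \<in> D p \<longleftrightarrow> (\<forall>v\<in>Dp p. h p u v = 0)"
proof
  assume "u \<in> D p"
  then show "\<forall>v\<in>Dp p. h p u v = 0" by (auto simp: orth_distr_def h_sym)
next
  assume u: "\<forall>v\<in>Dp p. h p u v = 0"
  obtain x y where x: "x \<in> D p" and y: "y \<in> Dp p" "u = x + y"
    by (rule tangent_decomposition_at)
  have "y = 0"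
  proof (rule h_nondegenerate)
    fix v
    obtain x' y' where x': "x' \<in> D p" and y': "y' \<in> Dp p" "v = x' + y'"
      by (rule tangent_decomposition_at)
    have 0: "h p x' y = 0" "h p x y' = 0"
      using x x' y(1) y'(1) by (auto simp: orth_distr_def h_sym[of p x] h_sym[of p x'])
    have "h p y y' = h p u y' - h p x y'" by (simp add: y(2) h_simps)
    then have "h p y' y = 0" using u y'(1) 0(2) h_sym[of p y' y] by simp
    then show "h p y v = 0"
      using 0(1) h_sym[of p y v] by (simp add: y'(2) h_simps)
  qed
  then show "u \<in> D p" using x y(2) by simp
qed

end

section \<open>Second fundamental form and shape operator\<close>

context CR_submanifold
begin

lemma normal_D: "w \<in> normal p \<Longrightarrow> g (f p) w (df p u) = 0"
  by (simp add: normal_space_def)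

lemma subspace_normal: "subspace (normal p)"
  unfolding normal_space_def by (auto intro!: subspaceI simp: g_simps)

lemma B_def: "B X Y p = conn p (X p) (\<lambda>q. df q (Y q)) - df p (nabN p (X p) Y)"
  by (simp add: second_fundamental_form_def)

context
  fixes W :: "'n set" and p :: 'n
  assumes W: "open W" and p: "p \<in> W"
begin

text \<open>Neither connection has torsion: both skew-symmetrised derivatives equal the bracket of X
  and Y, pushed forward by f, and cancel.\<close>

lemma B_sym:
  assumes X: "smooth_field AN W X" and Y: "smooth_field AN W Y"
  shows "B X Y p = B Y X p"
proof -
  have "is_lie_bracket AN W X Y (\<lambda>p. nabN p (X p) Y - nabN p (Y p) X)"
    using lcN[unfolded levi_civita_def, THEN conjunct2, THEN conjunct1, rule_format, of W X Y] W X Y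
    by simp
  from conn_along_torsion_free[OF lcM this W p X Y] show ?thesis
    by (simp add: B_def df_simps algebra_simps)
qed

text \<open>Both connections are metric, so the derivative of \<open>h(Y, Z)\<close> can be computed
  in two ways; subtracting the results gives skewness in Y and Z.\<close>

lemma conn_along_df_df:
  assumes Y: "smooth_field AN W Y" and Z: "smooth_field AN W Z"
  shows "g (f p) (conn p v (\<lambda>q. df q (Y q)) - df p (nabN p v Y)) (df p (Z p)) =
    - g (f p) (conn p v (\<lambda>q. df q (Z q)) - df p (nabN p v Z)) (df p (Y p))"
proof -
  have "vderiv AN p v (\<lambda>q. h q (Y q) (Z q)) = h p (nabN p v Y) (Z p) + h p (Y p) (nabN p v Z)"
    using lcN[unfolded levi_civita_def, THEN conjunct2, THEN conjunct2, rule_format, of W Y Z p v] W p Y Z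
    by (simp add: dir_deriv_eq_vderiv)
  moreover have "vderiv AN p v (\<lambda>q. h q (Y q) (Z q)) =
      g (f p) (conn p v (\<lambda>q. df q (Y q))) (df p (Z p)) + g (f p) (df p (Y p)) (conn p v (\<lambda>q. df q (Z q)))"
    unfolding h_def by (rule conn_along_metric[OF g lcM W p along_mdiff[OF Y W] along_mdiff[OF Z W]])
  ultimately show ?thesis
    using g_sym[of "f p" "df p (Y p)" "conn p v (\<lambda>q. df q (Z q))"]
      g_sym[of "f p" "df p (Y p)" "df p (nabN p v Z)"]
    by (simp add: g_simps h_def)
qed

end

text \<open>The tensor \<open>(X, Y, Z) \<mapsto> g(B(X, Y), Z)\<close> is symmetric in the first two and skew in the last two
  arguments, hence zero.\<close>

lemma B_normal:
  assumes W: "open W" and p: "p \<in> W" and X: "smooth_field AN W X" and Y: "smooth_field AN W Y"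
  shows "B X Y p \<in> normal p"
proof -
  have "g (f p) (B X Y p) (df p u) = 0" for u
  proof -
    obtain c where c: "c \<in> AN" "p \<in> fst c" "open (fst c)" "smooth_field AN (fst c) (coord_field AN c u)"
      "coord_field AN c u p = u"
      by (rule coord_extension)
    let ?V = "W \<inter> fst c" and ?Z = "coord_field AN c u"
    have V: "open ?V" "p \<in> ?V" using W p c by auto
    have X': "smooth_field AN ?V X" and Y': "smooth_field AN ?V Y" and Z': "smooth_field AN ?V ?Z"
      by (rule smooth_field_subset[OF X], simp, rule smooth_field_subset[OF Y], simp,
          rule smooth_field_subset[OF c(4)], simp)
    let ?T = "\<lambda>X Y Z. g (f p) (B X Y p) (df p (Z p))"
    have skew: "?T X Y Z = - ?T X Z Y" if "smooth_field AN ?V Y" "smooth_field AN ?V Z" for X Y Z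
      using conn_along_df_df[OF V that] by (simp add: B_def)
    have sym: "?T X Y Z = ?T Y X Z" if "smooth_field AN ?V X" "smooth_field AN ?V Y" for X Y Z
      using B_sym[OF V that] by simp
    \<comment> \<open>Alternating the two exchanges six times runs through all orders of the three
      fields and returns to the first one after three changes of sign.\<close>
    have "?T X Y ?Z = - ?T X Y ?Z"
      using sym[OF X' Y', of ?Z] skew[OF X' Z', of Y] sym[OF Y' Z', of X] skew[OF Y' X', of ?Z]
        sym[OF Z' X', of Y] skew[OF Z' Y', of X] by simp
    then show ?thesis using c(5) by simp
  qed
  then show ?thesis by (simp add: normal_space_def)
qed

text \<open>The first argument of \<open>B\<close> enters only through its value at p, so a constant
  function serves although it need not be a smooth field. The second one is differentiated and is
  extended with constant components in the preferred chart.\<close>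

definition B_tensor :: "'n \<Rightarrow> 'f \<Rightarrow> 'f \<Rightarrow> 'e" where
  "B_tensor p x y = B (\<lambda>_. x) (coord_field AN (chart_at AN p) y) p"

text \<open>Dependence on the value of X alone is built into \<open>B\<close>. Symmetry moves Y into
  that slot, where it can be replaced by the coordinate field with the same value at p, and moves it
  back.\<close>

lemma B_eq_B_tensor:
  assumes W: "open W" and p: "p \<in> W" and Y: "smooth_field AN W Y"
  shows "B X Y p = B_tensor p (X p) (Y p)"
proof -
  let ?c = "chart_at AN p"
  let ?x = "coord_field AN ?c"
  let ?V = "W \<inter> fst ?c"
  have V: "open ?V" "p \<in> ?V" using W p N.chart_at N.open_chart[OF N.chart_at(1)] by auto
  have x: "smooth_field AN ?V (?x u)" for u
    by (rule smooth_field_subset[OF N.smooth_field_coord_field[OF N.chart_at(1)]]) simp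
  have Y': "smooth_field AN ?V Y" by (rule smooth_field_subset[OF Y]) simp
  have "B X Y p = B (?x (X p)) Y p" by (simp add: B_def)
  also have "\<dots> = B Y (?x (X p)) p" by (rule B_sym[OF V x Y'])
  also have "\<dots> = B (?x (Y p)) (?x (X p)) p" by (simp add: B_def)
  also have "\<dots> = B (?x (X p)) (?x (Y p)) p" by (rule B_sym[OF V x x])
  also have "\<dots> = B_tensor p (X p) (Y p)" by (simp add: B_def B_tensor_def)
  finally show ?thesis .
qed

lemma B_tensor_sym: "B_tensor p x y = B_tensor p y x"
proof -
  note c = N.chart_at[of p]
  let ?x = "coord_field AN (chart_at AN p)"
  have "B_tensor p x y = B (?x x) (?x y) p"
    using B_eq_B_tensor[OF N.open_chart[OF c(1)] c(2) N.smooth_field_coord_field[OF c(1)], of "?x x" y] by simp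
  also have "\<dots> = B (?x y) (?x x) p"
    by (rule B_sym[OF N.open_chart[OF c(1)] c(2)]) (rule N.smooth_field_coord_field[OF c(1)])+
  also have "\<dots> = B_tensor p y x"
    using B_eq_B_tensor[OF N.open_chart[OF c(1)] c(2) N.smooth_field_coord_field[OF c(1)], of "?x y" x] by simp
  finally show ?thesis .
qed

lemma B_tensor_normal: "B_tensor p x y \<in> normal p"
proof -
  note c = N.chart_at[of p]
  let ?x = "coord_field AN (chart_at AN p)"
  have "B (?x x) (?x y) p \<in> normal p"
    by (rule B_normal[OF N.open_chart[OF c(1)] c(2)]) (rule N.smooth_field_coord_field[OF c(1)])+
  then show ?thesis
    using B_eq_B_tensor[OF N.open_chart[OF c(1)] c(2) N.smooth_field_coord_field[OF c(1)], of "?x x" y] by simp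
qed

lemma conn_along_df:
  assumes W: "open W" and p: "p \<in> W" and Y: "smooth_field AN W Y"
  shows "conn p v (\<lambda>q. df q (Y q)) = df p (nabN p v Y) + B_tensor p v (Y p)"
  using B_eq_B_tensor[OF W p Y, of "\<lambda>_. v"] by (simp add: B_def algebra_simps)

text \<open>Differentiate g(\<xi>, df(Y)) = 0 for an extension Y of u; the tangential part of the
  derivative of \<open>df(Y)\<close> is orthogonal to \<xi>, which leaves
  \<open>B_tensor\<close>.\<close>

lemma conn_along_normal:
  assumes W: "open W" and p: "p \<in> W" and \<xi>: "along AN AM f W \<xi>"
    and n: "\<And>q. q \<in> W \<Longrightarrow> \<xi> q \<in> normal q"
  shows "g (f p) (conn p v \<xi>) (df p u) = - g (f p) (\<xi> p) (B_tensor p v u)"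
proof -
  obtain c where c: "c \<in> AN" "p \<in> fst c" "open (fst c)" "smooth_field AN (fst c) (coord_field AN c u)"
    "coord_field AN c u p = u"
    by (rule coord_extension)
  let ?V = "W \<inter> fst c" and ?Y = "coord_field AN c u"
  have V: "open ?V" "p \<in> ?V" using W p c by auto
  have Y: "smooth_field AN ?V ?Y" and \<xi>': "along AN AM f ?V \<xi>"
    by (rule smooth_field_subset[OF c(4)], simp, rule along_subset[OF \<xi>], simp)
  have "vderiv AN p v (\<lambda>q. g (f q) (\<xi> q) (df q (?Y q))) = vderiv AN p v (\<lambda>q. 0)"
    by (rule N.vderiv_cong[OF V]) (use n normal_D in auto)
  also have "\<dots> = 0" by (rule N.vderiv_const)
  finally have "g (f p) (conn p v \<xi>) (df p u) + g (f p) (\<xi> p) (conn p v (\<lambda>q. df q (?Y q))) = 0"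
    using conn_along_metric[OF g lcM V \<xi>' along_mdiff[OF Y V(1)], of v] c(5) by simp
  then show ?thesis
    unfolding conn_along_df[OF V Y] using c(5) normal_D[OF n[OF p]] by (simp add: g_simps)
qed

text \<open>To see that the definite description denotes something, represent
  \<open>u \<mapsto> - g(\<nabla>\<^sub>X \<xi>, df u)\<close> by \<open>h\<close> on all of TN. The
  representing field P is smooth, and adding \<open>df(P)\<close> to the derivative of \<xi> leaves
  a normal vector, so no frame of the normal bundle is required.\<close>

lemma shape_operator:
  assumes \<xi>: "along AN AM f UNIV \<xi>" and n: "\<And>q. \<xi> q \<in> normal q" and X: "smooth_field AN UNIV X"
  shows "smooth_field AN UNIV (Sh \<xi> X)" and "h p (Sh \<xi> X p) u = g (f p) (\<xi> p) (B_tensor p (X p) u)"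
proof -
  have *: "\<exists>V. open V \<and> p \<in> V \<and> smooth_field AN V (Sh \<xi> X) \<and>
      (\<forall>u. h p (Sh \<xi> X p) u = g (f p) (\<xi> p) (B_tensor p (X p) u))" for p
  proof -
    \<comment> \<open>The sign is that of the Weingarten formula.\<close>
    let ?L = "\<lambda>q u. - g (f q) (conn q (X q) \<xi>) (df q u)"
    have lin: "linear (?L q)" for q
      using linear_compose[OF linear_mdiff linear_compose_neg[OF g_linear(2)]] by (simp add: o_def)
    have sm: "vsmooth AN V (\<lambda>q. ?L q (Y q))" if V: "open V" and Y: "smooth_field AN V Y" for V Y
      by (rule N.vsmooth_bounded_linear[OF V bounded_linear_minus[OF bounded_linear_ident]])
        (rule vsmooth_metric[OF g V along_subset[OF along_conn_along[OF open_UNIV \<xi> X]] along_mdiff[OF Y V]], simp)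
    obtain V P where P: "open V" "p \<in> V" "smooth_field AN V P"
      "\<And>q u. q \<in> V \<Longrightarrow> h q (P q) u = ?L q u"
    proof (rule N.represent_functional[where E = "\<lambda>_. UNIV" and h = h and W = UNIV and p = p and L = ?L])
      show "distribution AN (\<lambda>_. UNIV)" by (rule N.distribution_UNIV)
      show "u = 0" if "\<forall>v\<in>UNIV. h q u v = 0" for q u
        by (rule h_nondegenerate[of q]) (use that in simp)
      show "vsmooth AN V (\<lambda>q. h q (X q) (Y q))"
        if "open V" "smooth_field AN V X" "smooth_field AN V Y" for V X Y
        by (rule smooth_h[OF that])
      show "vsmooth AN V (\<lambda>q. ?L q (Y q))" if "open V" "smooth_field AN V Y" for V Y
        by (rule sm[OF that])
    qed (simp_all add: h_bilinear lin that)
    have Sh: "Sh \<xi> X q = P q" if q: "q \<in> V" for q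
      unfolding shape_operator_def
    proof (rule the_equality)
      show "\<exists>w\<in>normal q. conn q (X q) \<xi> = - df q (P q) + w"
        using P(4)[OF q]
        by (intro bexI[of _ "conn q (X q) \<xi> + df q (P q)"]) (auto simp: normal_space_def g_simps h_def)
      fix a assume "\<exists>w\<in>normal q. conn q (X q) \<xi> = - df q a + w"
      then obtain w where w: "w \<in> normal q" "conn q (X q) \<xi> = - df q a + w" by blast
      \<comment> \<open>Uniqueness: two admissible tangential parts have the same products with all
        tangent vectors.\<close>
      have "a - P q = 0"
      proof (rule h_nondegenerate)
        fix u
        have "h q (P q) u = h q a u"
          unfolding P(4)[OF q] w(2) using normal_D[OF w(1)] by (simp add: g_simps h_def)
        then show "h q (a - P q) u = 0" by (simp add: h_simps)
      qed
      then show "a = P q" by simp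
    qed
    have "smooth_field AN V (Sh \<xi> X)"
      by (rule N.smooth_field_cong[OF P(1) _ P(3)]) (simp add: Sh)
    moreover have "h p (Sh \<xi> X p) u = g (f p) (\<xi> p) (B_tensor p (X p) u)" for u
      using P(4)[OF P(2)] conn_along_normal[OF open_UNIV _ \<xi> n] by (simp add: Sh[OF P(2)])
    ultimately show ?thesis using P(1,2) by blast
  qed
  show "smooth_field AN UNIV (Sh \<xi> X)"
  proof (rule N.smooth_field_local[OF open_UNIV])
    show "\<exists>V. open V \<and> p \<in> V \<and> smooth_field AN V (Sh \<xi> X)" for p
      using *[of p] by blast
  qed
  show "h p (Sh \<xi> X p) u = g (f p) (\<xi> p) (B_tensor p (X p) u)"
    using *[of p] by blast
qed

section \<open>Canonical local bases along the submanifold\<close>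

lemma CR_J:
  assumes "canonical_basis AM \<sigma> U J" "f p \<in> U"
  shows "J \<alpha> (f p) ` df p ` D p = df p ` D p" and "J \<alpha> (f p) ` df p ` Dp p \<subseteq> normal p"
  using CR[unfolded paraquaternionic_CR_submanifold_def, THEN conjunct2, THEN conjunct2, THEN conjunct2,
      rule_format, of U J p \<alpha>] assms by simp_all

context
  fixes U J p assumes J: "canonical_basis AM \<sigma> U J" and p: "f p \<in> U"
begin

lemma J_D:
  assumes "x \<in> D p"
  obtains y where "y \<in> D p" "J \<alpha> (f p) (df p x) = df p y"
proof -
  have "J \<alpha> (f p) ` df p ` D p = df p ` D p" by (rule CR_J(1)[OF J p])
  then have "J \<alpha> (f p) (df p x) \<in> df p ` D p" using assms by blast
  then obtain y where "y \<in> D p" "J \<alpha> (f p) (df p x) = df p y"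
    by (elim imageE) simp
  then show thesis by (rule that)
qed

lemma J_D_surj:
  assumes "y \<in> D p"
  obtains x where "x \<in> D p" "J \<alpha> (f p) (df p x) = df p y"
proof -
  have "J \<alpha> (f p) ` df p ` D p = df p ` D p" by (rule CR_J(1)[OF J p])
  then have "df p y \<in> J \<alpha> (f p) ` df p ` D p" using assms by blast
  then obtain x where "x \<in> D p" "df p y = J \<alpha> (f p) (df p x)"
    by (elim imageE) simp
  then show thesis by (intro that[of x]) simp_all
qed

lemma J_Dp: "u \<in> Dp p \<Longrightarrow> J \<alpha> (f p) (df p u) \<in> normal p"
  using CR_J(2)[OF J p, of \<alpha>] by auto

lemma g_J: "g (f p) (J \<alpha> (f p) u) (J \<alpha> (f p) v) = eps \<alpha> * g (f p) u v"
  using herm[unfolded almost_paraquaternionic_hermitian_def, THEN conjunct2, THEN conjunct2,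
      rule_format, OF J p] .

text \<open>The CR condition names only the members of a canonical basis; they span \<sigma>, and
  the normal space is a subspace. Needed because the derivative of \<open>J\<^sub>\<alpha>\<close>
  is just some element of \<sigma>.\<close>

lemma \<sigma>_Dp: "t \<in> \<sigma> (f p) \<Longrightarrow> u \<in> Dp p \<Longrightarrow> blinfun_apply t (df p u) \<in> normal p"
proof -
  assume "t \<in> \<sigma> (f p)" and u: "u \<in> Dp p"
  then have "t \<in> span (range (\<lambda>\<alpha>. J \<alpha> (f p)))"
    using J p unfolding canonical_basis_def by blast
  then show ?thesis
  proof (induction rule: span_induct_alt)
    case base
    show ?case using subspace_0[OF subspace_normal] by simp
  next
    case (step c s t)
    then obtain \<alpha> where "s = J \<alpha> (f p)" by blast
    then show ?case
      using subspace_add[OF subspace_normal subspace_scale[OF subspace_normal J_Dp[OF u]] step(2)]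
      by (simp add: blinfun.add_left blinfun.scaleR_left)
  qed
qed

lemma nu_perp_memI: "(\<And>\<alpha>. u \<alpha> \<in> Dp p) \<Longrightarrow> (\<Sum>\<alpha>\<in>UNIV. J \<alpha> (f p) (df p (u \<alpha>))) \<in> nup p"
  unfolding nu_perp_def by (intro CollectI exI[of _ U] exI[of _ J] exI[of _ u] conjI J p allI refl)

lemma J_Dp_nu_perp: "u \<in> Dp p \<Longrightarrow> J \<alpha> (f p) (df p u) \<in> nup p"
proof -
  assume u: "u \<in> Dp p"
  \<comment> \<open>A single image is written as a sum over all three indices with zero in the other
    two slots.\<close>
  let ?u = "\<lambda>\<beta>. if \<beta> = \<alpha> then u else 0"
  have "J \<beta> (f p) (df p (?u \<beta>)) = (if \<beta> = \<alpha> then J \<alpha> (f p) (df p u) else 0)" for \<beta>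
    by (simp add: df_simps)
  then have "(\<Sum>\<beta>\<in>UNIV. J \<beta> (f p) (df p (?u \<beta>))) = J \<alpha> (f p) (df p u)"
    by (simp only:) (simp add: sum.delta)
  then show ?thesis
    using nu_perp_memI[of ?u] u subspace_0[OF subspace_Dp] by simp
qed

end

lemma nu_perpE:
  assumes "z \<in> nup p"
  obtains U J u where "canonical_basis AM \<sigma> U J" "f p \<in> U" "\<And>\<alpha>. u \<alpha> \<in> Dp p"
    "z = (\<Sum>\<alpha>\<in>UNIV. J \<alpha> (f p) (df p (u \<alpha>)))"
proof -
  obtain U J u where "canonical_basis AM \<sigma> U J" "f p \<in> U" "\<forall>\<alpha>. u \<alpha> \<in> Dp p"
    "z = (\<Sum>\<alpha>\<in>UNIV. J \<alpha> (f p) (df p (u \<alpha>)))"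
    using assms unfolding nu_perp_def by (elim CollectE exE conjE)
  then show thesis by (intro that[of U J u]) simp_all
qed

lemma canonical_basis_at:
  obtains U J where "canonical_basis AM \<sigma> U J" "m \<in> U"
  using apq[unfolded almost_paraquaternionic_def, THEN conjunct1, rule_format, of m] by (elim exE conjE)

lemma nu_perp_zero: "0 \<in> nup p"
proof -
  obtain U J where J: "canonical_basis AM \<sigma> U J" "f p \<in> U" by (rule canonical_basis_at)
  show ?thesis
    using J_Dp_nu_perp[OF J subspace_0[OF subspace_Dp]] by (simp add: df_simps)
qed

lemma nu_perp_normal: "z \<in> nup p \<Longrightarrow> z \<in> normal p"
  by (erule nu_perpE) (simp add: subspace_sum[OF subspace_normal] J_Dp)

lemma along_J:
  assumes J: "canonical_basis AM \<sigma> U J" and Z: "smooth_field AN (f -` U) Z"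
  shows "along AN AM f (f -` U) (\<lambda>q. J \<alpha> (f q) (df q (Z q)))"
proof -
  have U: "open U" "smooth_endo AM U (J \<alpha>)"
    using J by (simp_all add: canonical_basis_def)
  show ?thesis
    by (rule along_endo[OF U(2,1) open_vimage_f[OF U(1)] order_refl along_mdiff[OF Z open_vimage_f[OF U(1)]]])
qed

text \<open>Extend the three components of z to global sections of \<open>Dp\<close> and apply the
  canonical basis. The basis exists over U only, so the result is cut off there.\<close>

lemma nu_perp_extension:
  assumes "z \<in> nup p"
  obtains \<xi> where "\<xi> \<in> sections_along AN AM f nup" "\<xi> p = z"
proof -
  obtain U J u where J: "canonical_basis AM \<sigma> U J" "f p \<in> U" and u: "\<And>\<alpha>. u \<alpha> \<in> Dp p"
    and z: "z = (\<Sum>\<alpha>\<in>UNIV. J \<alpha> (f p) (df p (u \<alpha>)))"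
    by (rule nu_perpE[OF assms]) (rule that, assumption+)
  have "\<exists>Z. Z \<in> sections AN Dp \<and> Z p = u \<alpha>" for \<alpha>
    using Dp_extension[OF u[of \<alpha>]] by metis
  then obtain Z where Z: "\<And>\<alpha>. Z \<alpha> \<in> sections AN Dp" "\<And>\<alpha>. Z \<alpha> p = u \<alpha>"
    by metis
  have oU: "open (f -` U)" using J by (auto simp: canonical_basis_def intro: open_vimage_f)
  have Zs: "smooth_field AN (f -` U) (Z \<alpha>)" for \<alpha>
    by (rule smooth_field_subset[OF _ subset_UNIV]) (use Z(1)[of \<alpha>] in \<open>simp add: sections_def\<close>)
  let ?\<xi> = "\<lambda>q. \<Sum>\<alpha>\<in>UNIV. J \<alpha> (f q) (df q (Z \<alpha> q))"
  have "along AN AM f (f -` U) ?\<xi>"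
    by (rule along_sum[OF oU], rule along_J[OF J(1) Zs])
  then obtain k where k: "along AN AM f UNIV (\<lambda>q. k q *\<^sub>R ?\<xi> q)" "k p = 1"
      "\<And>q. q \<notin> f -` U \<Longrightarrow> k q = 0"
    using along_bump[OF oU _, of ?\<xi> p] J(2) by auto
  have "k q *\<^sub>R ?\<xi> q \<in> nup q" for q
  proof (cases "f q \<in> U")
    case True
    \<comment> \<open>Membership in \<open>nu_perp\<close> means having a representation by some
      canonical basis, so the cut-off factor is moved into the components of that
      representation.\<close>
    have "k q *\<^sub>R Z \<alpha> q \<in> Dp q" for \<alpha>
      using Z(1)[of \<alpha>] by (intro subspace_scale[OF subspace_Dp]) (simp add: sections_def)
    from nu_perp_memI[OF J(1) True this] show ?thesis
      by (simp add: df_simps blinfun.scaleR_right scaleR_sum_right)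
  qed (use k(3) nu_perp_zero in auto)
  then show thesis
    by (intro that[of "\<lambda>q. k q *\<^sub>R ?\<xi> q"])
      (use k z Z(2) in \<open>auto simp: sections_along_def smooth_along_iff_along\<close>)
qed

lemma eps_square: "eps \<alpha> * eps \<alpha> = 1"
  by (simp add: eps_def)

text \<open>Transport \<open>g(\<nabla>\<^sub>x Z, y)\<close> by the isometry or anti-isometry \<open>J\<^sub>\<alpha>\<close>; as \<open>\<sigma>\<close> is parallel, the derivative
  of \<open>J\<^sub>\<alpha>\<close> contributes only a normal vector.\<close>

lemma h_nab_Dp:
  assumes J: "canonical_basis AM \<sigma> U J" and p: "f p \<in> U"
    and Z: "Z \<in> sections AN Dp" and y: "J \<alpha> (f p) (df p y) = df p y'"
  shows "h p (nabN p x Z) y = - eps \<alpha> * g (f p) (J \<alpha> (f p) (df p (Z p))) (B_tensor p x y')"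
proof -
  have Zs: "smooth_field AN UNIV Z" and ZD: "\<And>q. Z q \<in> Dp q" using Z by (auto simp: sections_def)
  let ?W = "f -` U"
  have U: "open U" "smooth_endo AM U (J \<alpha>)"
    using J by (simp_all add: canonical_basis_def)
  have J\<sigma>: "J \<alpha> m \<in> \<sigma> m" if "m \<in> U" for m
  proof -
    have "span (range (\<lambda>\<alpha>. J \<alpha> m)) = \<sigma> m" using J that unfolding canonical_basis_def by blast
    then show ?thesis using span_base[of "J \<alpha> m" "range (\<lambda>\<alpha>. J \<alpha> m)"] by blast
  qed
  have W: "open ?W" "p \<in> ?W" using open_vimage_f[OF U(1)] p by auto
  have Zs': "smooth_field AN ?W Z" by (rule smooth_field_subset[OF Zs]) simp
  let ?Z = "\<lambda>q. df q (Z q)" and ?JZ = "\<lambda>q. J \<alpha> (f q) (df q (Z q))"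
  have n: "?JZ q \<in> normal q" if "q \<in> ?W" for q
    by (rule J_Dp[OF J _ ZD]) (use that in simp)
  have "\<exists>t\<in>\<sigma> (f p). conn p x ?JZ = J \<alpha> (f p) (conn p x ?Z) + blinfun_apply t (?Z p)"
    by (rule conn_along_parallel_endo[OF par U _ W(1) order_refl W(2) along_mdiff[OF Zs' W(1)]]) (rule J\<sigma>)
  then obtain t where t: "t \<in> \<sigma> (f p)" "conn p x ?JZ = J \<alpha> (f p) (conn p x ?Z) + blinfun_apply t (?Z p)"
    by (elim bexE)
  have "h p (nabN p x Z) y = g (f p) (conn p x ?Z) (df p y)"
    unfolding conn_along_df[OF W Zs'] using normal_D[OF B_tensor_normal] by (simp add: g_simps h_def)
  \<comment> \<open>\<open>g_J\<close> puts the factor on the other side; as its square is 1, it can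
    be moved across.\<close>
  also have "\<dots> = eps \<alpha> * g (f p) (J \<alpha> (f p) (conn p x ?Z)) (df p y')"
    using g_J[OF J p, of \<alpha> "conn p x ?Z" "df p y"] eps_square[of \<alpha>] y by (simp flip: mult.assoc)
  also have "g (f p) (J \<alpha> (f p) (conn p x ?Z)) (df p y') = g (f p) (conn p x ?JZ) (df p y')"
    unfolding t(2) using normal_D[OF \<sigma>_Dp[OF J p t(1) ZD]] by (simp add: g_simps)
  also have "\<dots> = - g (f p) (?JZ p) (B_tensor p x y')"
    by (rule conn_along_normal[OF W along_J[OF J Zs'] n])
  finally show ?thesis by simp
qed

section \<open>The four assertions compared with one pointwise condition\<close>

definition mixed_condition :: bool where
  "mixed_condition \<longleftrightarrow> (\<forall>p. \<forall>x\<in>D p. \<forall>y\<in>Dp p. \<forall>z\<in>nup p. g (f p) (B_tensor p x y) z = 0)"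

text \<open>Only for this assertion is an element of \<open>nu_perp\<close> taken apart into its
  three summands. \<open>h_nab_Dp\<close> expresses the D-component of the derivative of a section Z
  of \<open>Dp\<close> by \<open>B_tensor\<close> paired with \<open>J\<^sub>\<alpha> Z\<close>; the
  derivative is taken in a direction of \<open>Dp\<close>, so symmetry of \<open>B_tensor\<close>
  brings it to the mixed form.\<close>

lemma totally_geodesic_iff: "totally_geodesic_foliation AN nabN Dp \<longleftrightarrow> mixed_condition"
proof
  assume tg: "totally_geodesic_foliation AN nabN Dp"
  show mixed_condition
    unfolding mixed_condition_def
  proof (intro allI ballI)
    fix p x y z assume x: "x \<in> D p" and y: "y \<in> Dp p" and zn: "z \<in> nup p"
    obtain U J u where J: "canonical_basis AM \<sigma> U J" "f p \<in> U" and u: "\<And>\<alpha>. u \<alpha> \<in> Dp p"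
      and z: "z = (\<Sum>\<alpha>\<in>UNIV. J \<alpha> (f p) (df p (u \<alpha>)))"
      by (rule nu_perpE[OF zn]) (rule that, assumption+)
    obtain Y where Y: "Y \<in> sections AN Dp" "Y p = y" by (rule Dp_extension[OF y])
    have "g (f p) (J \<alpha> (f p) (df p (u \<alpha>))) (B_tensor p y x) = 0" for \<alpha>
    proof -
      obtain Z where Z: "Z \<in> sections AN Dp" "Z p = u \<alpha>" by (rule Dp_extension[OF u])
      \<comment> \<open>The given x has to appear as the image under
        \<open>J\<^sub>\<alpha>\<close>, so its preimage in D is the vector to test against.\<close>
      obtain x0 where x0: "x0 \<in> D p" "J \<alpha> (f p) (df p x0) = df p x" by (rule J_D_surj[OF J x])
      have "(\<lambda>p. nabN p (Y p) Z) \<in> sections AN Dp"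
        using tg[unfolded totally_geodesic_foliation_def, rule_format, OF Y(1) Z(1)] .
      then have "nabN p y Z \<in> Dp p" using Y(2) by (auto simp: sections_def)
      then have "h p (nabN p y Z) x0 = 0" using x0(1) by (simp add: orth_distr_def)
      then show ?thesis
        using h_nab_Dp[OF J Z(1) x0(2), of y] Z(2) by (simp add: eps_def split: if_splits)
    qed
    then show "g (f p) (B_tensor p x y) z = 0"
      unfolding z B_tensor_sym[of p x y] by (simp add: g_simps g_sym[of _ "B_tensor p y x"])
  qed
next
  assume m: mixed_condition
  show "totally_geodesic_foliation AN nabN Dp"
    unfolding totally_geodesic_foliation_def
  proof (intro ballI)
    fix X Z assume X: "X \<in> sections AN Dp" and Z: "Z \<in> sections AN Dp"
    have "smooth_field AN UNIV (\<lambda>p. nabN p (X p) Z)"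
      using X Z CN.smooth_field_nab[OF open_UNIV, of X Z] by (simp add: sections_def)
    moreover have "nabN p (X p) Z \<in> Dp p" for p
      unfolding orth_distr_def
    proof (intro CollectI ballI)
      fix y assume y: "y \<in> D p"
      obtain U J where J: "canonical_basis AM \<sigma> U J" "f p \<in> U" by (rule canonical_basis_at)
      \<comment> \<open>Any fixed index would serve here: one of the three relations already
        determines the D-component.\<close>
      obtain y' where y': "y' \<in> D p" "J 1 (f p) (df p y) = df p y'" by (rule J_D[OF J y])
      have "Z p \<in> Dp p" "X p \<in> Dp p" using X Z by (auto simp: sections_def)
      then have "g (f p) (B_tensor p y' (X p)) (J 1 (f p) (df p (Z p))) = 0"
        using m y'(1) J_Dp_nu_perp[OF J] unfolding mixed_condition_def by blast
      then show "h p (nabN p (X p) Z) y = 0"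
        using h_nab_Dp[OF J Z y'(2), of "X p"] B_tensor_sym[of p y' "X p"]
          g_sym[of "f p" "B_tensor p y' (X p)"] by simp
    qed
    ultimately show "(\<lambda>p. nabN p (X p) Z) \<in> sections AN Dp" by (simp add: sections_def)
  qed
qed

lemma along_B:
  assumes X: "smooth_field AN UNIV X" and Y: "smooth_field AN UNIV Y"
  shows "along AN AM f UNIV (B X Y)"
proof -
  have "along AN AM f UNIV (\<lambda>p. conn p (X p) (\<lambda>q. df q (Y q)) + (- 1) *\<^sub>R df p (nabN p (X p) Y))"
    by (intro along_add along_conn_along along_scaleR along_mdiff N.vsmooth_const open_UNIV X Y
        CN.smooth_field_nab)
  moreover have "B X Y = (\<lambda>p. conn p (X p) (\<lambda>q. df q (Y q)) + (- 1) *\<^sub>R df p (nabN p (X p) Y))"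
    by (rule ext) (simp add: B_def)
  ultimately show ?thesis by simp
qed

text \<open>Membership in \<open>nu\<close> also asks for normality, which
  \<open>B_tensor_normal\<close> supplies; the rest is the pointwise condition read through
  \<open>B_eq_B_tensor\<close>.\<close>

lemma second_fundamental_form_iff:
  "(\<forall>X\<in>sections AN D. \<forall>Y\<in>sections AN Dp. B X Y \<in> sections_along AN AM f (nu AN AM f \<sigma> g D))
    \<longleftrightarrow> mixed_condition"
proof
  assume *: "\<forall>X\<in>sections AN D. \<forall>Y\<in>sections AN Dp. B X Y \<in> sections_along AN AM f (nu AN AM f \<sigma> g D)"
  show mixed_condition
    unfolding mixed_condition_def
  proof (intro allI ballI)
    fix p x y z assume x: "x \<in> D p" and y: "y \<in> Dp p" and z: "z \<in> nup p"
    obtain X where X: "X \<in> sections AN D" "X p = x" by (rule D_extension[OF x])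
    obtain Y where Y: "Y \<in> sections AN Dp" "Y p = y" by (rule Dp_extension[OF y])
    have "B X Y p \<in> nu AN AM f \<sigma> g D p"
      using * X(1) Y(1) by (auto simp: sections_along_def)
    then have "g (f p) (B X Y p) z = 0" using z by (simp add: nu_def)
    then show "g (f p) (B_tensor p x y) z = 0"
      using B_eq_B_tensor[OF open_UNIV _, of p Y X] X Y by (simp add: sections_def)
  qed
next
  assume m: mixed_condition
  show "\<forall>X\<in>sections AN D. \<forall>Y\<in>sections AN Dp. B X Y \<in> sections_along AN AM f (nu AN AM f \<sigma> g D)"
  proof (intro ballI)
    fix X Y assume "X \<in> sections AN D" "Y \<in> sections AN Dp"
    then have X: "smooth_field AN UNIV X" "\<And>p. X p \<in> D p"
      and Y: "smooth_field AN UNIV Y" "\<And>p. Y p \<in> Dp p"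
      by (auto simp: sections_def)
    have e: "B X Y p = B_tensor p (X p) (Y p)" for p
      by (rule B_eq_B_tensor[OF open_UNIV _ Y(1)]) simp
    have "B X Y p \<in> nu AN AM f \<sigma> g D p" for p
      unfolding nu_def e using m X(2) Y(2) B_tensor_normal by (auto simp: mixed_condition_def)
    then show "B X Y \<in> sections_along AN AM f (nu AN AM f \<sigma> g D)"
      using along_B[OF X(1) Y(1)] by (simp add: sections_along_def smooth_along_iff_along)
  qed
qed

lemma shape_operator_nu_perp:
  assumes "\<xi> \<in> sections_along AN AM f nup" "X \<in> sections AN E"
  shows "smooth_field AN UNIV (Sh \<xi> X)" and "h p (Sh \<xi> X p) u = g (f p) (B_tensor p (X p) u) (\<xi> p)"
proof -
  have \<xi>: "along AN AM f UNIV \<xi>" "\<And>q. \<xi> q \<in> normal q"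
    using assms(1) nu_perp_normal by (auto simp: sections_along_def smooth_along_iff_along)
  have X: "smooth_field AN UNIV X" using assms(2) by (simp add: sections_def)
  show "smooth_field AN UNIV (Sh \<xi> X)" by (rule shape_operator(1)[OF \<xi> X])
  show "h p (Sh \<xi> X p) u = g (f p) (B_tensor p (X p) u) (\<xi> p)"
    using shape_operator(2)[OF \<xi> X] g_sym by simp
qed

lemma shape_operator_Dp_iff:
  "(\<forall>X\<in>sections AN Dp. \<forall>\<xi>\<in>sections_along AN AM f nup. Sh \<xi> X \<in> sections AN Dp) \<longleftrightarrow> mixed_condition"
proof
  assume *: "\<forall>X\<in>sections AN Dp. \<forall>\<xi>\<in>sections_along AN AM f nup. Sh \<xi> X \<in> sections AN Dp"
  show mixed_condition
    unfolding mixed_condition_def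
  proof (intro allI ballI)
    fix p x y z assume x: "x \<in> D p" and y: "y \<in> Dp p" and z: "z \<in> nup p"
    obtain Y where Y: "Y \<in> sections AN Dp" "Y p = y" by (rule Dp_extension[OF y])
    obtain \<xi> where \<xi>: "\<xi> \<in> sections_along AN AM f nup" "\<xi> p = z" by (rule nu_perp_extension[OF z])
    have "Sh \<xi> Y p \<in> Dp p" using * Y(1) \<xi>(1) by (auto simp: sections_def)
    then have "h p (Sh \<xi> Y p) x = 0" using x by (simp add: orth_distr_def)
    then show "g (f p) (B_tensor p x y) z = 0"
      using shape_operator_nu_perp(2)[OF \<xi>(1) Y(1), of p x] Y(2) \<xi>(2) B_tensor_sym[of p x y] by simp
  qed
next
  assume m: mixed_condition
  show "\<forall>X\<in>sections AN Dp. \<forall>\<xi>\<in>sections_along AN AM f nup. Sh \<xi> X \<in> sections AN Dp"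
  proof (intro ballI)
    fix X \<xi> assume X: "X \<in> sections AN Dp" and \<xi>: "\<xi> \<in> sections_along AN AM f nup"
    have "Sh \<xi> X p \<in> Dp p" for p
      unfolding orth_distr_def
    proof (intro CollectI ballI)
      fix v assume v: "v \<in> D p"
      have "X p \<in> Dp p" "\<xi> p \<in> nup p" using X \<xi> by (auto simp: sections_def sections_along_def)
      then have "g (f p) (B_tensor p v (X p)) (\<xi> p) = 0" using m v unfolding mixed_condition_def by blast
      then show "h p (Sh \<xi> X p) v = 0"
        using shape_operator_nu_perp(2)[OF \<xi> X] B_tensor_sym[of p v "X p"] by simp
    qed
    then show "Sh \<xi> X \<in> sections AN Dp"
      using shape_operator_nu_perp(1)[OF \<xi> X] by (simp add: sections_def)
  qed
qed

lemma shape_operator_D_iff: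
  "(\<forall>Y\<in>sections AN D. \<forall>\<xi>\<in>sections_along AN AM f nup. Sh \<xi> Y \<in> sections AN D) \<longleftrightarrow> mixed_condition"
proof
  assume *: "\<forall>Y\<in>sections AN D. \<forall>\<xi>\<in>sections_along AN AM f nup. Sh \<xi> Y \<in> sections AN D"
  show mixed_condition
    unfolding mixed_condition_def
  proof (intro allI ballI)
    fix p x y z assume x: "x \<in> D p" and y: "y \<in> Dp p" and z: "z \<in> nup p"
    obtain X where X: "X \<in> sections AN D" "X p = x" by (rule D_extension[OF x])
    obtain \<xi> where \<xi>: "\<xi> \<in> sections_along AN AM f nup" "\<xi> p = z" by (rule nu_perp_extension[OF z])
    have "Sh \<xi> X p \<in> D p" using * X(1) \<xi>(1) by (auto simp: sections_def)
    then have "h p (Sh \<xi> X p) y = 0" using y D_eq_orth by blast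
    then show "g (f p) (B_tensor p x y) z = 0"
      using shape_operator_nu_perp(2)[OF \<xi>(1) X(1), of p y] X(2) \<xi>(2) by simp
  qed
next
  assume m: mixed_condition
  show "\<forall>Y\<in>sections AN D. \<forall>\<xi>\<in>sections_along AN AM f nup. Sh \<xi> Y \<in> sections AN D"
  proof (intro ballI)
    fix Y \<xi> assume Y: "Y \<in> sections AN D" and \<xi>: "\<xi> \<in> sections_along AN AM f nup"
    have "Sh \<xi> Y p \<in> D p" for p
      unfolding D_eq_orth
    proof
      fix v assume v: "v \<in> Dp p"
      have "Y p \<in> D p" "\<xi> p \<in> nup p" using Y \<xi> by (auto simp: sections_def sections_along_def)
      then have "g (f p) (B_tensor p (Y p) v) (\<xi> p) = 0" using m v unfolding mixed_condition_def by blast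
      then show "h p (Sh \<xi> Y p) v = 0"
        using shape_operator_nu_perp(2)[OF \<xi> Y] by simp
    qed
    then show "Sh \<xi> Y \<in> sections AN D"
      using shape_operator_nu_perp(1)[OF \<xi> Y] by (simp add: sections_def)
  qed
qed

end

theorem theorem5p1:
  fixes AM :: "('m::{t2_space,second_countable_topology}, 'e::euclidean_space) chart set"
    and AN :: "('n::{t2_space,second_countable_topology}, 'f::euclidean_space) chart set"
    and \<sigma> :: "'m \<Rightarrow> ('e \<Rightarrow>\<^sub>L 'e) set"
    and g :: "'m \<Rightarrow> 'e \<Rightarrow> 'e \<Rightarrow> real"
    and nabM :: "('m, 'e) connection"
    and nabN :: "('n, 'f) connection"
    and f :: "'n \<Rightarrow> 'm"
    and D :: "'n \<Rightarrow> 'f set"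
  assumes "paraquaternionic_kaehler AM \<sigma> g nabM"
    and "paraquaternionic_CR_submanifold AN AM f \<sigma> g D"
    and "levi_civita AN (induced_metric AN AM f g) nabN"
  shows "let Dp = orth_distr (induced_metric AN AM f g) D;
             B = second_fundamental_form AN AM f nabM nabN;
             Sh = shape_operator AN AM f g nabM;
             \<Gamma>D = sections AN D;
             \<Gamma>Dp = sections AN Dp;
             \<Gamma>\<nu> = sections_along AN AM f (nu AN AM f \<sigma> g D);
             \<Gamma>\<nu>p = sections_along AN AM f (nu_perp AN AM f \<sigma> g D);
             i = totally_geodesic_foliation AN nabN Dp;
             ii = (\<forall>X\<in>\<Gamma>D. \<forall>Y\<in>\<Gamma>Dp. B X Y \<in> \<Gamma>\<nu>);
             iii = (\<forall>X\<in>\<Gamma>Dp. \<forall>\<xi>\<in>\<Gamma>\<nu>p. Sh \<xi> X \<in> \<Gamma>Dp);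
             iv = (\<forall>Y\<in>\<Gamma>D. \<forall>\<xi>\<in>\<Gamma>\<nu>p. Sh \<xi> Y \<in> \<Gamma>D)
         in (i \<longleftrightarrow> ii) \<and> (ii \<longleftrightarrow> iii) \<and> (iii \<longleftrightarrow> iv)"
proof -
  interpret CR_submanifold AM AN \<sigma> g nabM nabN f D
    using assms by unfold_locales
  show ?thesis
    unfolding Let_def totally_geodesic_iff second_fundamental_form_iff shape_operator_Dp_iff
      shape_operator_D_iff by simp
qed

end
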